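(* Let $n\ge 3$ and let $M=\Gamma\backslash\mathbb{H}^n$ be a complete finite-volume hyperbolic $n$-manifold, with $\Gamma\subset SO^+(n,1)$ a torsion-free lattice, containing a branched totally geodesic hypersurface $\Delta$ with branching locus $\mathscr{B}$. Let $c_{n-1}$ be the number of $(n-1)$-dimensional complementary regions (connected components) of $\Delta\setminus\mathscr{B}$, and let $c_{n-2}$ be the number of connected components of $\mathscr{B}$. Let $\tilde\Delta$ be the preimage of $\Delta$ in the universal cover $\tilde M=\mathbb{H}^n$, and suppose that for every connected component $\delta$ of $\tilde M\setminus\tilde\Delta$ the setwise stabilizer $\mathrm{Fix}_\Gamma(\delta)=\{\gamma\in\Gamma:\gamma\delta=\delta\}$ is Zariski-dense in $SO^+(n,1)$. Then $$\dim_{\mathbb{R}} H^1(\Gamma,\mathbb{R}^{n,1})\ \ge\ c_{n-1}-2c_{n-2}.$$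
   Context: $\mathbb{R}^{n,1}$ denotes $\mathbb{R}^{n+1}$ with a quadratic form of signature $(n,1)$, on which $\Gamma\subset SO^+(n,1)=\mathrm{Isom}^+(\mathbb{H}^n)$ acts by the standard linear representation (it arises as the $SO(n,1)$-invariant complement in the splitting $\mathfrak{so}(n+1,1)=\mathfrak{so}(n,1)\oplus\mathbb{R}^{n,1}$). $H^1(\Gamma,\cdot)$ is group cohomology. A branched totally geodesic hypersurface $\Delta\subset M$ with branching locus $\mathscr{B}\subset\Delta$ is a (closed) piecewise totally geodesic complex of $(n-1)$-dimensional faces meeting along an $(n-2)$-dimensional locus: $\mathscr{B}$ has finitely many connected components ("bindings"), each a totally geodesic piece of codimension 2 in $M$ (so each lift to $\mathbb{H}^n$ lies in a totally geodesic copy of $\mathbb{H}^{n-2}$); $\Delta\setminus\mathscr{B}$ has finitely many connected components ("walls"), each a totally geodesic piece of codimension 1 in $M$ (so each lift lies in a totally geodesic copy of $\mathbb{H}^{n-1}$); and the walls meet one another along the bindings. *)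

theory Defs
  imports "HOL-Analysis.Analysis" "HOL-Algebra.Group"
begin

text \<open>Throughout, the hyperbolic dimension is \<open>n = CARD('n)\<close>. Coordinates of \<open>\<real>\<^sup>n\<^sup>,\<^sup>1\<close> are indexed by
  \<open>'n option\<close>: \<open>Some i\<close> are the \<open>n\<close> spacelike coordinates and \<open>None\<close> is the timelike one.\<close>

type_synonym 'n mink = "real ^ 'n option"
type_synonym 'n mink_mat = "real ^ 'n option ^ 'n option"

definition lorentz :: "'n::finite mink \<Rightarrow> 'n mink \<Rightarrow> real" where
  "lorentz x y = (\<Sum>i\<in>UNIV. x $ Some i * y $ Some i) - x $ None * y $ None"

definition hyperboloid :: "'n::finite mink set" where
  "hyperboloid = {x. lorentz x x = -1 \<and> x $ None > 0}"

definition SO_plus :: "'n::finite mink_mat monoid" where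
  "SO_plus = \<lparr>carrier = {A. (\<forall>x y. lorentz (A *v x) (A *v y) = lorentz x y) \<and> det A = 1 \<and>
                          (*v) A ` hyperboloid = hyperboloid},
              mult = (**), one = mat 1\<rparr>"

text \<open>The hyperboloid is the graph of \<open>x \<mapsto> sqrt (1 + |x|\<^sup>2)\<close> over \<open>\<real>\<^sup>n\<close>. In this chart the hyperbolic
  metric is \<open>I - x x\<^sup>T / (1 + |x|\<^sup>2)\<close>, which has determinant \<open>1 / (1 + |x|\<^sup>2)\<close>.\<close>

definition graph_point :: "real ^ 'n::finite \<Rightarrow> 'n mink" where
  "graph_point x = (\<chi> k. case k of None \<Rightarrow> sqrt (1 + (norm x)\<^sup>2) | Some i \<Rightarrow> x $ i)"

definition hyp_volume :: "'n::finite mink set \<Rightarrow> ennreal" where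
  "hyp_volume D =
    (\<integral>\<^sup>+x. ennreal (1 / sqrt (1 + (norm x)\<^sup>2)) * indicator D (graph_point x) \<partial>lborel)"

text \<open>\<open>D\<close> is a strict (Borel) fundamental domain. A torsion-free discrete group acts freely on
  hyperbolic space, so it has one, and the volume of the quotient is the volume of any of them.\<close>

definition finite_covolume :: "'n::finite mink_mat set \<Rightarrow> bool" where
  "finite_covolume \<Gamma> \<longleftrightarrow>
    (\<exists>D. D \<in> sets borel \<and> D \<subseteq> hyperboloid \<and> (\<forall>x\<in>hyperboloid. \<exists>!g. g \<in> \<Gamma> \<and> g *v x \<in> D) \<and>
         hyp_volume D < \<infinity>)"

definition torsion_free_lattice :: "'n::finite mink_mat set \<Rightarrow> bool" where
  "torsion_free_lattice \<Gamma> \<longleftrightarrow>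
    subgroup \<Gamma> SO_plus \<and> discrete \<Gamma> \<and> finite_covolume \<Gamma> \<and>
    (\<forall>g\<in>\<Gamma>. \<forall>k::nat. k > 0 \<longrightarrow> g [^]\<^bsub>SO_plus\<^esub> k = \<one>\<^bsub>SO_plus\<^esub> \<longrightarrow> g = \<one>\<^bsub>SO_plus\<^esub>)"

definition orbit :: "'n::finite mink_mat set \<Rightarrow> 'n mink \<Rightarrow> 'n mink set" where
  "orbit \<Gamma> x = (\<lambda>g. g *v x) ` \<Gamma>"

definition lift :: "'n::finite mink_mat set \<Rightarrow> 'n mink set set \<Rightarrow> 'n mink set" where
  "lift \<Gamma> S = {x \<in> hyperboloid. orbit \<Gamma> x \<in> S}"

definition quotient_manifold :: "'n::finite mink_mat set \<Rightarrow> 'n mink set topology" where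
  "quotient_manifold \<Gamma> =
    topology (\<lambda>U. U \<subseteq> orbit \<Gamma> ` hyperboloid \<and> openin (top_of_set hyperboloid) (lift \<Gamma> U))"

lemma openin_quotient_manifold:
  "openin (quotient_manifold \<Gamma>) U \<longleftrightarrow>
    U \<subseteq> orbit \<Gamma> ` hyperboloid \<and> openin (top_of_set hyperboloid) (lift \<Gamma> U)"
proof -
  have int: "lift \<Gamma> (S \<inter> T) = lift \<Gamma> S \<inter> lift \<Gamma> T" for S T
    by (auto simp: lift_def)
  have un: "lift \<Gamma> (\<Union>K) = (\<Union>S\<in>K. lift \<Gamma> S)" for K
    by (auto simp: lift_def)
  have "istopology (\<lambda>U. U \<subseteq> orbit \<Gamma> ` hyperboloid \<and>
          openin (top_of_set hyperboloid) (lift \<Gamma> U))"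
    unfolding istopology_def by (auto simp: int un intro!: openin_Union)
  then show ?thesis
    by (simp add: quotient_manifold_def topology_inverse')
qed

text \<open>A totally geodesic copy of \<open>\<H>\<^sup>n\<^sup>-\<^sup>k\<close>: a nonempty slice of the hyperboloid by a linear subspace of
  codimension \<open>k\<close> in \<open>\<real>\<^sup>n\<^sup>,\<^sup>1\<close>.\<close>

definition hyp_subspace :: "nat \<Rightarrow> 'n::finite mink set \<Rightarrow> bool" where
  "hyp_subspace k P \<longleftrightarrow>
    P \<noteq> {} \<and> (\<exists>V. subspace V \<and> dim V + k = CARD('n) + 1 \<and> P = hyperboloid \<inter> V)"

definition half_hyperplane :: "'n::finite mink set \<Rightarrow> 'n mink set \<Rightarrow> bool" where
  "half_hyperplane P F \<longleftrightarrow>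
    (\<exists>Q v. hyp_subspace 1 Q \<and> P = {x \<in> Q. lorentz v x = 0} \<and> F = {x \<in> Q. lorentz v x \<ge> 0})"

definition totally_geodesic :: "nat \<Rightarrow> 'n::finite mink set \<Rightarrow> bool" where
  "totally_geodesic k S \<longleftrightarrow>
    (\<forall>x\<in>S. \<exists>U P. openin (top_of_set hyperboloid) U \<and> x \<in> U \<and> hyp_subspace k P \<and> S \<inter> U = P \<inter> U) \<and>
    (\<forall>C\<in>components S. \<exists>P. hyp_subspace k P \<and> C \<subseteq> P)"

text \<open>The bindings (walls) of \<open>\<Delta>\<close> are the connected components, in the quotient manifold, of \<open>B\<close>
  (of \<open>\<Delta> - B\<close>). Upstairs, every point of the lifted branching locus has a neighbourhood in which the
  lift of \<open>\<Delta>\<close> is an open book: finitely many, but at least two, half-hyperplanes meeting along the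
  binding. No lower bound of three is imposed, and \<open>B\<close> may be empty.\<close>

definition branched_hypersurface ::
    "'n::finite mink_mat set \<Rightarrow> 'n mink set set \<Rightarrow> 'n mink set set \<Rightarrow> bool" where
  "branched_hypersurface \<Gamma> \<Delta> B \<longleftrightarrow>
    closedin (quotient_manifold \<Gamma>) \<Delta> \<and> closedin (quotient_manifold \<Gamma>) B \<and> B \<subseteq> \<Delta> \<and>
    finite (connected_components_of (subtopology (quotient_manifold \<Gamma>) B)) \<and>
    finite (connected_components_of (subtopology (quotient_manifold \<Gamma>) (\<Delta> - B))) \<and>
    totally_geodesic 2 (lift \<Gamma> B) \<and>
    totally_geodesic 1 (lift \<Gamma> (\<Delta> - B)) \<and>
    (\<forall>x\<in>lift \<Gamma> B. \<exists>U P \<F>. openin (top_of_set hyperboloid) U \<and> x \<in> U \<and> hyp_subspace 2 P \<and>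
        finite \<F> \<and> card \<F> \<ge> 2 \<and> (\<forall>F\<in>\<F>. half_hyperplane P F) \<and>
        lift \<Gamma> B \<inter> U = P \<inter> U \<and> lift \<Gamma> \<Delta> \<inter> U = \<Union>\<F> \<inter> U)"

definition num_walls :: "'n::finite mink_mat set \<Rightarrow> 'n mink set set \<Rightarrow> 'n mink set set \<Rightarrow> nat" where
  "num_walls \<Gamma> \<Delta> B = card (connected_components_of (subtopology (quotient_manifold \<Gamma>) (\<Delta> - B)))"

definition num_bindings :: "'n::finite mink_mat set \<Rightarrow> 'n mink set set \<Rightarrow> nat" where
  "num_bindings \<Gamma> B = card (connected_components_of (subtopology (quotient_manifold \<Gamma>) B))"

definition zariski_closed :: "'n::finite mink_mat set \<Rightarrow> bool" where
  "zariski_closed Z \<longleftrightarrow>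
    (\<exists>\<P>. (\<forall>p\<in>\<P>. real_polynomial_function p) \<and> Z = {A. \<forall>p\<in>\<P>. p A = 0})"

text \<open>Density for the Zariski topology that \<open>G\<close> inherits from the affine space of matrices. As
  \<open>det = 1\<close> on \<open>SO_plus\<close>, polynomials in the matrix entries are all the regular functions.\<close>

definition zariski_dense_in :: "'n::finite mink_mat set \<Rightarrow> 'n mink_mat set \<Rightarrow> bool" where
  "zariski_dense_in S G \<longleftrightarrow> S \<subseteq> G \<and> (\<forall>Z. zariski_closed Z \<and> S \<subseteq> Z \<longrightarrow> G \<subseteq> Z)"

definition set_stabilizer :: "'n::finite mink_mat set \<Rightarrow> 'n mink set \<Rightarrow> 'n mink_mat set" where
  "set_stabilizer \<Gamma> \<delta> = {g \<in> \<Gamma>. (\<lambda>x. g *v x) ` \<delta> = \<delta>}"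

text \<open>Inhomogeneous cochains; a 1-cochain on \<open>\<Gamma>\<close> is represented by its extension by zero to all
  matrices.\<close>

definition cocycles1 :: "'n::finite mink_mat set \<Rightarrow> ('n mink_mat \<Rightarrow> 'n mink) set" where
  "cocycles1 \<Gamma> = {f. (\<forall>g. g \<notin> \<Gamma> \<longrightarrow> f g = 0) \<and>
                     (\<forall>g\<in>\<Gamma>. \<forall>h\<in>\<Gamma>. f (g ** h) = f g + g *v f h)}"

definition coboundaries1 :: "'n::finite mink_mat set \<Rightarrow> ('n mink_mat \<Rightarrow> 'n mink) set" where
  "coboundaries1 \<Gamma> = range (\<lambda>v g. if g \<in> \<Gamma> then g *v v - v else 0)"

text \<open>The dimension of \<open>Z / W\<close>, for spaces \<open>W \<subseteq> Z\<close> of vector-valued functions: the supremum of the sizes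
  of finite subsets of \<open>Z\<close> whose classes are linearly independent in the quotient. It is \<open>\<infinity>\<close> if the
  quotient is infinite-dimensional.\<close>

definition quotient_dim :: "('a \<Rightarrow> 'v::real_vector) set \<Rightarrow> ('a \<Rightarrow> 'v) set \<Rightarrow> enat" where
  "quotient_dim Z W = Sup {enat (card S) | S. finite S \<and> S \<subseteq> Z \<and>
     (\<forall>c. (\<lambda>g. \<Sum>s\<in>S. c s *\<^sub>R s g) \<in> W \<longrightarrow> (\<forall>s\<in>S. c s = 0))}"

definition dim_H1 :: "'n::finite mink_mat set \<Rightarrow> enat" where
  "dim_H1 \<Gamma> = quotient_dim (cocycles1 \<Gamma>) (coboundaries1 \<Gamma>)"

end

theory Submission
  imports Defs
begin

text \<open>The cohomology classes are produced by bending. Work in the open convex cone \<open>timecone\<close> of future timelike vectors,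
which retracts radially onto the hyperboloid; a totally geodesic hyperplane becomes a linear hyperplane
\<open>e\<^sup>\<bottom>\<close> with \<open>lorentz e e = 1\<close>. Given a real weight \<open>t w\<close> for every wall \<open>w\<close> of the quotient, look for a
function \<open>\<Psi>\<close> on the cone that is locally linear off the lifted hypersurface and that near a point of a lift of \<open>w\<close>
is a linear function plus \<open>t w * \<bar>lorentz e z\<bar>\<close>. Since the absolute value removes the choice of sign of
\<open>e\<close>, this requirement is invariant under \<open>\<Gamma>\<close>, and two solutions differ by a linear function
(\<open>solves_near_diff_linear\<close>). Hence, off the lifted bindings, \<open>\<Psi> z - \<Psi> (g z)\<close> is linear in \<open>z\<close> for each \<open>g \<in> \<Gamma>\<close>, and writing it
as \<open>lorentz (f g) (g z)\<close> gives a cocycle \<open>f\<close> with values in \<open>\<real>\<^sup>n\<^sup>,\<^sup>1\<close> (\<open>bending_cocycle_in_cocycles1\<close>).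

The only obstruction to the existence of \<open>\<Psi>\<close> sits at the bindings. In the normal plane of a binding the
pages of the hypersurface are rays in unit directions \<open>u\<close>, and a piecewise linear function of the plane
that bends by the weights \<open>t\<^sub>u\<close> along them exists if \<open>\<Sum> t\<^sub>u u = 0\<close>: the multivalued expressions
\<open>arg(z/u) Im(z/u)\<close>, weighted by \<open>t\<^sub>u\<close>, then add up to a function without any dependence on the branch of
the argument (\<open>balanced_rays_break\<close>). This is a condition with two real components, it is locally constant
along the lifted bindings and \<open>\<Gamma>\<close>-invariant, so each binding of the quotient imposes two linear
equations on \<open>t\<close>. When they hold, local solutions exist everywhere, and they can be matched to a global
one because the cone is convex: the defects form a locally additive cocycle with a potential
(\<open>local_cocycle_potential\<close>, \<open>solves_near_glue\<close>).

Finally the class of \<open>f\<close> determines \<open>t\<close>. If \<open>f\<close> is a coboundary, then after subtracting a linear function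
\<open>\<Psi>\<close> is \<open>\<Gamma>\<close>-invariant. On the cone over a complementary region \<open>\<delta>\<close> it is \<open>lorentz v\<close> for some \<open>v\<close>, and \<open>v\<close>
is fixed by the stabilizer of \<open>\<delta>\<close>. Fixing \<open>v\<close> is a polynomial condition, so by Zariski density all of
\<open>SO_plus\<close> fixes \<open>v\<close> and \<open>v = 0\<close> (\<open>invariant_solution_vanishes_off_D\<close>). Thus \<open>\<Psi>\<close> vanishes off the
hypersurface and cannot bend along any wall (\<open>weight_zero_if_vanishing_off_D\<close>). The weights form a space
of dimension at least the number of walls minus twice the number of bindings, and that is the bound.\<close>

section \<open>Potentials of local cocycles on convex sets\<close>

lemma telescoping_local_cocycle:
  fixes c :: "'a \<Rightarrow> 'a \<Rightarrow> 'b::ab_group_add"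
  assumes add: "\<And>u v w. u \<in> S \<Longrightarrow> v \<in> S \<Longrightarrow> w \<in> S \<Longrightarrow> c u v + c v w = c u w"
    and a: "\<And>j. j \<le> M \<Longrightarrow> a j \<in> S"
  shows "(\<Sum>j<M. c (a j) (a (Suc j))) = c (a 0) (a M)"
  using a
proof (induction M)
  case 0
  have "c (a 0) (a 0) + c (a 0) (a 0) = c (a 0) (a 0)"
    by (rule add) (use 0 in auto)
  then show ?case by simp
next
  case (Suc M)
  then show ?case using add[of "a 0" "a M" "a (Suc M)"] by simp
qed

text \<open>A two-point function that is additive at small scale is locally a coboundary on a convex set: its first
Alexander--Spanier class vanishes. The potential at \<open>x\<close> is the sum of \<open>c\<close> over a fine subdivision of the
segment from a base point to \<open>x\<close>. By compactness of the segment there is a Lebesgue number below which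
\<open>c\<close> is additive, so refining the subdivision leaves the sum unchanged, and moving \<open>x\<close> to a nearby \<open>y\<close>
changes it by \<open>c x y\<close>.\<close>

lemma local_cocycle_potential:
  fixes c :: "'a::real_normed_vector \<Rightarrow> 'a \<Rightarrow> 'b::ab_group_add"
  assumes C: "convex C"
    and loc: "\<And>x. x \<in> C \<Longrightarrow> \<exists>r>0. \<forall>u\<in>C \<inter> ball x r. \<forall>v\<in>C \<inter> ball x r. \<forall>w\<in>C \<inter> ball x r.
                 c u v + c v w = c u w"
  obtains h where "\<And>x. x \<in> C \<Longrightarrow> \<exists>r>0. \<forall>y\<in>C \<inter> ball x r. c x y = h y - h x"
proof (cases "C = {}")
  case True
  then show ?thesis using that by blast
next
  case False
  then obtain o' where o: "o' \<in> C" by blast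
  define p where "p N x i = o' + (real i / real N) *\<^sub>R (x - o')" for N :: nat and x and i :: nat
  define S where "S N x = (\<Sum>i<N. c (p N x i) (p N x (Suc i)))" for N :: nat and x
  have p_C: "p N x i \<in> C" if "x \<in> C" "i \<le> N" for N x i
  proof -
    have "p N x i = (1 - real i / real N) *\<^sub>R o' + (real i / real N) *\<^sub>R x"
      by (simp add: p_def algebra_simps)
    then show ?thesis
      using convexD_alt[OF C o that(1), of "real i / real N"] that(2)
      by (cases "N = 0") (auto simp: field_simps)
  qed
  have p_seg: "p N x i \<in> closed_segment o' x" if "i \<le> N" for N x i
    unfolding p_def closed_segment_def using that
    by (cases "N = 0") (auto intro!: exI[of _ "real i / real N"] simp: algebra_simps)
  have leb: "\<exists>e>0. \<forall>z\<in>closed_segment o' x. \<forall>u\<in>C \<inter> ball z e. \<forall>v\<in>C \<inter> ball z e. \<forall>w\<in>C \<inter> ball z e.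
                 c u v + c v w = c u w" if x: "x \<in> C" for x
  proof -
    obtain r where r: "\<And>y. y \<in> C \<Longrightarrow> r y > 0" and
      rc: "\<And>y u v w. \<lbrakk>y \<in> C; u \<in> C \<inter> ball y (r y); v \<in> C \<inter> ball y (r y); w \<in> C \<inter> ball y (r y)\<rbrakk>
             \<Longrightarrow> c u v + c v w = c u w"
      using loc by metis
    have "closed_segment o' x \<subseteq> C"
      using C o x by (simp add: closed_segment_subset)
    then have cover: "closed_segment o' x \<subseteq> \<Union>((\<lambda>y. ball y (r y)) ` C)"
      using r by force
    obtain e where "0 < e" and e: "\<forall>z\<in>closed_segment o' x. \<exists>G\<in>(\<lambda>y. ball y (r y)) ` C. ball z e \<subseteq> G"
      using Heine_Borel_lemma[OF compact_segment cover] by (metis (no_types, lifting) imageE open_ball)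
    show ?thesis
    proof (intro exI[of _ e] conjI ballI \<open>0 < e\<close>)
      fix z u v w
      assume z: "z \<in> closed_segment o' x"
        and uvw: "u \<in> C \<inter> ball z e" "v \<in> C \<inter> ball z e" "w \<in> C \<inter> ball z e"
      obtain y where y: "y \<in> C" "ball z e \<subseteq> ball y (r y)" using e z by auto
      show "c u v + c v w = c u w" by (rule rc[OF y(1)]) (use uvw y(2) in auto)
    qed
  qed
  have step: "dist (p N x i) (p N x j) \<le> dist o' x * (real j - real i) / real N"
    if "i \<le> j" "N > 0" for N x i j
  proof -
    have "p N x i - p N x j = ((real i - real j) / real N) *\<^sub>R (x - o')"
      by (simp add: p_def algebra_simps diff_divide_distrib)
    then show ?thesis using that by (simp add: dist_norm norm_minus_commute mult.commute)
  qed
  \<comment> \<open>Once the mesh is below the Lebesgue number, refining the subdivision no longer changes the sum.\<close>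
  have refine: "\<exists>N0>0. \<forall>N\<ge>N0. \<forall>M>0. S (N * M) x = S N x" if x: "x \<in> C" for x
  proof -
    obtain e where "0 < e" and e: "\<And>z u v w. \<lbrakk>z \<in> closed_segment o' x; u \<in> C \<inter> ball z e;
        v \<in> C \<inter> ball z e; w \<in> C \<inter> ball z e\<rbrakk> \<Longrightarrow> c u v + c v w = c u w"
      using leb[OF x] by blast
    obtain N0 where N0: "real N0 > dist o' x / e" using reals_Archimedean2 by blast
    have "S (N * M) x = S N x" if N: "N \<ge> Suc N0" and M: "M > 0" for N M
    proof -
      have small: "dist o' x / real N < e"
      proof -
        have "dist o' x < real N0 * e" using N0 \<open>0 < e\<close> by (simp add: field_simps)
        also have "\<dots> \<le> real N * e" using N \<open>0 < e\<close> by (intro mult_right_mono) auto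
        finally show ?thesis using N by (simp add: field_simps)
      qed
      have "S (N * M) x = (\<Sum>k<N. sum (\<lambda>i. c (p (N * M) x i) (p (N * M) x (Suc i))) {k*M..<k*M+M})"
        unfolding S_def by (rule sum.nat_group[symmetric])
      also have "\<dots> = (\<Sum>k<N. \<Sum>j<M. c (p (N * M) x (k*M+j)) (p (N * M) x (Suc (k*M+j))))"
        by (rule sum.cong[OF refl], subst sum.atLeastLessThan_shift_0) (simp add: o_def lessThan_atLeast0)
      also have "\<dots> = (\<Sum>k<N. c (p N x k) (p N x (Suc k)))"
      proof (rule sum.cong[OF refl])
        fix k assume k: "k \<in> {..<N}"
        have same: "p (N * M) x (k*M+j) = o' + ((real k + real j / real M) / real N) *\<^sub>R (x - o')" for j
          using M N by (simp add: p_def field_simps)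
        have "(\<Sum>j<M. c (p (N * M) x (k*M+j)) (p (N * M) x (k*M+Suc j)))
              = c (p (N * M) x (k*M+0)) (p (N * M) x (k*M+M))"
        proof (rule telescoping_local_cocycle[where S = "C \<inter> ball (p N x k) e"])
          fix j assume j: "j \<le> M"
          have kM: "k * M + M \<le> N * M" using k by (metis Suc_leI add.commute lessThan_iff mult_Suc mult_le_mono1)
          have pk: "p N x k = p (N*M) x (k*M)" using same[of 0] M by (simp add: p_def)
          have "dist (p N x k) (p (N * M) x (k * M + j)) \<le> dist o' x * real j / real (N * M)"
            unfolding pk using step[of "k*M" "k*M+j" "N*M" x] M N by simp
          also have "\<dots> \<le> dist o' x * real M / real (N * M)"
            using j by (intro divide_right_mono mult_left_mono) auto
          also have "\<dots> = dist o' x / real N" using M by simp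
          finally have "dist (p N x k) (p (N * M) x (k * M + j)) < e" using small by simp
          then show "p (N * M) x (k * M + j) \<in> C \<inter> ball (p N x k) e"
            using p_C[OF x, of "k*M+j" "N*M"] kM j by auto
        qed (rule e[OF p_seg[of k N x]], use k in auto)
        moreover have "p (N * M) x (k*M+0) = p N x k" using same[of 0] M by (simp add: p_def)
        moreover have "p (N * M) x (k*M+M) = p N x (Suc k)" using same[of M] M by (simp add: p_def add.commute)
        ultimately show "(\<Sum>j<M. c (p (N * M) x (k*M+j)) (p (N * M) x (Suc (k*M+j)))) = c (p N x k) (p N x (Suc k))"
          by simp
      qed
      finally show ?thesis by (simp add: S_def)
    qed
    then show ?thesis by (intro exI[of _ "Suc N0"]) auto
  qed
  \<comment> \<open>Moving the end point: the strip between two subdivided segments is a ladder of small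
      quadrilaterals, and summing the cocycle identity over them telescopes.\<close>
  have ladder: "\<exists>r>0. \<exists>N0. \<forall>N\<ge>N0. \<forall>y\<in>C \<inter> ball x r. c x y = S N y - S N x" if x: "x \<in> C" for x
  proof -
    obtain e where "0 < e" and e: "\<And>z u v w. \<lbrakk>z \<in> closed_segment o' x; u \<in> C \<inter> ball z e;
        v \<in> C \<inter> ball z e; w \<in> C \<inter> ball z e\<rbrakk> \<Longrightarrow> c u v + c v w = c u w"
      using leb[OF x] by blast
    obtain N0 where N0: "real N0 > 2 * dist o' x / e" using reals_Archimedean2 by blast
    have "c x y = S N y - S N x" if N: "N \<ge> Suc N0" and y: "y \<in> C" "dist x y < e/2" for N y
    proof -
      have small: "dist o' x / real N < e/2"
      proof -
        have "2 * dist o' x < real N0 * e" using N0 \<open>0 < e\<close> by (simp add: field_simps)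
        also have "\<dots> \<le> real N * e" using N \<open>0 < e\<close> by (intro mult_right_mono) auto
        finally show ?thesis using N by (simp add: field_simps)
      qed
      have pq: "dist (p N x i) (p N y i) < e/2" if "i \<le> N" for i
      proof -
        have "p N x i - p N y i = (real i / real N) *\<^sub>R (x - y)" by (simp add: p_def algebra_simps)
        then have "dist (p N x i) (p N y i) = (real i / real N) * dist x y" by (simp add: dist_norm)
        also have "\<dots> \<le> 1 * dist x y" using that N by (intro mult_right_mono) (auto simp: field_simps)
        finally show ?thesis using y by simp
      qed
      have quad: "c (p N x (Suc i)) (p N y (Suc i)) - c (p N x i) (p N y i)
                  = c (p N y i) (p N y (Suc i)) - c (p N x i) (p N x (Suc i))" if i: "i < N" for i
      proof -
        let ?B = "C \<inter> ball (p N x i) e"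
        have xx: "dist (p N x i) (p N x (Suc i)) < e/2"
          using step[of i "Suc i" N x] small N by (simp del: less_divide_eq_numeral1)
        have m: "p N x i \<in> ?B" "p N x (Suc i) \<in> ?B" "p N y i \<in> ?B" "p N y (Suc i) \<in> ?B"
          using i p_C[OF x, of i N] p_C[OF x, of "Suc i" N] p_C[OF y(1), of i N] p_C[OF y(1), of "Suc i" N]
            xx pq[of i] pq[of "Suc i"] \<open>0 < e\<close> dist_triangle[of "p N x i" "p N y (Suc i)" "p N x (Suc i)"]
          by auto
        have ps: "p N x i \<in> closed_segment o' x" using p_seg i by simp
        have "c (p N x i) (p N x (Suc i)) + c (p N x (Suc i)) (p N y (Suc i)) = c (p N x i) (p N y (Suc i))"
          by (rule e[OF ps]) (use m in auto)
        moreover have "c (p N x i) (p N y i) + c (p N y i) (p N y (Suc i)) = c (p N x i) (p N y (Suc i))"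
          by (rule e[OF ps]) (use m in auto)
        ultimately show ?thesis by (simp add: algebra_simps)
      qed
      have "S N y - S N x = (\<Sum>i<N. c (p N x (Suc i)) (p N y (Suc i)) - c (p N x i) (p N y i))"
        unfolding S_def sum_subtractf[symmetric] by (rule sum.cong) (simp_all add: quad)
      also have "\<dots> = c (p N x N) (p N y N) - c (p N x 0) (p N y 0)"
        by (rule sum_lessThan_telescope)
      also have "\<dots> = c x y - c o' o'" using N by (simp add: p_def)
      also have "c o' o' = 0"
      proof -
        have "c o' o' + c o' o' = c o' o'"
          by (rule e[of o']) (use o \<open>0 < e\<close> in auto)
        then show ?thesis by simp
      qed
      finally show ?thesis by simp
    qed
    then show ?thesis using \<open>0 < e\<close> by (intro exI[of _ "e/2"] conjI exI[of _ "Suc N0"]) auto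
  qed
  obtain N0 where N0: "\<And>x. x \<in> C \<Longrightarrow> N0 x > 0" "\<And>x N M. \<lbrakk>x \<in> C; N \<ge> N0 x; M > 0\<rbrakk> \<Longrightarrow> S (N * M) x = S N x"
    using refine by metis
  define h where "h x = S (N0 x) x" for x
  have h: "h x = S N x" if "x \<in> C" "N \<ge> N0 x" for x N
  proof -
    have "S (N0 x * N) x = S (N0 x) x" "S (N * N0 x) x = S N x"
      using N0(1)[OF that(1)] N0(2)[OF that(1)] that(2) by auto
    then show ?thesis by (simp add: h_def mult.commute)
  qed
  have "\<exists>r>0. \<forall>y\<in>C \<inter> ball x r. c x y = h y - h x" if x: "x \<in> C" for x
  proof -
    obtain r N1 where "r > 0" and r: "\<And>N y. N \<ge> N1 \<Longrightarrow> y \<in> C \<inter> ball x r \<Longrightarrow> c x y = S N y - S N x"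
      using ladder[OF x] by blast
    have "c x y = h y - h x" if "y \<in> C \<inter> ball x r" for y
    proof -
      let ?N = "max N1 (max (N0 x) (N0 y))"
      have "h x = S ?N x" "h y = S ?N y" using h[of x ?N] h[of y ?N] x that by auto
      then show ?thesis using r[of ?N y] that by simp
    qed
    then show ?thesis using \<open>r > 0\<close> by blast
  qed
  then show ?thesis by (rule that)
qed

section \<open>Functions prescribed locally up to linear functions\<close>

text \<open>A linear function is determined by its germ at any point.\<close>

lemma inner_eq_on_open_imp_eq:
  fixes L :: "'a::euclidean_space"
  assumes "open U" "U \<noteq> {}" "\<And>z. z \<in> U \<Longrightarrow> L \<bullet> z = L' \<bullet> z"
  shows "L = L'"
proof -
  obtain x where x: "x \<in> U" using assms by blast
  obtain e where "e > 0" and e: "ball x e \<subseteq> U" using assms(1) x by (rule openE)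
  have "(L - L') \<bullet> v = 0" for v
  proof -
    define s where "s = e / (2 * (norm v + 1))"
    have nv: "norm v + 1 > 0" using norm_ge_zero[of v] by linarith
    have s: "s > 0" "s * norm v < e"
      using \<open>e > 0\<close> nv mult_nonneg_nonneg[of e "norm v"] by (auto simp: s_def field_simps intro!: add_nonneg_pos)
    then have "x + s *\<^sub>R v \<in> ball x e" by (simp add: dist_norm)
    then have "L \<bullet> (x + s *\<^sub>R v) = L' \<bullet> (x + s *\<^sub>R v)" "L \<bullet> x = L' \<bullet> x" using e x assms(3) by auto
    then show ?thesis using s by (simp add: inner_add_right inner_diff_left)
  qed
  then show ?thesis by (metis inner_eq_zero_iff right_minus_eq)
qed

text \<open>The exceptional set of a piecewise linear problem: small balls remain open, connected and nonempty when
it is removed, as for a closed set of codimension at least two. Linear germs then continue across it.\<close>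

definition negligible_locus :: "'a::metric_space set \<Rightarrow> 'a set \<Rightarrow> bool" where
  "negligible_locus C N \<longleftrightarrow> (\<forall>x\<in>C. \<exists>r0>0. \<forall>r. 0 < r \<and> r < r0 \<longrightarrow>
     open (ball x r - N) \<and> connected (ball x r - N) \<and> ball x r - N \<noteq> {})"

lemma negligible_locusE:
  assumes "negligible_locus C N" "x \<in> C" "open U" "x \<in> U"
  obtains r where "r > 0" "ball x r \<subseteq> U" "open (ball x r - N)" "connected (ball x r - N)"
    "ball x r - N \<noteq> {}"
proof -
  obtain r0 where r0: "r0 > 0" "\<And>r. 0 < r \<and> r < r0 \<Longrightarrow>
     open (ball x r - N) \<and> connected (ball x r - N) \<and> ball x r - N \<noteq> {}"
    using assms unfolding negligible_locus_def by blast
  obtain e where e: "e > 0" "ball x e \<subseteq> U" using assms openE by blast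
  have m: "0 < min e (r0/2) \<and> min e (r0/2) < r0" using e r0 by auto
  show ?thesis
    by (rule that[of "min e (r0/2)"]) (use m e r0(2)[OF m] in auto)
qed

lemma eventually_off_locus:
  assumes "negligible_locus C N" "x \<in> C - N"
  shows "\<forall>\<^sub>F z in nhds x. z \<notin> N"
proof -
  obtain r where "r > 0" "open (ball x r - N)"
    using negligible_locusE[OF assms(1) _ open_UNIV, of x] assms(2) by auto
  moreover have "x \<in> ball x r - N" using assms(2) \<open>r > 0\<close> by auto
  ultimately show ?thesis unfolding eventually_nhds by blast
qed

lemma linear_germ_unique:
  fixes L :: "'a::euclidean_space"
  assumes "negligible_locus C N" "x \<in> C"
    and "\<forall>\<^sub>F z in nhds x. z \<notin> N \<longrightarrow> f z = L \<bullet> z"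
    and "\<forall>\<^sub>F z in nhds x. z \<notin> N \<longrightarrow> f z = L' \<bullet> z"
  shows "L = L'"
proof -
  have "\<forall>\<^sub>F z in nhds x. z \<notin> N \<longrightarrow> L \<bullet> z = L' \<bullet> z"
    using assms(3,4) by eventually_elim auto
  then obtain U where U: "open U" "x \<in> U" "\<And>z. z \<in> U \<Longrightarrow> z \<notin> N \<Longrightarrow> L \<bullet> z = L' \<bullet> z"
    unfolding eventually_nhds by auto
  obtain r where "r > 0" "ball x r \<subseteq> U" "open (ball x r - N)" "ball x r - N \<noteq> {}"
    using negligible_locusE[OF assms(1,2) U(1,2)] by metis
  then show ?thesis using U by (intro inner_eq_on_open_imp_eq[of "ball x r - N"]) auto
qed

text \<open>The gradient of the germ is unique at every point, even on \<open>N\<close>, and therefore a locally constant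
function on the connected set \<open>W\<close>.\<close>

lemma locally_linear_imp_linear_off_locus:
  fixes f :: "'a::euclidean_space \<Rightarrow> real"
  assumes N: "negligible_locus C N" and W: "connected W" "open W" "W \<subseteq> C"
    and loc: "\<And>y. y \<in> W \<Longrightarrow> \<exists>L. \<forall>\<^sub>F z in nhds y. z \<notin> N \<longrightarrow> f z = L \<bullet> z"
  shows "\<exists>L. \<forall>z\<in>W - N. f z = L \<bullet> z"
proof (cases "W = {}")
  case False
  then obtain x where x: "x \<in> W" by blast
  obtain G where G: "\<And>y. y \<in> W \<Longrightarrow> \<forall>\<^sub>F z in nhds y. z \<notin> N \<longrightarrow> f z = G y \<bullet> z"
    using loc by metis
  have const: "G y = G x" if y: "y \<in> W" for y
  proof (rule connected_local_const[OF W(1) y x])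
    show "\<forall>a\<in>W. \<forall>\<^sub>F b in at a within W. G a = G b"
    proof
      fix a assume a: "a \<in> W"
      have "\<forall>\<^sub>F b in nhds a. b \<in> W \<and> (\<forall>\<^sub>F z in nhds b. z \<notin> N \<longrightarrow> f z = G a \<bullet> z)"
        using G[OF a] a W(2) by (auto simp: eventually_eventually eventually_nhds_in_open intro: eventually_conj)
      then have "\<forall>\<^sub>F b in nhds a. G a = G b"
      proof eventually_elim
        case (elim b)
        then show ?case using linear_germ_unique[OF N _ _ G[of b]] W(3) by blast
      qed
      then show "\<forall>\<^sub>F b in at a within W. G a = G b"
        unfolding eventually_at_filter by (rule eventually_mono) blast
    qed
  qed
  have "f z = G x \<bullet> z" if "z \<in> W - N" for z
    using eventually_nhds_x_imp_x[OF G[of z]] const[of z] that by auto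
  then show ?thesis by blast
qed auto

text \<open>The function \<open>m y\<close> prescribes the germ of \<open>\<psi>\<close> at \<open>y\<close> up to a linear function; nothing is required at
the points of \<open>N\<close>. A solution remains one when a linear function is added.\<close>

definition solves_near :: "('a::euclidean_space \<Rightarrow> 'a \<Rightarrow> real) \<Rightarrow> 'a set \<Rightarrow> 'a set \<Rightarrow> ('a \<Rightarrow> real) \<Rightarrow> bool" where
  "solves_near m N W \<psi> \<longleftrightarrow> (\<forall>y\<in>W - N. \<exists>L. \<forall>\<^sub>F z in nhds y. \<psi> z = L \<bullet> z + m y z)"

lemma solves_nearD:
  "solves_near m N W \<psi> \<Longrightarrow> y \<in> W - N \<Longrightarrow> \<exists>L. \<forall>\<^sub>F z in nhds y. \<psi> z = L \<bullet> z + m y z"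
  unfolding solves_near_def by (rule bspec)

lemma solves_near_mono: "solves_near m N W \<psi> \<Longrightarrow> V \<subseteq> W \<Longrightarrow> solves_near m N V \<psi>"
  unfolding solves_near_def by blast

text \<open>Off \<open>N\<close> the prescribed germs cancel in the difference. Around a point of \<open>N\<close> the difference is linear on
the connected set that a small ball leaves after removal of \<open>N\<close>, so that local linearity holds at all
points of \<open>V\<close>.\<close>

lemma solves_near_diff_linear:
  assumes N: "negligible_locus C N" and V: "connected V" "open V" "V \<subseteq> C"
    and sol: "solves_near m N V \<psi>" "solves_near m N V \<psi>'"
  shows "\<exists>L. \<forall>z\<in>V - N. \<psi> z - \<psi>' z = L \<bullet> z"
proof -
  have loc: "\<exists>L. \<forall>\<^sub>F z in nhds y. \<psi> z - \<psi>' z = L \<bullet> z" if y: "y \<in> V - N" for y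
  proof -
    obtain L where "\<forall>\<^sub>F z in nhds y. \<psi> z = L \<bullet> z + m y z"
      using solves_nearD[OF sol(1) y] ..
    moreover obtain L' where "\<forall>\<^sub>F z in nhds y. \<psi>' z = L' \<bullet> z + m y z"
      using solves_nearD[OF sol(2) y] ..
    ultimately have "\<forall>\<^sub>F z in nhds y. \<psi> z - \<psi>' z = (L - L') \<bullet> z"
      by eventually_elim (simp add: inner_diff_left)
    then show ?thesis by blast
  qed
  have none: "negligible_locus UNIV ({} :: 'a set)"
    unfolding negligible_locus_def
    by (auto intro!: exI[of _ "1::real"])
  show ?thesis
  proof (rule locally_linear_imp_linear_off_locus[OF N V])
    fix y assume y: "y \<in> V"
    obtain r where r: "r > 0" "ball y r \<subseteq> V" "open (ball y r - N)" "connected (ball y r - N)"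
      using negligible_locusE[OF N _ V(2) y] y V(3) by (metis subsetD)
    have "\<exists>L. \<forall>z\<in>(ball y r - N) - {}. \<psi> z - \<psi>' z = L \<bullet> z"
    proof (rule locally_linear_imp_linear_off_locus[OF none r(4,3) subset_UNIV])
      fix u assume "u \<in> ball y r - N"
      then show "\<exists>L. \<forall>\<^sub>F z in nhds u. z \<notin> {} \<longrightarrow> \<psi> z - \<psi>' z = L \<bullet> z"
        using loc[of u] r(2) by auto
    qed
    then obtain L where L: "\<forall>z\<in>ball y r - N. \<psi> z - \<psi>' z = L \<bullet> z" by auto
    have "\<forall>\<^sub>F z in nhds y. z \<in> ball y r" using r(1) by (intro eventually_nhds_in_open) auto
    then have "\<forall>\<^sub>F z in nhds y. z \<notin> N \<longrightarrow> \<psi> z - \<psi>' z = L \<bullet> z"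
      by eventually_elim (use L in auto)
    then show "\<exists>L. \<forall>\<^sub>F z in nhds y. z \<notin> N \<longrightarrow> \<psi> z - \<psi>' z = L \<bullet> z" by blast
  qed
qed

text \<open>Fix a local solution \<open>\<psi> x\<close> around every \<open>x\<close>. For \<open>u\<close> near \<open>x\<close> the solutions \<open>\<psi> x\<close> and \<open>\<psi> u\<close> differ near
\<open>u\<close> by a linear function \<open>\<kappa> x u\<close>. The differences \<open>\<kappa> x v - \<kappa> x u\<close> do not depend on \<open>x\<close> and form a locally
additive cocycle in \<open>(u, v)\<close>; a potential \<open>h\<close> for it corrects all \<open>\<psi> x\<close> simultaneously. The global
solution is the diagonal \<open>z \<mapsto> \<psi> z z + h z \<bullet> z\<close>.\<close>

lemma solves_near_glue:
  assumes N: "negligible_locus C N" and C: "convex C" "open C"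
    and ex: "\<And>x. x \<in> C \<Longrightarrow> \<exists>r>0. \<exists>\<psi>. solves_near m N (ball x r) \<psi>"
  shows "\<exists>\<Psi>. solves_near m N C \<Psi>"
proof -
  have "\<exists>r \<psi>. r > 0 \<and> ball x r \<subseteq> C \<and> solves_near m N (ball x r) \<psi>" if "x \<in> C" for x
  proof -
    obtain r \<psi> where r: "r > 0" "solves_near m N (ball x r) \<psi>" using ex[OF \<open>x \<in> C\<close>] by blast
    obtain e where e: "e > 0" "ball x e \<subseteq> C" using C(2) \<open>x \<in> C\<close> openE by blast
    have "ball x (min r e) \<subseteq> ball x r" "ball x (min r e) \<subseteq> C" using e by auto
    then show ?thesis using r e solves_near_mono by (intro exI[of _ "min r e"] exI[of _ \<psi>]) auto
  qed
  then obtain r \<psi> where r: "\<And>x. x \<in> C \<Longrightarrow> r x > 0" "\<And>x. x \<in> C \<Longrightarrow> ball x (r x) \<subseteq> C"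
    "\<And>x. x \<in> C \<Longrightarrow> solves_near m N (ball x (r x)) (\<psi> x)" by metis
  have "\<exists>L. \<forall>\<^sub>F z in nhds u. z \<notin> N \<longrightarrow> \<psi> x z - \<psi> u z = L \<bullet> z"
    if x: "x \<in> C" and u: "u \<in> ball x (r x)" for x u
  proof -
    have uC: "u \<in> C" using r(2) x u by blast
    let ?V = "ball x (r x) \<inter> ball u (r u)"
    have "\<exists>L. \<forall>z\<in>?V - N. \<psi> x z - \<psi> u z = L \<bullet> z"
    proof (rule solves_near_diff_linear[OF N])
      show "solves_near m N ?V (\<psi> x)" "solves_near m N ?V (\<psi> u)"
        by (rule solves_near_mono[OF r(3)]; use x uC in blast)+
    qed (use r(2)[OF x] in \<open>auto intro: convex_connected convex_Int\<close>)
    then obtain L where L: "\<forall>z\<in>?V - N. \<psi> x z - \<psi> u z = L \<bullet> z" ..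
    have "\<forall>\<^sub>F z in nhds u. z \<in> ?V" using u r(1)[OF uC] by (intro eventually_nhds_in_open) auto
    then have "\<forall>\<^sub>F z in nhds u. z \<notin> N \<longrightarrow> \<psi> x z - \<psi> u z = L \<bullet> z"
      by eventually_elim (use L in auto)
    then show ?thesis by blast
  qed
  then obtain \<kappa> where \<kappa>: "\<And>x u. \<lbrakk>x \<in> C; u \<in> ball x (r x)\<rbrakk> \<Longrightarrow>
      \<forall>\<^sub>F z in nhds u. z \<notin> N \<longrightarrow> \<psi> x z - \<psi> u z = \<kappa> x u \<bullet> z" by metis
  have indep: "\<kappa> x v - \<kappa> x u = \<kappa> y v - \<kappa> y u"
    if xy: "x \<in> C" "y \<in> C" and u: "u \<in> ball x (r x)" "u \<in> ball y (r y)"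
      and v: "v \<in> ball x (r x)" "v \<in> ball y (r y)" for x y u v
  proof -
    let ?V = "ball x (r x) \<inter> ball y (r y)"
    have "\<exists>L. \<forall>z\<in>?V - N. \<psi> x z - \<psi> y z = L \<bullet> z"
    proof (rule solves_near_diff_linear[OF N])
      show "solves_near m N ?V (\<psi> x)" "solves_near m N ?V (\<psi> y)"
        by (rule solves_near_mono[OF r(3)]; use xy in blast)+
    qed (use r(2)[OF xy(1)] in \<open>auto intro: convex_connected convex_Int\<close>)
    then obtain L where L: "\<forall>z\<in>?V - N. \<psi> x z - \<psi> y z = L \<bullet> z" ..
    have "\<kappa> x w - \<kappa> y w = L" if w: "w \<in> ?V" for w
    proof (rule linear_germ_unique[OF N, of w "\<lambda>z. \<psi> x z - \<psi> y z"])
      show "w \<in> C" using w r(2)[OF xy(1)] by auto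
      have "\<forall>\<^sub>F z in nhds w. z \<in> ?V" using w by (intro eventually_nhds_in_open) auto
      then show "\<forall>\<^sub>F z in nhds w. z \<notin> N \<longrightarrow> \<psi> x z - \<psi> y z = L \<bullet> z"
        by eventually_elim (use L in auto)
      have "\<forall>\<^sub>F z in nhds w. z \<notin> N \<longrightarrow> \<psi> x z - \<psi> w z = \<kappa> x w \<bullet> z"
        "\<forall>\<^sub>F z in nhds w. z \<notin> N \<longrightarrow> \<psi> y z - \<psi> w z = \<kappa> y w \<bullet> z"
        using \<kappa> xy w by auto
      then show "\<forall>\<^sub>F z in nhds w. z \<notin> N \<longrightarrow> \<psi> x z - \<psi> y z = (\<kappa> x w - \<kappa> y w) \<bullet> z"
        by eventually_elim (auto simp: inner_diff_left)
    qed
    from this[of u] this[of v] show ?thesis using u v by (simp add: algebra_simps)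
  qed
  define c where "c u v = (let x = SOME x. x \<in> C \<and> u \<in> ball x (r x) \<and> v \<in> ball x (r x) in \<kappa> x v - \<kappa> x u)" for u v
  have c: "c u v = \<kappa> x v - \<kappa> x u" if "x \<in> C" "u \<in> ball x (r x)" "v \<in> ball x (r x)" for x u v
  proof -
    let ?P = "\<lambda>x. x \<in> C \<and> u \<in> ball x (r x) \<and> v \<in> ball x (r x)"
    have P: "?P (SOME x. ?P x)" by (rule someI[of ?P x]) (use that in auto)
    show ?thesis unfolding c_def Let_def using P that by (intro indep) auto
  qed
  obtain h where h: "\<And>x. x \<in> C \<Longrightarrow> \<exists>e>0. \<forall>y\<in>C \<inter> ball x e. c x y = h y - h x"
  proof (rule local_cocycle_potential[OF C(1), of c])
    fix x assume x: "x \<in> C"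
    show "\<exists>e>0. \<forall>u\<in>C \<inter> ball x e. \<forall>v\<in>C \<inter> ball x e. \<forall>w\<in>C \<inter> ball x e. c u v + c v w = c u w"
      by (rule exI[of _ "r x"]) (use x r(1) c[OF x] in auto)
  qed blast
  define \<Psi> where "\<Psi> z = \<psi> z z + h z \<bullet> z" for z
  have near: "\<forall>\<^sub>F z in nhds x. z \<notin> N \<longrightarrow> \<Psi> z = \<psi> x z + h x \<bullet> z" if x: "x \<in> C" for x
  proof -
    obtain e where e: "e > 0" "\<And>y. y \<in> C \<inter> ball x e \<Longrightarrow> c x y = h y - h x" using h[OF x] by blast
    have x0: "\<kappa> x x = 0"
      by (rule linear_germ_unique[OF N x, of "\<lambda>z. \<psi> x z - \<psi> x z"]) (use \<kappa>[OF x, of x] r(1)[OF x] in auto)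
    have "\<forall>\<^sub>F z in nhds x. z \<in> ball x (min e (r x))"
      using e r(1)[OF x] by (intro eventually_nhds_in_open) auto
    then show ?thesis
    proof eventually_elim
      case (elim z)
      then have z: "z \<in> ball x (r x)" "z \<in> C \<inter> ball x e" using r(2)[OF x] by auto
      have "\<kappa> x z = h z - h x" using c[OF x, of x z] e(2)[OF z(2)] z x0 r(1)[OF x] by simp
      moreover have "z \<notin> N \<longrightarrow> \<psi> x z - \<psi> z z = \<kappa> x z \<bullet> z"
        using eventually_nhds_x_imp_x[OF \<kappa>[OF x z(1)]] .
      ultimately show ?case by (auto simp: \<Psi>_def inner_diff_left)
    qed
  qed
  have "solves_near m N C \<Psi>"
    unfolding solves_near_def
  proof
    fix y assume y: "y \<in> C - N"
    obtain L where L: "\<forall>\<^sub>F z in nhds y. \<psi> y z = L \<bullet> z + m y z"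
      using solves_nearD[OF r(3)[of y], of y] r(1)[of y] y by auto
    have "\<forall>\<^sub>F z in nhds y. \<Psi> z = (L + h y) \<bullet> z + m y z"
      using L eventually_off_locus[OF N y] near[of y, OF DiffD1[OF y]]
      by eventually_elim (simp add: inner_add_left)
    then show "\<exists>L. \<forall>\<^sub>F z in nhds y. \<Psi> z = L \<bullet> z + m y z" by blast
  qed
  then show ?thesis by blast
qed

section \<open>Lorentzian linear algebra\<close>

definition space_part :: "'n::finite mink \<Rightarrow> real ^ 'n" where
  "space_part x = (\<chi> i. x $ Some i)"

text \<open>The Gram operator of \<open>lorentz\<close> with respect to the Euclidean inner product.\<close>

definition lorentz_flip :: "'n::finite mink \<Rightarrow> 'n mink" where
  "lorentz_flip x = (\<chi> k. case k of None \<Rightarrow> - (x $ None) | Some i \<Rightarrow> x $ Some i)"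

lemma sum_option: "(\<Sum>k\<in>UNIV. f k) = f None + (\<Sum>i\<in>UNIV. f (Some i))"
  for f :: "'n::finite option \<Rightarrow> 'b::comm_monoid_add"
  by (simp add: UNIV_option_conv sum.reindex)

lemma lorentz_space_part: "lorentz x y = space_part x \<bullet> space_part y - x $ None * y $ None"
  by (simp add: lorentz_def space_part_def inner_vec_def)

lemma lorentz_eq_inner: "lorentz x y = lorentz_flip x \<bullet> y"
  by (simp add: lorentz_def lorentz_flip_def inner_vec_def sum_option)

lemma lorentz_flip_flip [simp]: "lorentz_flip (lorentz_flip x) = x"
  by (simp add: lorentz_flip_def vec_eq_iff split: option.split)

lemma inner_eq_lorentz: "L \<bullet> y = lorentz (lorentz_flip L) y"
  by (simp add: lorentz_eq_inner)

lemma lorentz_sym: "lorentz x y = lorentz y x"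
  by (simp add: lorentz_def mult.commute)

lemma lorentz_right [simp]:
  "lorentz x (y + z) = lorentz x y + lorentz x z" "lorentz x (y - z) = lorentz x y - lorentz x z"
  "lorentz x (c *\<^sub>R y) = c * lorentz x y" "lorentz x (- y) = - lorentz x y" "lorentz x 0 = 0"
  by (simp_all add: lorentz_eq_inner inner_add_right inner_diff_right)

lemma lorentz_left [simp]:
  "lorentz (y + z) x = lorentz y x + lorentz z x" "lorentz (y - z) x = lorentz y x - lorentz z x"
  "lorentz (c *\<^sub>R y) x = c * lorentz y x" "lorentz (- y) x = - lorentz y x" "lorentz 0 x = 0"
  by (simp_all add: lorentz_sym[of _ x])

lemma lorentz_sum_left: "lorentz (\<Sum>i\<in>I. f i) x = (\<Sum>i\<in>I. lorentz (f i) x)"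
  by (simp only: lorentz_sym[of _ x]) (simp only: lorentz_eq_inner inner_sum_right)

lemma lorentz_zero_iff: "(\<forall>y. lorentz x y = 0) \<longleftrightarrow> x = 0" for x :: "'n::finite mink"
proof
  assume "\<forall>y. lorentz x y = 0"
  then have "lorentz_flip x = 0" by (metis inner_eq_zero_iff lorentz_eq_inner)
  then have "x = lorentz_flip 0" by (metis lorentz_flip_flip)
  also have "lorentz_flip 0 = (0 :: 'n mink)" by (simp add: lorentz_flip_def vec_eq_iff split: option.split)
  finally show "x = 0" .
qed simp

lemma continuous_on_lorentz [continuous_intros]:
  "continuous_on S f \<Longrightarrow> continuous_on S g \<Longrightarrow> continuous_on S (\<lambda>x. lorentz (f x) (g x))"
  unfolding lorentz_def by (intro continuous_intros)

definition timecone :: "'n::finite mink set" where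
  "timecone = {y. lorentz y y < 0 \<and> y $ None > 0}"

text \<open>In this form the cone is visibly convex.\<close>

lemma timecone_iff: "y \<in> timecone \<longleftrightarrow> norm (space_part y) < y $ None"
proof -
  have "lorentz y y = (norm (space_part y))\<^sup>2 - (y $ None)\<^sup>2"
    by (simp add: lorentz_space_part power2_eq_square flip: power2_norm_eq_inner)
  then show ?thesis unfolding timecone_def
    using abs_less_iff power2_less_imp_less[of "norm (space_part y)" "y $ None"]
      power_strict_mono[of "norm (space_part y)" "y $ None" 2] norm_ge_zero[of "space_part y"]
    by (auto simp del: norm_ge_zero)
qed

lemma open_timecone: "open (timecone :: 'n::finite mink set)"
  unfolding timecone_def by (intro open_Collect_conj open_Collect_less continuous_intros)

lemma convex_timecone: "convex (timecone :: 'n::finite mink set)"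
proof (rule convexI)
  fix x y :: "'n mink" and u v :: real
  assume xy: "x \<in> timecone" "y \<in> timecone" and uv: "u \<ge> 0" "v \<ge> 0" "u + v = 1"
  have "space_part (u *\<^sub>R x + v *\<^sub>R y) = u *\<^sub>R space_part x + v *\<^sub>R space_part y"
    by (simp add: space_part_def vec_eq_iff)
  then have "norm (space_part (u *\<^sub>R x + v *\<^sub>R y)) \<le> u * norm (space_part x) + v * norm (space_part y)"
    using uv norm_triangle_ineq[of "u *\<^sub>R space_part x" "v *\<^sub>R space_part y"] by simp
  also have "\<dots> < u * x $ None + v * y $ None"
  proof (cases "u = 0")
    case False
    then show ?thesis using uv xy unfolding timecone_iff
      by (intro add_less_le_mono mult_strict_left_mono mult_left_mono) auto
  qed (use uv xy in \<open>simp add: timecone_iff\<close>)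
  finally show "u *\<^sub>R x + v *\<^sub>R y \<in> timecone" by (simp add: timecone_iff)
qed

lemma hyperboloid_subset_timecone: "hyperboloid \<subseteq> timecone"
  by (auto simp: hyperboloid_def timecone_def)

lemma timecone_scaleR: "y \<in> timecone \<Longrightarrow> c > 0 \<Longrightarrow> c *\<^sub>R y \<in> timecone"
  by (auto simp: timecone_def mult_pos_neg zero_less_mult_iff)

definition radial :: "'n::finite mink \<Rightarrow> 'n mink" where
  "radial y = (1 / sqrt (- lorentz y y)) *\<^sub>R y"

lemma radial_in_hyperboloid: "y \<in> timecone \<Longrightarrow> radial y \<in> hyperboloid"
  by (auto simp: timecone_def hyperboloid_def radial_def field_simps power2_eq_square[symmetric] real_sqrt_mult_self)

lemma radial_hyperboloid: "y \<in> hyperboloid \<Longrightarrow> radial y = y"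
  by (simp add: hyperboloid_def radial_def)

lemma timecone_eq_scaled_radial:
  assumes "y \<in> timecone"
  obtains c where "c > 0" "y = c *\<^sub>R radial y"
  by (rule that[of "sqrt (- lorentz y y)"]) (use assms in \<open>auto simp: timecone_def radial_def\<close>)

lemma radial_scaleR: "c > 0 \<Longrightarrow> radial (c *\<^sub>R y) = radial y"
proof -
  assume c: "c > 0"
  have eq: "- lorentz (c *\<^sub>R y) (c *\<^sub>R y) = (c * c) * (- lorentz y y)" by simp
  have "sqrt (- lorentz (c *\<^sub>R y) (c *\<^sub>R y)) = c * sqrt (- lorentz y y)"
    unfolding eq real_sqrt_mult using c by simp
  then show ?thesis using c by (simp add: radial_def)
qed

lemma lorentz_radial:
  "lorentz e (radial y) = (1 / sqrt (- lorentz y y)) * lorentz e y"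
  by (simp add: radial_def)

lemma lorentz_radial_sign:
  assumes "y \<in> timecone"
  shows "lorentz e (radial y) = 0 \<longleftrightarrow> lorentz e y = 0"
  using assms by (auto simp: lorentz_radial timecone_def)

lemma continuous_on_radial: "continuous_on timecone radial"
  unfolding radial_def by (intro continuous_intros) (auto simp: timecone_def)

text \<open>The form has only one negative direction, and \<open>y\<close> uses it up; quantitatively, this is the Cauchy--Schwarz
inequality for the spacelike parts.\<close>

lemma spacelike_if_orthogonal_timelike:
  assumes "y \<in> timecone" "lorentz e y = 0" "e \<noteq> 0"
  shows "lorentz e e > 0"
proof -
  have y: "norm (space_part y) < y $ None" using assms(1) by (simp add: timecone_iff)
  then have pos: "y $ None > 0" using norm_ge_zero[of "space_part y"] by linarith
  have eq: "space_part e \<bullet> space_part y = e $ None * y $ None"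
    using assms(2) by (simp add: lorentz_space_part)
  have sp: "space_part e \<noteq> 0"
  proof
    assume z: "space_part e = 0"
    then have "e $ None = 0" using eq pos by simp
    then have "e = 0" using z unfolding vec_eq_iff space_part_def
      by (metis not_None_eq vec_lambda_beta zero_index)
    then show False using assms(3) by simp
  qed
  have "\<bar>e $ None\<bar> * y $ None = \<bar>space_part e \<bullet> space_part y\<bar>" using eq pos by (simp add: abs_mult)
  also have "\<dots> \<le> norm (space_part e) * norm (space_part y)" by (rule Cauchy_Schwarz_ineq2)
  also have "\<dots> < norm (space_part e) * y $ None" using y sp by simp
  finally have "\<bar>e $ None\<bar> < norm (space_part e)" using pos by simp
  then have "(e $ None)\<^sup>2 < (norm (space_part e))\<^sup>2"
    by (metis abs_ge_zero power2_abs power_strict_mono zero_less_numeral)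
  then show ?thesis by (simp add: lorentz_space_part power2_eq_square flip: power2_norm_eq_inner)
qed

lemma subspace_eq_lorentz_orthogonal:
  fixes V :: "'n::finite mink set"
  assumes V: "subspace V" and d: "dim V + k = CARD('n) + 1"
  obtains S where "finite S" "card S = k" "independent S" "V = {y. \<forall>e\<in>S. lorentz e y = 0}"
proof -
  let ?W = "V\<^sup>\<bottom>"
  have "dim ?W + dim V = dim (UNIV :: 'n mink set)"
    using dim_subspace_orthogonal_to_vectors[OF V subspace_UNIV] by (simp add: orthogonal_comp_def)
  then have dW: "dim ?W = k" using d by (simp add: dim_UNIV)
  obtain T where T: "T \<subseteq> ?W" "independent T" "?W \<subseteq> span T" "card T = k"
    using basis_exists[of ?W] dW by metis
  have "finite T" using T(2) by (rule independent_imp_finite)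
  have "V = ?W\<^sup>\<bottom>" using orthogonal_comp_self[OF V] by simp
  also have "\<dots> = T\<^sup>\<bottom>"
  proof
    show "T\<^sup>\<bottom> \<subseteq> ?W\<^sup>\<bottom>"
    proof
      fix x assume "x \<in> T\<^sup>\<bottom>"
      then have "orthogonal x y" if "y \<in> span T" for y
        using orthogonal_to_span[OF that, of x] by (auto simp: orthogonal_comp_def orthogonal_commute)
      then show "x \<in> ?W\<^sup>\<bottom>" using T(3) unfolding orthogonal_comp_def by (auto simp: orthogonal_commute)
    qed
  qed (use T(1) in \<open>auto simp: orthogonal_comp_def\<close>)
  finally have VT: "V = T\<^sup>\<bottom>" .
  have lin: "linear (lorentz_flip :: 'n mink \<Rightarrow> 'n mink)"
    by (rule linearI) (auto simp: lorentz_flip_def vec_eq_iff split: option.split)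
  have inj: "inj (lorentz_flip :: 'n mink \<Rightarrow> 'n mink)"
    by (metis injI lorentz_flip_flip)
  show ?thesis
  proof (rule that[of "lorentz_flip ` T"])
    show "finite (lorentz_flip ` T)" using \<open>finite T\<close> by simp
    show "card (lorentz_flip ` T) = k" using T(4) inj by (simp add: card_image inj_on_subset)
    show "independent (lorentz_flip ` T)"
      using linear_independent_injective_image[OF lin T(2) inj_on_subset[OF inj subset_UNIV]] .
    show "V = {y. \<forall>e\<in>lorentz_flip ` T. lorentz e y = 0}"
      unfolding VT orthogonal_comp_def by (auto simp: lorentz_eq_inner orthogonal_def)
  qed
qed

text \<open>A hyperplane that meets the hyperboloid has a spacelike normal, which can be normalized.\<close>

lemma hyperplane_unit_normal:
  fixes V :: "'n::finite mink set"
  assumes V: "subspace V" "dim V + 1 = CARD('n) + 1" and y: "y \<in> V" "y \<in> timecone"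
  obtains e where "lorentz e e = 1" "V = {z. lorentz e z = 0}"
proof -
  obtain S where S: "finite S" "card S = 1" "independent S" "V = {z. \<forall>e\<in>S. lorentz e z = 0}"
    by (rule subspace_eq_lorentz_orthogonal[OF V])
  obtain p where p: "S = {p}" using S(2) by (auto simp: card_1_singleton_iff)
  have "p \<noteq> 0" using S(3) dependent_zero[of S] p by auto
  then have pos: "lorentz p p > 0" using spacelike_if_orthogonal_timelike[OF y(2), of p] S(4) y(1) p by auto
  show ?thesis
  proof (rule that[of "(1 / sqrt (lorentz p p)) *\<^sub>R p"])
    show "lorentz ((1 / sqrt (lorentz p p)) *\<^sub>R p) ((1 / sqrt (lorentz p p)) *\<^sub>R p) = 1"
      using pos by simp
    show "V = {z. lorentz ((1 / sqrt (lorentz p p)) *\<^sub>R p) z = 0}"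
      using pos S(4) p by simp
  qed
qed

definition lorentz_orthonormal :: "'n::finite mink \<Rightarrow> 'n mink \<Rightarrow> bool" where
  "lorentz_orthonormal a b \<longleftrightarrow> lorentz a a = 1 \<and> lorentz b b = 1 \<and> lorentz a b = 0"

text \<open>The normal plane of a subspace through a timelike vector is positive definite, so the Gram--Schmidt
process works in it.\<close>

lemma codim2_orthonormal_normals:
  fixes V :: "'n::finite mink set"
  assumes V: "subspace V" "dim V + 2 = CARD('n) + 1" and y: "y \<in> V" "y \<in> timecone"
  obtains a b where "lorentz_orthonormal a b" "V = {z. lorentz a z = 0 \<and> lorentz b z = 0}"
proof -
  obtain S where S: "finite S" "card S = 2" "independent S" "V = {z. \<forall>e\<in>S. lorentz e z = 0}"
    by (rule subspace_eq_lorentz_orthogonal[OF V])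
  obtain p q where pq: "S = {p, q}" "p \<noteq> q" using S(2) by (auto simp: card_2_iff)
  have "p \<noteq> 0" using S(3) dependent_zero[of S] pq by auto
  then have pos: "lorentz p p > 0" using spacelike_if_orthogonal_timelike[OF y(2), of p] S(4) y(1) pq by auto
  define a where "a = (1 / sqrt (lorentz p p)) *\<^sub>R p"
  have a: "lorentz a a = 1" using pos by (simp add: a_def)
  have a0: "lorentz a z = 0 \<longleftrightarrow> lorentz p z = 0" for z using pos by (simp add: a_def)
  define q' where "q' = q - lorentz a q *\<^sub>R a"
  have "q' \<noteq> 0"
  proof
    assume "q' = 0"
    then have "q = (lorentz a q / sqrt (lorentz p p)) *\<^sub>R p" by (simp add: q'_def a_def)
    then have "q \<in> span {p}" by (metis span_base span_mul singletonI)
    moreover have "independent (insert q {p})" using S(3) pq by (simp add: insert_commute)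
    ultimately show False using pq(2) by (simp add: independent_insert split: if_splits)
  qed
  moreover have "lorentz q' y = 0" using S(4) y(1) pq a0[of y] by (auto simp: q'_def)
  ultimately have posq: "lorentz q' q' > 0" using spacelike_if_orthogonal_timelike[OF y(2)] by blast
  define b where "b = (1 / sqrt (lorentz q' q')) *\<^sub>R q'"
  have b: "lorentz b b = 1" using posq by (simp add: b_def)
  have b0: "lorentz b z = 0 \<longleftrightarrow> lorentz q' z = 0" for z using posq by (simp add: b_def)
  have ab: "lorentz a b = 0" using a by (simp add: b_def q'_def)
  show ?thesis
  proof (rule that[of a b])
    show "lorentz_orthonormal a b" using a b ab by (simp add: lorentz_orthonormal_def)
    show "V = {z. lorentz a z = 0 \<and> lorentz b z = 0}"
      using S(4) pq by (auto simp: a0 b0) (auto simp: q'_def a0)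
  qed
qed

text \<open>The germ of a hyperplane determines its unit normal up to sign.\<close>

lemma unit_normal_unique:
  fixes e :: "'n::finite mink"
  assumes "lorentz e e = 1" "lorentz e' e' = 1" "lorentz e y = 0"
    and ev: "\<forall>\<^sub>F z in nhds y. lorentz e z = 0 \<longrightarrow> lorentz e' z = 0"
  shows "\<bar>lorentz e' v\<bar> = \<bar>lorentz e v\<bar>"
proof -
  obtain U where U: "open U" "y \<in> U" "\<And>z. z \<in> U \<Longrightarrow> lorentz e z = 0 \<Longrightarrow> lorentz e' z = 0"
    using ev unfolding eventually_nhds by blast
  obtain r where r: "r > 0" "ball y r \<subseteq> U" using U(1,2) by (rule openE)
  have y': "lorentz e' y = 0" using U assms(3) by blast
  have tangent: "lorentz e' w = 0" if w: "lorentz e w = 0" for w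
  proof (cases "w = 0")
    case False
    define s where "s = r / (2 * norm w)"
    have s: "s > 0" "s * norm w < r" using r(1) False by (auto simp: s_def)
    then have "y + s *\<^sub>R w \<in> U" using r(2) by (auto simp: dist_norm subset_iff)
    then have "lorentz e' (y + s *\<^sub>R w) = 0" by (rule U(3)) (simp add: w assms(3))
    then show ?thesis using y' s by simp
  qed simp
  have all: "lorentz e' w = lorentz e w * lorentz e' e" for w
    using tangent[of "w - lorentz e w *\<^sub>R e"] assms(1) by simp
  have "lorentz e' e * lorentz e' e = 1"
    using all[of e'] assms(2) by (simp add: lorentz_sym)
  then have "\<bar>lorentz e' e\<bar> = 1" by (auto simp: square_eq_1_iff)
  then show ?thesis using all[of v] by (simp add: abs_mult)
qed

text \<open>For orthonormal \<open>a\<close>, \<open>b\<close> this is the orthogonal projection to the plane they span, read as a complex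
number; its zero set is the codimension two subspace orthogonal to both.\<close>

definition normal_coord :: "'n::finite mink \<Rightarrow> 'n mink \<Rightarrow> 'n mink \<Rightarrow> complex" where
  "normal_coord a b y = Complex (lorentz a y) (lorentz b y)"

lemma normal_coord_simps [simp]:
  "normal_coord a b (x + y) = normal_coord a b x + normal_coord a b y"
  "normal_coord a b (c *\<^sub>R x) = c *\<^sub>R normal_coord a b x"
  "Re (normal_coord a b x) = lorentz a x" "Im (normal_coord a b x) = lorentz b x"
  by (simp_all add: normal_coord_def complex_eq_iff)

lemma continuous_on_normal_coord [continuous_intros]:
  "continuous_on S f \<Longrightarrow> continuous_on S (\<lambda>x. normal_coord a b (f x))"
  unfolding normal_coord_def Complex_eq by (intro continuous_intros)

lemma normal_coord_eq_0_iff: "normal_coord a b y = 0 \<longleftrightarrow> lorentz a y = 0 \<and> lorentz b y = 0"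
  by (simp add: normal_coord_def complex_eq_iff)

text \<open>The section of \<open>normal_coord a b\<close> with values in the plane spanned by \<open>a\<close> and \<open>b\<close>.\<close>

definition normal_vector :: "'n::finite mink \<Rightarrow> 'n mink \<Rightarrow> complex \<Rightarrow> 'n mink" where
  "normal_vector a b u = Re u *\<^sub>R a + Im u *\<^sub>R b"

lemma normal_coord_vector [simp]:
  "lorentz_orthonormal a b \<Longrightarrow> normal_coord a b (normal_vector a b u) = u"
  by (simp add: normal_coord_def normal_vector_def lorentz_orthonormal_def complex_eq_iff lorentz_sym[of b a])

lemma lorentz_normal_vector: "lorentz (normal_vector a b u) y = Re (cnj u * normal_coord a b y)"
  by (simp add: normal_vector_def)

text \<open>Vanishing on a germ of the codimension two subspace implies vanishing on all of it, so \<open>w\<close> lies in the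
orthogonal complement of that subspace, which is the plane spanned by \<open>a\<close> and \<open>b\<close>.\<close>

lemma lorentz_vanishing_imp_normal:
  assumes ab: "lorentz_orthonormal a b"
    and x: "normal_coord a b x = 0"
    and van: "\<forall>\<^sub>F y in nhds x. normal_coord a b y = 0 \<longrightarrow> lorentz w y = 0"
  shows "w = normal_vector a b (normal_coord a b w)"
proof -
  obtain U where U: "open U" "x \<in> U" "\<And>z. z \<in> U \<Longrightarrow> normal_coord a b z = 0 \<Longrightarrow> lorentz w z = 0"
    using van unfolding eventually_nhds by blast
  obtain r where r: "r > 0" "ball x r \<subseteq> U" using U(1,2) by (rule openE)
  have wx: "lorentz w x = 0" using U x by blast
  have tangent: "lorentz w v = 0" if v: "normal_coord a b v = 0" for v
  proof (cases "v = 0")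
    case False
    define s where "s = r / (2 * norm v)"
    have s: "s > 0" "s * norm v < r" using r(1) False by (auto simp: s_def)
    then have "x + s *\<^sub>R v \<in> U" using r(2) by (auto simp: dist_norm subset_iff)
    then have "lorentz w (x + s *\<^sub>R v) = 0" by (rule U(3)) (simp add: v x)
    then show ?thesis using wx s by simp
  qed simp
  let ?n = "normal_vector a b (normal_coord a b w)"
  have "lorentz (w - ?n) y = 0" for y
  proof -
    let ?y = "y - normal_vector a b (normal_coord a b y)"
    have y0: "normal_coord a b ?y = 0"
      using ab by (simp add: normal_coord_def normal_vector_def lorentz_orthonormal_def complex_eq_iff lorentz_sym[of b a])
    then have "lorentz w ?y = 0" by (rule tangent)
    moreover have "lorentz w (normal_vector a b (normal_coord a b y)) = lorentz ?n y"
      by (simp add: normal_vector_def lorentz_sym[of w] mult.commute)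
    ultimately show ?thesis by simp
  qed
  then show ?thesis using lorentz_zero_iff[of "w - ?n"] by simp
qed

text \<open>In the normal plane of its boundary a half-hyperplane is a ray. The normal \<open>e\<close> of the hyperplane and the
vector \<open>v\<close> that cuts out the half both vanish on \<open>P\<close>, hence lie in the normal plane, where they have the
coordinates \<open>\<epsilon>\<close> and \<open>\<nu>\<close>. The hyperplane is the line of direction \<open>\<i> \<epsilon>\<close>, and the sign of \<open>\<kappa>\<close>, the value
of \<open>v\<close> on that direction, selects the ray; \<open>\<kappa>\<close> is nonzero because otherwise \<open>P\<close> would be the whole
hyperplane.\<close>

lemma half_hyperplane_ray:
  fixes F P :: "'n::finite mink set"
  assumes ab: "lorentz_orthonormal a b" and P: "P = {x \<in> hyperboloid. normal_coord a b x = 0}" "P \<noteq> {}"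
    and F: "half_hyperplane P F"
  obtains u where "norm u = 1"
    "F = {x \<in> hyperboloid. \<exists>s\<ge>0. normal_coord a b x = s *\<^sub>R u}"
proof -
  obtain Q v where Q: "hyp_subspace 1 Q" "P = {x \<in> Q. lorentz v x = 0}" "F = {x \<in> Q. lorentz v x \<ge> 0}"
    using F unfolding half_hyperplane_def by blast
  obtain V where V: "subspace V" "dim V + 1 = CARD('n) + 1" "Q = hyperboloid \<inter> V" "Q \<noteq> {}"
    using Q(1) unfolding hyp_subspace_def by blast
  obtain q where q: "q \<in> hyperboloid" "q \<in> V" using V(3,4) by blast
  obtain e where e: "lorentz e e = 1" "V = {z. lorentz e z = 0}"
    using hyperplane_unit_normal[OF V(1,2) q(2)] q(1) hyperboloid_subset_timecone by blast
  obtain x where x: "x \<in> P" using P(2) by blast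
  have xt: "x \<in> timecone" and x0: "normal_coord a b x = 0"
    using x P(1) hyperboloid_subset_timecone by auto
  have near: "\<forall>\<^sub>F y in nhds x. y \<in> timecone"
    using xt open_timecone by (intro eventually_nhds_in_open)
  have inP: "radial y \<in> P" if "y \<in> timecone" "normal_coord a b y = 0" for y
    using that P(1) by (simp add: radial_in_hyperboloid normal_coord_eq_0_iff lorentz_radial_sign)
  have outP: "normal_coord a b y = 0" if "y \<in> timecone" "radial y \<in> P" for y
    using that P(1) by (simp add: normal_coord_eq_0_iff lorentz_radial_sign)
  have "\<forall>\<^sub>F y in nhds x. normal_coord a b y = 0 \<longrightarrow> lorentz e y = 0"
    using near
  proof eventually_elim
    case (elim y)
    then show ?case using inP[of y] Q(2) V(3) e(2) by (auto simp: lorentz_radial_sign)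
  qed
  then have en: "e = normal_vector a b (normal_coord a b e)"
    by (rule lorentz_vanishing_imp_normal[OF ab x0])
  have "\<forall>\<^sub>F y in nhds x. normal_coord a b y = 0 \<longrightarrow> lorentz v y = 0"
    using near
  proof eventually_elim
    case (elim y)
    then show ?case using inP[of y] Q(2) by (auto simp: lorentz_radial_sign)
  qed
  then have vn: "v = normal_vector a b (normal_coord a b v)"
    by (rule lorentz_vanishing_imp_normal[OF ab x0])
  define \<epsilon> where "\<epsilon> = normal_coord a b e"
  define \<nu> where "\<nu> = normal_coord a b v"
  define \<kappa> where "\<kappa> = Re (cnj \<nu> * (\<i> * \<epsilon>))"
  have le: "lorentz e y = Re (cnj \<epsilon> * normal_coord a b y)" for y
    using lorentz_normal_vector[of a b \<epsilon> y] en \<epsilon>_def by simp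
  have lv: "lorentz v y = Re (cnj \<nu> * normal_coord a b y)" for y
    using lorentz_normal_vector[of a b \<nu> y] vn \<nu>_def by simp
  have n\<epsilon>: "cnj \<epsilon> * \<epsilon> = 1" "\<epsilon> * cnj \<epsilon> = 1"
    using le[of e] e(1) by (simp_all add: complex_eq_iff flip: \<epsilon>_def)
  then have n1: "norm \<epsilon> = 1"
    by (metis complex_mod_cnj complex_norm_square mult.commute norm_one norm_mult of_real_1 of_real_eq_iff
        power2_eq_1_iff norm_ge_zero power2_eq_square abs_norm_cancel real_sqrt_abs real_sqrt_one)
  \<comment> \<open>A point of the hyperplane is determined in the normal plane by its coordinate along \<open>\<i>\<epsilon>\<close>.\<close>
  have onQ: "normal_coord a b y = Im (cnj \<epsilon> * normal_coord a b y) *\<^sub>R (\<i> * \<epsilon>)" if "lorentz e y = 0" for y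
  proof -
    have "cnj \<epsilon> * normal_coord a b y = Im (cnj \<epsilon> * normal_coord a b y) *\<^sub>R \<i>"
      using that le[of y] by (simp add: complex_eq_iff)
    then have "\<epsilon> * (cnj \<epsilon> * normal_coord a b y) = \<epsilon> * (Im (cnj \<epsilon> * normal_coord a b y) *\<^sub>R \<i>)"
      by (rule arg_cong)
    moreover have "\<epsilon> * (cnj \<epsilon> * normal_coord a b y) = normal_coord a b y"
      by (simp only: mult.assoc[symmetric] n\<epsilon> mult_1_left)
    moreover have "\<epsilon> * (t *\<^sub>R \<i>) = t *\<^sub>R (\<i> * \<epsilon>)" for t :: real
      by (simp add: mult.commute)
    ultimately show ?thesis by metis
  qed
  have vQ: "lorentz v y = s * \<kappa>" if "normal_coord a b y = s *\<^sub>R (\<i> * \<epsilon>)" for y s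
    unfolding lv that \<kappa>_def by (simp add: algebra_simps)
  have eQ: "lorentz e y = 0" if "normal_coord a b y = s *\<^sub>R (\<i> * \<epsilon>)" for y s
    unfolding le that using n\<epsilon> by (simp add: algebra_simps complex_eq_iff)
  \<comment> \<open>Otherwise moving \<open>x\<close> slightly within the hyperplane would stay in \<open>P\<close>.\<close>
  have \<kappa>: "\<kappa> \<noteq> 0"
  proof
    assume \<kappa>0: "\<kappa> = 0"
    define d where "d = normal_vector a b (\<i> * \<epsilon>)"
    have "((\<lambda>s. x + s *\<^sub>R d) \<longlongrightarrow> x + 0 *\<^sub>R d) (at 0)" by (intro tendsto_intros)
    then have "((\<lambda>s. x + s *\<^sub>R d) \<longlongrightarrow> x) (at 0)" by simp
    then have "\<forall>\<^sub>F s in at 0. x + s *\<^sub>R d \<in> timecone" using near by (rule eventually_compose_filterlim[rotated])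
    then have "\<forall>\<^sub>F s in at (0::real). s \<noteq> 0 \<and> x + s *\<^sub>R d \<in> timecone"
      using eventually_neq_at_within[of 0 0 UNIV] by eventually_elim auto
    then obtain s :: real where s: "s \<noteq> 0" "x + s *\<^sub>R d \<in> timecone"
      by (metis (mono_tags, lifting) eventually_happens trivial_limit_at)
    let ?y = "x + s *\<^sub>R d"
    have c: "normal_coord a b ?y = s *\<^sub>R (\<i> * \<epsilon>)" using x0 ab by (simp add: d_def)
    have "radial ?y \<in> Q" using s(2) V(3) e(2) eQ[OF c] by (simp add: radial_in_hyperboloid lorentz_radial_sign)
    moreover have "lorentz v (radial ?y) = 0" using vQ[OF c] \<kappa>0 s(2) by (simp add: lorentz_radial_sign)
    ultimately have "radial ?y \<in> P" using Q(2) by blast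
    then have "normal_coord a b ?y = 0" using outP s(2) by blast
    then show False using c s(1) n1 by auto
  qed
  define u where "u = sgn \<kappa> *\<^sub>R (\<i> * \<epsilon>)"
  show ?thesis
  proof (rule that[of u])
    show "norm u = 1" using \<kappa> n1 by (simp add: u_def norm_mult abs_sgn_eq)
    show "F = {x \<in> hyperboloid. \<exists>s\<ge>0. normal_coord a b x = s *\<^sub>R u}"
    proof (intro Set.set_eqI iffI)
      fix y assume "y \<in> F"
      then have y: "y \<in> hyperboloid" "lorentz e y = 0" "lorentz v y \<ge> 0" using Q(3) V(3) e(2) by auto
      define s where "s = Im (cnj \<epsilon> * normal_coord a b y)"
      have c: "normal_coord a b y = s *\<^sub>R (\<i> * \<epsilon>)" unfolding s_def by (rule onQ[OF y(2)])
      have "s * \<kappa> \<ge> 0" using vQ[OF c] y(3) by simp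
      then have "sgn \<kappa> * s \<ge> 0" using \<kappa> by (auto simp: sgn_real_def zero_le_mult_iff)
      moreover have "normal_coord a b y = (sgn \<kappa> * s) *\<^sub>R u"
        using c \<kappa> by (simp add: u_def sgn_real_def)
      ultimately show "y \<in> {x \<in> hyperboloid. \<exists>s\<ge>0. normal_coord a b x = s *\<^sub>R u}" using y(1) by blast
    next
      fix y assume "y \<in> {x \<in> hyperboloid. \<exists>s\<ge>0. normal_coord a b x = s *\<^sub>R u}"
      then obtain s where s: "y \<in> hyperboloid" "s \<ge> 0" "normal_coord a b y = s *\<^sub>R u" by blast
      have c: "normal_coord a b y = (s * sgn \<kappa>) *\<^sub>R (\<i> * \<epsilon>)" using s(3) by (simp add: u_def)
      have "sgn \<kappa> * \<kappa> \<ge> 0" by (simp add: sgn_real_def)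
      then have "lorentz v y \<ge> 0" using vQ[OF c] s(2) by (simp add: mult.assoc)
      then show "y \<in> F" using Q(3) V(3) e(2) eQ[OF c] s(1) by simp
    qed
  qed
qed

section \<open>The group of orientation-preserving isometries\<close>

lemma SO_plus_lorentz: "g \<in> carrier SO_plus \<Longrightarrow> lorentz (g *v x) (g *v y) = lorentz x y"
  by (simp add: SO_plus_def)

lemma SO_plus_hyperboloid: "g \<in> carrier SO_plus \<Longrightarrow> x \<in> hyperboloid \<Longrightarrow> g *v x \<in> hyperboloid"
  unfolding SO_plus_def by auto

lemma SO_plus_timecone:
  assumes "g \<in> carrier SO_plus" "y \<in> timecone"
  shows "g *v y \<in> timecone" "radial (g *v y) = g *v radial y"
proof -
  obtain c where c: "c > 0" "y = c *\<^sub>R radial y" using timecone_eq_scaled_radial[OF assms(2)] .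
  have "g *v y = c *\<^sub>R (g *v radial y)" using c(2) by (metis matrix_vector_mult_scaleR)
  moreover have "g *v radial y \<in> timecone"
    using SO_plus_hyperboloid[OF assms(1) radial_in_hyperboloid[OF assms(2)]] hyperboloid_subset_timecone by blast
  ultimately show "g *v y \<in> timecone" using timecone_scaleR c(1) by simp
  show "radial (g *v y) = g *v radial y"
    by (simp add: radial_def SO_plus_lorentz[OF assms(1)] matrix_vector_mult_scaleR)
qed

lemma SO_plus_surj:
  fixes g :: "'n::finite mink_mat"
  assumes "g \<in> carrier SO_plus" obtains x where "g *v x = y"
proof -
  have "invertible g" using assms by (simp add: SO_plus_def invertible_det_nz)
  then obtain h where "g ** h = mat 1" unfolding invertible_def by blast
  then have "g *v (h *v y) = y" by (simp add: matrix_vector_mul_assoc)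
  then show ?thesis using that by blast
qed

lemma SO_plus_simps:
  "x \<otimes>\<^bsub>SO_plus\<^esub> y = x ** y" "\<one>\<^bsub>SO_plus\<^esub> = mat 1"
  by (simp_all add: SO_plus_def)

lemma group_SO_plus: "group (SO_plus :: 'n::finite mink_mat monoid)"
proof (rule groupI)
  fix x y :: "'n mink_mat"
  assume xy: "x \<in> carrier SO_plus" "y \<in> carrier SO_plus"
  have "(*v) (x ** y) ` hyperboloid = (*v) x ` ((*v) y ` hyperboloid)"
    by (simp add: image_image matrix_vector_mul_assoc)
  then show "x \<otimes>\<^bsub>SO_plus\<^esub> y \<in> carrier SO_plus"
    using xy by (simp add: SO_plus_def det_mul flip: matrix_vector_mul_assoc)
next
  show "\<one>\<^bsub>SO_plus\<^esub> \<in> carrier (SO_plus :: 'n mink_mat monoid)" by (simp add: SO_plus_def)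
next
  fix x y z :: "'n mink_mat"
  show "x \<otimes>\<^bsub>SO_plus\<^esub> y \<otimes>\<^bsub>SO_plus\<^esub> z = x \<otimes>\<^bsub>SO_plus\<^esub> (y \<otimes>\<^bsub>SO_plus\<^esub> z)"
    by (simp add: SO_plus_simps matrix_mul_assoc)
next
  fix x :: "'n mink_mat"
  show "\<one>\<^bsub>SO_plus\<^esub> \<otimes>\<^bsub>SO_plus\<^esub> x = x" by (simp add: SO_plus_simps)
next
  fix x :: "'n mink_mat"
  assume x: "x \<in> carrier SO_plus"
  then have "invertible x" by (simp add: SO_plus_def invertible_det_nz)
  then obtain h where h: "x ** h = mat 1" "h ** x = mat 1" unfolding invertible_def by blast
  have xh: "x *v (h *v y) = y" and hx: "h *v (x *v y) = y" for y
    by (simp_all add: matrix_vector_mul_assoc h)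
  have "lorentz (h *v y) (h *v z) = lorentz y z" for y z
    using SO_plus_lorentz[OF x, of "h *v y" "h *v z"] by (simp add: xh)
  moreover have "det x * det h = 1" using h(1) by (metis det_I det_mul)
  then have "det h = 1" using x by (simp add: SO_plus_def)
  moreover have "(*v) h ` hyperboloid = hyperboloid"
  proof -
    have "(*v) h ` hyperboloid = (*v) h ` ((*v) x ` hyperboloid)" using x by (simp add: SO_plus_def)
    then show ?thesis by (simp add: image_image hx)
  qed
  ultimately have "h \<in> carrier SO_plus" by (simp add: SO_plus_def)
  then show "\<exists>y\<in>carrier SO_plus. y \<otimes>\<^bsub>SO_plus\<^esub> x = \<one>\<^bsub>SO_plus\<^esub>" using h(2) by (auto simp: SO_plus_simps)
qed

text \<open>Fixing a vector is a system of affine linear equations in the matrix entries.\<close>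

lemma zariski_closed_fixing: "zariski_closed {A :: 'n::finite mink_mat. A *v w = w}"
proof -
  let ?P = "range (\<lambda>k A. (A *v w - w) $ k)"
  have "real_polynomial_function (\<lambda>A :: 'n mink_mat. (A *v w - w) $ k)" for k
  proof -
    have "bounded_linear (\<lambda>A :: 'n mink_mat. (A *v w) $ k)"
      unfolding matrix_vector_mult_def vec_lambda_beta
      by (intro bounded_linear_sum bounded_linear_mult_const
          bounded_linear_compose[OF bounded_linear_vec_nth bounded_linear_vec_nth])
    then have "real_polynomial_function (\<lambda>A :: 'n mink_mat. (A *v w) $ k - w $ k)"
      by (intro real_polynomial_function_diff real_polynomial_function.intros)
    then show ?thesis by simp
  qed
  then show ?thesis unfolding zariski_closed_def
    by (intro exI[of _ ?P]) (auto simp: vec_eq_iff)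
qed

text \<open>A boost of hyperbolic cosine \<open>5/4\<close> and hyperbolic sine \<open>3/4\<close>, so that all entries are rational.\<close>

definition boost :: "'n::finite \<Rightarrow> 'n mink \<Rightarrow> 'n mink" where
  "boost i x = (\<chi> k. if k = None then 5/4 * x $ None + 3/4 * x $ Some i
                     else if k = Some i then 3/4 * x $ None + 5/4 * x $ Some i else x $ k)"

definition quarter_turn :: "'n::finite \<Rightarrow> 'n \<Rightarrow> 'n mink \<Rightarrow> 'n mink" where
  "quarter_turn i j x = (\<chi> k. if k = Some i then - (x $ Some j) else if k = Some j then x $ Some i else x $ k)"

text \<open>Squaring an isometry avoids the computation of its determinant, which is a sign.\<close>

lemma lorentz_pres_in_SO_plus:
  fixes f :: "'n::finite mink \<Rightarrow> 'n mink"
  assumes lin: "linear f" and pres: "\<And>x y. lorentz (f x) (f y) = lorentz x y"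
    and cone: "\<And>x. x \<in> timecone \<Longrightarrow> f x $ None > 0" and inv: "surj f"
    and cone': "\<And>x. f x \<in> timecone \<Longrightarrow> x $ None > 0"
  shows "matrix f ** matrix f \<in> carrier SO_plus" "(matrix f ** matrix f) *v x = f (f x)"
proof -
  have mf: "matrix f *v x = f x" for x using lin by (simp add: matrix_works)
  have mm: "(matrix f ** matrix f) *v x = f (f x)" for x
    by (simp add: mf flip: matrix_vector_mul_assoc)
  then show "(matrix f ** matrix f) *v x = f (f x)" .
  \<comment> \<open>The Gram matrix of the form is nondegenerate, so an isometry has determinant \<open>\<plusminus>1\<close>, and its square 1.\<close>
  define G where "G = (matrix lorentz_flip :: 'n mink_mat)"
  have linG: "linear (lorentz_flip :: 'n mink \<Rightarrow> 'n mink)"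
    by (rule linearI) (auto simp: lorentz_flip_def vec_eq_iff split: option.split)
  have G: "G *v x = lorentz_flip x" for x using linG by (simp add: G_def matrix_works)
  have "G ** G = mat 1"
    by (simp add: matrix_eq G flip: matrix_vector_mul_assoc)
  then have "det G * det G = 1" by (metis det_I det_mul)
  then have dG: "det G \<noteq> 0" by auto
  have "transpose (matrix f) ** G ** matrix f = G"
  proof -
    have "((transpose (matrix f) ** G ** matrix f) *v x) \<bullet> y = (G *v x) \<bullet> y" for x y
    proof -
      have "((transpose (matrix f) ** G ** matrix f) *v x) \<bullet> y = (transpose (matrix f) *v (G *v f x)) \<bullet> y"
        by (simp add: mf flip: matrix_vector_mul_assoc)
      also have "\<dots> = (G *v f x) \<bullet> (matrix f *v y)"
        by (simp add: dot_lmul_matrix)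
      also have "\<dots> = lorentz (f x) (f y)" by (simp add: G mf lorentz_eq_inner)
      also have "\<dots> = lorentz x y" by (rule pres)
      also have "\<dots> = (G *v x) \<bullet> y" by (simp add: G lorentz_eq_inner)
      finally show ?thesis .
    qed
    then have "(transpose (matrix f) ** G ** matrix f) *v x = G *v x" for x
      by (metis vector_eq_rdot)
    then show ?thesis by (simp add: matrix_eq)
  qed
  then have "det (matrix f) * det G * det (matrix f) = det G" by (metis det_mul det_transpose)
  then have "det (matrix f) * det (matrix f) = 1" using dG by simp
  then have det: "det (matrix f ** matrix f) = 1" by (simp add: det_mul)
  have hyp: "f ` hyperboloid = hyperboloid"
  proof (intro Set.set_eqI iffI)
    fix y assume "y \<in> f ` hyperboloid"
    then show "y \<in> hyperboloid"
      using cone hyperboloid_subset_timecone by (auto simp: hyperboloid_def pres)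
  next
    fix y :: "'n mink" assume y: "y \<in> hyperboloid"
    obtain x where "y = f x" using inv by (metis surjD)
    moreover have "f x \<in> timecone" using y \<open>y = f x\<close> hyperboloid_subset_timecone by blast
    ultimately have "x \<in> hyperboloid" using y cone'[of x] by (simp add: hyperboloid_def pres)
    then show "y \<in> f ` hyperboloid" using \<open>y = f x\<close> by blast
  qed
  have "(\<lambda>x. (matrix f ** matrix f) *v x) ` hyperboloid = f ` (f ` hyperboloid)" by (simp add: mm image_image)
  then have "(\<lambda>x. (matrix f ** matrix f) *v x) ` hyperboloid = hyperboloid" by (simp add: hyp)
  then show "matrix f ** matrix f \<in> carrier SO_plus"
    by (simp add: SO_plus_def mm pres det)
qed

lemma abs_space_coord_less:
  assumes "x \<in> timecone" shows "\<bar>x $ Some i\<bar> < x $ None"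
proof -
  have "\<bar>x $ Some i\<bar> = \<bar>space_part x $ i\<bar>" by (simp add: space_part_def)
  also have "\<dots> \<le> norm (space_part x)" by (rule component_le_norm_cart)
  finally show ?thesis using assms by (simp add: timecone_iff)
qed

lemma boost_in_SO_plus:
  "matrix (boost i) ** matrix (boost i) \<in> carrier SO_plus"
  "(matrix (boost i) ** matrix (boost i)) *v x = boost i (boost i x)"
proof -
  have lin: "linear (boost i)" by (rule linearI) (auto simp: boost_def vec_eq_iff field_simps)
  have pres: "lorentz (boost i x) (boost i y) = lorentz x y" for x y
  proof -
    have "(\<Sum>k\<in>UNIV. boost i x $ Some k * boost i y $ Some k)
        = boost i x $ Some i * boost i y $ Some i + (\<Sum>k\<in>UNIV - {i}. boost i x $ Some k * boost i y $ Some k)"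
      by (rule sum.remove) auto
    also have "(\<Sum>k\<in>UNIV - {i}. boost i x $ Some k * boost i y $ Some k) = (\<Sum>k\<in>UNIV - {i}. x $ Some k * y $ Some k)"
      by (rule sum.cong) (auto simp: boost_def)
    moreover have "(\<Sum>k\<in>UNIV. x $ Some k * y $ Some k) = x $ Some i * y $ Some i + (\<Sum>k\<in>UNIV - {i}. x $ Some k * y $ Some k)"
      by (rule sum.remove) auto
    ultimately show ?thesis by (simp add: lorentz_def) (simp add: boost_def algebra_simps)
  qed
  have surj: "surj (boost i)"
  proof (rule surjI)
    fix y
    show "boost i (\<chi> k. if k = None then 5/4 * y $ None - 3/4 * y $ Some i
                     else if k = Some i then - 3/4 * y $ None + 5/4 * y $ Some i else y $ k) = y"
      by (auto simp: boost_def vec_eq_iff field_simps)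
  qed
  have cone: "boost i x $ None > 0" if "x \<in> timecone" for x
    using abs_space_coord_less[OF that, of i] by (auto simp: boost_def abs_less_iff)
  have cone': "x $ None > 0" if "boost i x \<in> timecone" for x
  proof -
    have "x $ None = 5/4 * boost i x $ None - 3/4 * boost i x $ Some i" by (simp add: boost_def field_simps)
    then show ?thesis using abs_space_coord_less[OF that, of i] by linarith
  qed
  show "matrix (boost i) ** matrix (boost i) \<in> carrier SO_plus"
    "(matrix (boost i) ** matrix (boost i)) *v x = boost i (boost i x)"
    using lorentz_pres_in_SO_plus[OF lin pres cone surj cone'] by auto
qed

lemma quarter_turn_in_SO_plus:
  fixes i j :: "'n::finite"
  assumes ij: "i \<noteq> j"
  shows "matrix (quarter_turn i j) ** matrix (quarter_turn i j) \<in> carrier SO_plus"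
  "(matrix (quarter_turn i j) ** matrix (quarter_turn i j)) *v x = quarter_turn i j (quarter_turn i j x)"
proof -
  let ?q = "quarter_turn i j"
  have lin: "linear ?q" by (rule linearI) (auto simp: quarter_turn_def vec_eq_iff)
  have pres: "lorentz (?q x) (?q y) = lorentz x y" for x y
  proof -
    have split: "(\<Sum>k\<in>UNIV. f k) = f i + f j + (\<Sum>k\<in>UNIV - {i} - {j}. f k)" for f :: "'n \<Rightarrow> real"
      using ij by (simp add: sum.remove[of UNIV i] sum.remove[of "UNIV - {i}" j])
    have rest: "(\<Sum>k\<in>UNIV - {i} - {j}. ?q x $ Some k * ?q y $ Some k) = (\<Sum>k\<in>UNIV - {i} - {j}. x $ Some k * y $ Some k)"
      by (rule sum.cong) (auto simp: quarter_turn_def)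
    show ?thesis using ij unfolding lorentz_def split rest by (simp add: quarter_turn_def)
  qed
  have surj: "surj ?q"
  proof (rule surjI)
    fix y
    show "?q (\<chi> k. if k = Some i then y $ Some j else if k = Some j then - (y $ Some i) else y $ k) = y"
      using ij by (auto simp: quarter_turn_def vec_eq_iff)
  qed
  have cone: "?q x $ None > 0" if "x \<in> timecone" for x
    using that by (simp add: quarter_turn_def timecone_def)
  have cone': "x $ None > 0" if "?q x \<in> timecone" for x
    using that by (simp add: quarter_turn_def timecone_def)
  show "matrix ?q ** matrix ?q \<in> carrier SO_plus"
    "(matrix ?q ** matrix ?q) *v x = ?q (?q x)"
    using lorentz_pres_in_SO_plus[OF lin pres cone surj cone'] by auto
qed

text \<open>The square of a quarter turn negates two spacelike coordinates, so the spacelike part of a fixed vector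
vanishes; what remains is a multiple of the timelike basis vector, which a boost moves.\<close>

lemma SO_plus_fixed_vector:
  fixes w :: "'n::finite mink"
  assumes "CARD('n) \<ge> 2" and fixed: "\<And>A. A \<in> carrier SO_plus \<Longrightarrow> A *v w = w"
  shows "w = 0"
proof -
  have space: "w $ Some i = 0" for i
  proof -
    have "card (UNIV - {i}) \<noteq> 0" using assms(1) by (simp add: card_Diff_singleton)
    then have "UNIV - {i} \<noteq> {}" by (metis card.empty)
    then obtain j where "j \<in> UNIV - {i}" by blast
    then have ij: "i \<noteq> j" by auto
    have "quarter_turn i j (quarter_turn i j w) = w"
      using fixed[OF quarter_turn_in_SO_plus(1)[OF ij]] quarter_turn_in_SO_plus(2)[OF ij, of w] by simp
    then have "quarter_turn i j (quarter_turn i j w) $ Some i = w $ Some i" by simp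
    then show ?thesis using ij by (simp add: quarter_turn_def)
  qed
  have "w $ None = 0"
  proof -
    obtain i :: 'n where True by blast
    have "boost i (boost i w) = w"
      using fixed[OF boost_in_SO_plus(1), of i] boost_in_SO_plus(2)[of i w] by simp
    then have "boost i (boost i w) $ None = w $ None" by simp
    then show ?thesis using space[of i] by (simp add: boost_def)
  qed
  then show ?thesis using space by (metis not_None_eq vec_eq_iff zero_index)
qed

section \<open>Balanced rays in the plane\<close>

text \<open>Away from the cut of the principal branch, \<open>Arg\<close> is a local homomorphism relative to a base point.\<close>

lemma Arg_local_additive:
  assumes w: "w0 \<notin> \<real>\<^sub>\<le>\<^sub>0"
  shows "\<forall>\<^sub>F w in nhds w0. Arg w = Arg w0 + Arg (w / w0)"
proof -
  have w0: "w0 \<noteq> 0" using w by auto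
  have nr: "Arg w0 \<noteq> pi" using w by (metis Arg_eq_pi_iff complex_is_Real_iff complex_nonpos_Reals_iff less_imp_le Arg_eq_pi)
  have A: "- pi < Arg w0" "Arg w0 < pi" using mpi_less_Arg[of w0] Arg_le_pi[of w0] nr by auto
  have "((\<lambda>w. w / w0) \<longlongrightarrow> w0 / w0) (nhds w0)"
    using w0 by (intro tendsto_divide tendsto_const) (auto simp: filterlim_ident)
  then have "((\<lambda>w. Arg (w / w0)) \<longlongrightarrow> Arg (w0 / w0)) (nhds w0)"
    using w0 by (intro tendsto_Arg) auto
  then have lim: "((\<lambda>w. Arg (w / w0)) \<longlongrightarrow> 0) (nhds w0)" using w0 by simp
  have "\<forall>\<^sub>F w in nhds w0. w \<noteq> 0" using w0 by (intro t1_space_nhds)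
  moreover have "\<forall>\<^sub>F w in nhds w0. Arg (w / w0) > - pi - Arg w0" using A by (intro order_tendstoD(1)[OF lim]) auto
  moreover have "\<forall>\<^sub>F w in nhds w0. Arg (w / w0) < pi - Arg w0" using A by (intro order_tendstoD(2)[OF lim]) auto
  ultimately show ?thesis
  proof eventually_elim
    case (elim w)
    then have "Arg (w0 * (w / w0)) = Arg w0 + Arg (w / w0)"
      using w0 by (intro Arg_times) auto
    then show ?case using w0 by simp
  qed
qed

text \<open>The function \<open>arg(-\<zeta>/u) Im(\<zeta>/u)\<close> has its branch cut along the ray through \<open>u\<close>. Crossing it changes
the argument by \<open>2\<pi>\<close>, which after division by \<open>\<pi>\<close> is a break by \<open>\<bar>Im(\<zeta>/u)\<bar>\<close>. Besides that and a linear
function there only remains a term with the local argument \<open>Arg(\<zeta>/\<zeta>0)\<close>, common to all \<open>u\<close>.\<close>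

lemma single_ray_break:
  fixes u \<zeta>0 :: complex
  assumes u: "u \<noteq> 0" and \<zeta>0: "\<zeta>0 \<noteq> 0"
  shows "\<exists>\<kappa>. \<forall>\<^sub>F \<zeta> in nhds \<zeta>0. - (Arg (- (\<zeta> / u)) * Im (\<zeta> / u)) / pi =
     \<kappa> * Im (\<zeta> / u) - Arg (\<zeta> / \<zeta>0) * Im (\<zeta> / u) / pi +
     (if \<exists>s>0. \<zeta>0 = s *\<^sub>R u then \<bar>Im (\<zeta> / u)\<bar> else 0)"
proof (cases "\<exists>s>0. \<zeta>0 = s *\<^sub>R u")
  case True
  then obtain s where s: "s > 0" "\<zeta>0 = s *\<^sub>R u" by blast
  have q0: "\<zeta>0 / u = of_real s" using s u by (simp add: scaleR_conv_of_real)
  have nr: "\<zeta>0 / u \<notin> \<real>\<^sub>\<le>\<^sub>0" unfolding q0 using s by simp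
  have tend: "filterlim (\<lambda>\<zeta>. \<zeta> / u) (nhds (\<zeta>0 / u)) (nhds \<zeta>0)"
    using u by (intro tendsto_intros filterlim_ident) auto
  have ev1: "\<forall>\<^sub>F \<zeta> in nhds \<zeta>0. Arg (\<zeta> / u) = Arg (\<zeta>0 / u) + Arg (\<zeta> / u / (\<zeta>0 / u))"
    using eventually_compose_filterlim[OF Arg_local_additive[OF nr] tend] .
  have ev2: "\<forall>\<^sub>F \<zeta> in nhds \<zeta>0. \<zeta> \<noteq> 0" using \<zeta>0 by (intro t1_space_nhds)
  have A0: "Arg (\<zeta>0 / u) = 0" unfolding q0 using s by (simp add: Arg_of_real)
  have "\<forall>\<^sub>F \<zeta> in nhds \<zeta>0. - (Arg (- (\<zeta> / u)) * Im (\<zeta> / u)) / pi =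
     0 * Im (\<zeta> / u) - Arg (\<zeta> / \<zeta>0) * Im (\<zeta> / u) / pi + \<bar>Im (\<zeta> / u)\<bar>"
    using ev1 ev2
  proof eventually_elim
    case (elim \<zeta>)
    define q where "q = \<zeta> / u"
    have q: "q \<noteq> 0" using elim u by (simp add: q_def)
    have "Arg q = Arg (\<zeta> / \<zeta>0)" using elim A0 u by (simp add: q_def)
    moreover have "- (Arg (- q) * Im q) / pi = - Arg q * Im q / pi + \<bar>Im q\<bar>"
    proof (cases "Im q = 0")
      case False
      then show ?thesis
      proof (cases "Im q < 0")
        case True
        then have "Arg q \<le> 0" using Arg_neg_iff[of q] by simp
        then have "Arg (- q) = Arg q + pi" using q by (simp add: Arg_minus)
        then show ?thesis using True by (simp add: field_simps)
      next
        case nneg: False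
        then have "Arg q > 0" using False Arg_neg_iff[of q] Arg_eq_0[of q] by (auto simp: complex_is_Real_iff)
        then have Am: "Arg (- q) = Arg q - pi" using q by (simp add: Arg_minus)
        show ?thesis unfolding Am using nneg by (simp add: field_simps)
      qed
    qed simp
    ultimately show ?case by (simp add: q_def)
  qed
  then show ?thesis unfolding if_P[OF True] by (rule exI)
next
  case False
  have nr: "- (\<zeta>0 / u) \<notin> \<real>\<^sub>\<le>\<^sub>0"
  proof
    assume "- (\<zeta>0 / u) \<in> \<real>\<^sub>\<le>\<^sub>0"
    then have "Im (\<zeta>0 / u) = 0" "Re (\<zeta>0 / u) \<ge> 0" by (auto simp: complex_nonpos_Reals_iff)
    then have q: "\<zeta>0 / u = of_real (Re (\<zeta>0 / u))" by (simp add: complex_eq_iff)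
    moreover have "\<zeta>0 / u \<noteq> 0" using u \<zeta>0 by simp
    ultimately have "Re (\<zeta>0 / u) > 0" using \<open>Re (\<zeta>0 / u) \<ge> 0\<close> by (metis of_real_0 order_le_less)
    moreover have "\<zeta>0 = Re (\<zeta>0 / u) *\<^sub>R u" using q u by (metis nonzero_divide_eq_eq scaleR_conv_of_real)
    ultimately show False using False by blast
  qed
  have tend: "filterlim (\<lambda>\<zeta>. - (\<zeta> / u)) (nhds (- (\<zeta>0 / u))) (nhds \<zeta>0)"
    using u by (intro tendsto_intros filterlim_ident) auto
  have "\<forall>\<^sub>F \<zeta> in nhds \<zeta>0. Arg (- (\<zeta> / u)) = Arg (- (\<zeta>0 / u)) + Arg (- (\<zeta> / u) / - (\<zeta>0 / u))"
    using eventually_compose_filterlim[OF Arg_local_additive[OF nr] tend] .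
  then have "\<forall>\<^sub>F \<zeta> in nhds \<zeta>0. - (Arg (- (\<zeta> / u)) * Im (\<zeta> / u)) / pi =
     (- Arg (- (\<zeta>0 / u)) / pi) * Im (\<zeta> / u) - Arg (\<zeta> / \<zeta>0) * Im (\<zeta> / u) / pi + 0"
  proof eventually_elim
    case (elim \<zeta>)
    have "- (\<zeta> / u) / - (\<zeta>0 / u) = \<zeta> / \<zeta>0" using u by simp
    then show ?case unfolding elim by (simp add: algebra_simps add_divide_distrib diff_divide_distrib)
  qed
  then show ?thesis unfolding if_not_P[OF False] by (rule exI)
qed

text \<open>The terms with the local argument add up to a multiple of \<open>Im(\<zeta> cnj (\<Sum> \<tau>\<^sub>u u))\<close>, which is zero by
balance. The sum is therefore piecewise linear with the prescribed breaks.\<close>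

lemma balanced_rays_break:
  fixes R :: "complex set" and \<tau> :: "complex \<Rightarrow> real"
  assumes R: "finite R" "\<And>u. u \<in> R \<Longrightarrow> norm u = 1" and bal: "(\<Sum>u\<in>R. \<tau> u *\<^sub>R u) = 0"
    and \<zeta>0: "\<zeta>0 \<noteq> 0"
  shows "\<exists>\<kappa>. \<forall>\<^sub>F \<zeta> in nhds \<zeta>0. (\<Sum>u\<in>R. \<tau> u * (- (Arg (- (\<zeta> / u)) * Im (\<zeta> / u)) / pi)) =
     (\<Sum>u\<in>R. \<kappa> u * Im (\<zeta> / u)) + (\<Sum>u\<in>R. if \<exists>s>0. \<zeta>0 = s *\<^sub>R u then \<tau> u * \<bar>Im (\<zeta> / u)\<bar> else 0)"
proof -
  have "\<forall>u\<in>R. \<exists>\<kappa>. \<forall>\<^sub>F \<zeta> in nhds \<zeta>0. - (Arg (- (\<zeta> / u)) * Im (\<zeta> / u)) / pi =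
     \<kappa> * Im (\<zeta> / u) - Arg (\<zeta> / \<zeta>0) * Im (\<zeta> / u) / pi +
     (if \<exists>s>0. \<zeta>0 = s *\<^sub>R u then \<bar>Im (\<zeta> / u)\<bar> else 0)"
  proof
    fix u assume "u \<in> R"
    then have "u \<noteq> 0" using R(2)[of u] by auto
    then show "\<exists>\<kappa>. \<forall>\<^sub>F \<zeta> in nhds \<zeta>0. - (Arg (- (\<zeta> / u)) * Im (\<zeta> / u)) / pi =
     \<kappa> * Im (\<zeta> / u) - Arg (\<zeta> / \<zeta>0) * Im (\<zeta> / u) / pi +
     (if \<exists>s>0. \<zeta>0 = s *\<^sub>R u then \<bar>Im (\<zeta> / u)\<bar> else 0)"
      by (rule single_ray_break[OF _ \<zeta>0])
  qed
  note choice = bchoice[OF this]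
  obtain \<kappa> where \<kappa>: "\<forall>u\<in>R. \<forall>\<^sub>F \<zeta> in nhds \<zeta>0. - (Arg (- (\<zeta> / u)) * Im (\<zeta> / u)) / pi =
     \<kappa> u * Im (\<zeta> / u) - Arg (\<zeta> / \<zeta>0) * Im (\<zeta> / u) / pi +
     (if \<exists>s>0. \<zeta>0 = s *\<^sub>R u then \<bar>Im (\<zeta> / u)\<bar> else 0)"
    using choice ..
  have cancel: "(\<Sum>u\<in>R. \<tau> u * Im (\<zeta> / u)) = 0" for \<zeta>
  proof -
    have "\<zeta> / u = \<zeta> * cnj u" if "u \<in> R" for u
      using R(2)[OF that] complex_div_cnj[of \<zeta> u] by simp
    then have "(\<Sum>u\<in>R. \<tau> u * Im (\<zeta> / u)) = (\<Sum>u\<in>R. \<tau> u * Im (\<zeta> * cnj u))"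
      by (intro sum.cong) (simp_all only:)
    also have "\<dots> = Im (\<Sum>u\<in>R. \<tau> u *\<^sub>R (\<zeta> * cnj u))"
      by (simp only: Im_sum scaleR_complex.sel)
    also have "(\<Sum>u\<in>R. \<tau> u *\<^sub>R (\<zeta> * cnj u)) = \<zeta> * cnj (\<Sum>u\<in>R. \<tau> u *\<^sub>R u)"
      by (simp add: sum_distrib_left scaleR_conv_of_real mult.left_commute)
    finally show ?thesis by (simp add: bal)
  qed
  have "\<forall>\<^sub>F \<zeta> in nhds \<zeta>0. \<forall>u\<in>R. - (Arg (- (\<zeta> / u)) * Im (\<zeta> / u)) / pi =
     \<kappa> u * Im (\<zeta> / u) - Arg (\<zeta> / \<zeta>0) * Im (\<zeta> / u) / pi +
     (if \<exists>s>0. \<zeta>0 = s *\<^sub>R u then \<bar>Im (\<zeta> / u)\<bar> else 0)"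
    using \<kappa> R(1) by (simp add: eventually_ball_finite)
  then have "\<forall>\<^sub>F \<zeta> in nhds \<zeta>0. (\<Sum>u\<in>R. \<tau> u * (- (Arg (- (\<zeta> / u)) * Im (\<zeta> / u)) / pi)) =
     (\<Sum>u\<in>R. (\<tau> u * \<kappa> u) * Im (\<zeta> / u)) + (\<Sum>u\<in>R. if \<exists>s>0. \<zeta>0 = s *\<^sub>R u then \<tau> u * \<bar>Im (\<zeta> / u)\<bar> else 0)"
  proof eventually_elim
    case (elim \<zeta>)
    have distrib: "t * (k * i - A * i / pi + (if p then \<bar>i\<bar> else 0)) =
        t * k * i + (if p then t * \<bar>i\<bar> else 0) - A / pi * (t * i)" for t k i A :: real and p
      by (simp add: algebra_simps)
    have "(\<Sum>u\<in>R. \<tau> u * (- (Arg (- (\<zeta> / u)) * Im (\<zeta> / u)) / pi)) =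
        (\<Sum>u\<in>R. (\<tau> u * \<kappa> u) * Im (\<zeta> / u) + (if \<exists>s>0. \<zeta>0 = s *\<^sub>R u then \<tau> u * \<bar>Im (\<zeta> / u)\<bar> else 0)
          - (Arg (\<zeta> / \<zeta>0) / pi) * (\<tau> u * Im (\<zeta> / u)))"
    proof (rule sum.cong[OF refl])
      fix u assume "u \<in> R"
      then show "\<tau> u * (- (Arg (- (\<zeta> / u)) * Im (\<zeta> / u)) / pi) = (\<tau> u * \<kappa> u) * Im (\<zeta> / u)
          + (if \<exists>s>0. \<zeta>0 = s *\<^sub>R u then \<tau> u * \<bar>Im (\<zeta> / u)\<bar> else 0) - (Arg (\<zeta> / \<zeta>0) / pi) * (\<tau> u * Im (\<zeta> / u))"
        by (subst bspec[OF elim], assumption) (rule distrib)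
    qed
    also have "\<dots> = (\<Sum>u\<in>R. (\<tau> u * \<kappa> u) * Im (\<zeta> / u)) + (\<Sum>u\<in>R. if \<exists>s>0. \<zeta>0 = s *\<^sub>R u then \<tau> u * \<bar>Im (\<zeta> / u)\<bar> else 0)
          - (Arg (\<zeta> / \<zeta>0) / pi) * (\<Sum>u\<in>R. \<tau> u * Im (\<zeta> / u))"
      by (simp add: sum.distrib sum_subtractf sum_distrib_left)
    finally show ?case by (simp add: cancel)
  qed
  then show ?thesis by (rule exI[of _ "\<lambda>u. \<tau> u * \<kappa> u"])
qed

text \<open>Two points of the ball are joined through a third one that lies over a well-chosen direction of the
normal plane.\<close>

lemma connected_ball_off_axis:
  fixes x :: "'n::finite mink"
  assumes ab: "lorentz_orthonormal a b" and x: "normal_coord a b x = 0" and r: "r > 0"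
  shows "connected (ball x r \<inter> {z. normal_coord a b z \<noteq> 0})" (is "connected ?S")
    and "ball x r \<inter> {z. normal_coord a b z \<noteq> 0} \<noteq> {}"
proof -
  let ?\<zeta> = "normal_coord a b"
  have near: "\<exists>\<delta>>0. x + \<delta> *\<^sub>R normal_vector a b u \<in> ball x r" for u
  proof -
    let ?v = "normal_vector a b u"
    define \<delta> where "\<delta> = r / (2 * (norm ?v + 1))"
    have nv: "norm ?v + 1 > 0" using norm_ge_zero[of ?v] by linarith
    have "\<delta> > 0" using r nv by (simp add: \<delta>_def)
    moreover have "\<delta> * norm ?v < r"
    proof -
      have "\<delta> * norm ?v < \<delta> * (2 * (norm ?v + 1))" using \<open>\<delta> > 0\<close> nv by (intro mult_strict_left_mono) auto
      also have "\<dots> = r" using nv by (simp add: \<delta>_def)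
      finally show ?thesis .
    qed
    ultimately show ?thesis by (intro exI[of _ \<delta>]) (simp add: dist_norm)
  qed
  obtain \<delta> where "\<delta> > 0" "x + \<delta> *\<^sub>R normal_vector a b 1 \<in> ball x r" using near by blast
  moreover have "?\<zeta> (x + \<delta> *\<^sub>R normal_vector a b 1) = \<delta> *\<^sub>R 1" using x ab by simp
  ultimately show "?S \<noteq> {}" by force
  \<comment> \<open>A segment from \<open>p\<close> to a point over the direction \<open>u\<close> meets the axis only if \<open>u\<close> is a nonpositive
    multiple of the coordinate of \<open>p\<close>.\<close>
  have seg: "closed_segment p (x + \<delta> *\<^sub>R normal_vector a b u) \<subseteq> ?S"
    if p: "p \<in> ?S" and \<delta>: "\<delta> > 0" "x + \<delta> *\<^sub>R normal_vector a b u \<in> ball x r"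
      and u: "\<And>k. k \<ge> 0 \<Longrightarrow> u \<noteq> - (k *\<^sub>R ?\<zeta> p)" "u \<noteq> 0" for p \<delta> u
  proof
    fix z assume z: "z \<in> closed_segment p (x + \<delta> *\<^sub>R normal_vector a b u)"
    have "closed_segment p (x + \<delta> *\<^sub>R normal_vector a b u) \<subseteq> ball x r"
      using p \<delta>(2) by (intro closed_segment_subset) auto
    moreover have "?\<zeta> z \<noteq> 0"
    proof
      assume z0: "?\<zeta> z = 0"
      obtain t where t: "0 \<le> t" "t \<le> 1" "z = (1 - t) *\<^sub>R p + t *\<^sub>R (x + \<delta> *\<^sub>R normal_vector a b u)"
        using z unfolding closed_segment_def by blast
      have eq: "(1 - t) *\<^sub>R ?\<zeta> p + (t * \<delta>) *\<^sub>R u = 0" using z0 x ab unfolding t(3) by simp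
      show False
      proof (cases "t = 0")
        case True
        then show False using eq p by simp
      next
        case False
        then have pos: "t * \<delta> > 0" using t \<delta> by simp
        have "(t * \<delta>) *\<^sub>R u = - ((1 - t) *\<^sub>R ?\<zeta> p)" using eq by (simp add: add_eq_0_iff2)
        then have "(1 / (t * \<delta>)) *\<^sub>R ((t * \<delta>) *\<^sub>R u) = (1 / (t * \<delta>)) *\<^sub>R - ((1 - t) *\<^sub>R ?\<zeta> p)" by (rule arg_cong)
        then have "u = - (((1 - t) / (t * \<delta>)) *\<^sub>R ?\<zeta> p)" using False \<delta>(1) by simp
        moreover have "(1 - t) / (t * \<delta>) \<ge> 0" using pos t by simp
        ultimately show False using u(1) by blast
      qed
    qed
    ultimately show "z \<in> ?S" using z by blast
  qed
  have "connected_component ?S p q" if p: "p \<in> ?S" and q: "q \<in> ?S" for p q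
  proof -
    \<comment> \<open>Each of \<open>p\<close>, \<open>q\<close> blocks at most one unit direction, and three are available.\<close>
    have one: "u = v" if "k \<ge> 0" "l \<ge> 0" "u = - (k *\<^sub>R w)" "v = - (l *\<^sub>R w)" "norm u = 1" "norm v = 1"
      for k l :: real and u v w :: complex
    proof -
      have "k * norm w = 1" "l * norm w = 1" using that by auto
      then have "k = l" by (metis mult_cancel_right mult_zero_right zero_neq_one)
      then show ?thesis using that by simp
    qed
    define bad where "bad w = {u. norm u = 1 \<and> (\<exists>k\<ge>0. u = - (k *\<^sub>R w))}" for w :: complex
    have "\<exists>u. norm u = 1 \<and> u \<notin> bad (?\<zeta> p) \<and> u \<notin> bad (?\<zeta> q)"
    proof (rule ccontr)
      assume "\<not> ?thesis"
      then have *: "u \<in> bad (?\<zeta> p) \<or> u \<in> bad (?\<zeta> q)" if "norm u = 1" for u using that by blast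
      have "u = v" if "u \<in> bad w" "v \<in> bad w" for u v w using that one unfolding bad_def by blast
      moreover have "(1::complex) \<noteq> \<i>" "(1::complex) \<noteq> - 1" "\<i> \<noteq> - 1" by (auto simp: complex_eq_iff)
      ultimately show False using *[of 1] *[of \<i>] *[of "-1"] by (metis norm_ii norm_minus_cancel norm_one)
    qed
    then obtain u where u: "norm u = 1" "u \<notin> bad (?\<zeta> p)" "u \<notin> bad (?\<zeta> q)" by blast
    obtain \<delta> where \<delta>: "\<delta> > 0" "x + \<delta> *\<^sub>R normal_vector a b u \<in> ball x r" using near by blast
    let ?w = "x + \<delta> *\<^sub>R normal_vector a b u"
    have "u \<noteq> 0" "\<And>k. k \<ge> 0 \<Longrightarrow> u \<noteq> - (k *\<^sub>R ?\<zeta> p)" "\<And>k. k \<ge> 0 \<Longrightarrow> u \<noteq> - (k *\<^sub>R ?\<zeta> q)"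
      using u by (auto simp: bad_def)
    then have "closed_segment p ?w \<subseteq> ?S" "closed_segment q ?w \<subseteq> ?S"
      using seg[OF p \<delta>] seg[OF q \<delta>] by blast+
    moreover have "connected (closed_segment p ?w \<union> closed_segment q ?w)"
      by (rule connected_Un) auto
    ultimately show ?thesis unfolding connected_component_def
      by (intro exI[of _ "closed_segment p ?w \<union> closed_segment q ?w"]) auto
  qed
  then show "connected ?S" by (simp add: connected_iff_connected_component)
qed

section \<open>The cones over a branched hypersurface and its bindings\<close>

locale branched_lattice =
  fixes \<Gamma> :: "'n::finite mink_mat set" and \<Delta> B :: "'n mink set set"
  assumes subgroup: "subgroup \<Gamma> SO_plus" and branched: "branched_hypersurface \<Gamma> \<Delta> B"
begin

definition proj :: "'n mink \<Rightarrow> 'n mink set" where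
  "proj y = orbit \<Gamma> (radial y)"

text \<open>The cones over the lifts of the hypersurface and of the branching locus.\<close>

definition D :: "'n mink set" where "D = {y \<in> timecone. proj y \<in> \<Delta>}"
definition N :: "'n mink set" where "N = {y \<in> timecone. proj y \<in> B}"

definition wall :: "'n mink \<Rightarrow> 'n mink set set" where
  "wall y = connected_component_of_set (subtopology (quotient_manifold \<Gamma>) (\<Delta> - B)) (proj y)"

lemma \<Gamma>_SO: "g \<in> \<Gamma> \<Longrightarrow> g \<in> carrier SO_plus"
  using subgroup.mem_carrier[OF subgroup] .

lemma \<Gamma>_mult: "g \<in> \<Gamma> \<Longrightarrow> h \<in> \<Gamma> \<Longrightarrow> g ** h \<in> \<Gamma>"
  using subgroup.m_closed[OF subgroup] by (simp add: SO_plus_simps)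

lemma \<Gamma>_inverse:
  assumes "g \<in> \<Gamma>" obtains h where "h \<in> \<Gamma>" "h ** g = mat 1" "g ** h = mat 1"
proof -
  have "inv\<^bsub>SO_plus\<^esub> g \<in> \<Gamma>" using subgroup.m_inv_closed[OF subgroup assms] .
  moreover have "inv\<^bsub>SO_plus\<^esub> g ** g = mat 1" "g ** inv\<^bsub>SO_plus\<^esub> g = mat 1"
    using group.l_inv[OF group_SO_plus \<Gamma>_SO[OF assms]] group.r_inv[OF group_SO_plus \<Gamma>_SO[OF assms]]
    by (simp_all add: SO_plus_simps)
  ultimately show ?thesis using that by blast
qed

lemma orbit_invariant: "g \<in> \<Gamma> \<Longrightarrow> orbit \<Gamma> (g *v x) = orbit \<Gamma> x"
proof -
  assume g: "g \<in> \<Gamma>"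
  obtain h where h: "h \<in> \<Gamma>" "h ** g = mat 1" "g ** h = mat 1" using \<Gamma>_inverse[OF g] .
  have "\<exists>k\<in>\<Gamma>. k' *v x = k *v (g *v x)" if "k' \<in> \<Gamma>" for k'
  proof (rule bexI[of _ "k' ** h"])
    have "k' ** h ** g = k'" by (metis h(2) matrix_mul_assoc matrix_mul_rid)
    then show "k' *v x = k' ** h *v (g *v x)" by (simp add: matrix_vector_mul_assoc)
  qed (use \<Gamma>_mult that h in auto)
  moreover have "\<exists>k\<in>\<Gamma>. k' *v (g *v x) = k *v x" if "k' \<in> \<Gamma>" for k'
    using \<Gamma>_mult[OF that g] by (auto simp: matrix_vector_mul_assoc)
  ultimately show ?thesis unfolding orbit_def by fastforce
qed

lemma orbit_eqD:
  assumes "orbit \<Gamma> x = orbit \<Gamma> y" obtains g where "g \<in> \<Gamma>" "x = g *v y"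
proof -
  have "mat 1 \<in> \<Gamma>" using subgroup.one_closed[OF subgroup] by (simp add: SO_plus_simps)
  then have "x \<in> orbit \<Gamma> x" unfolding orbit_def by (metis image_eqI matrix_vector_mul_lid)
  then show ?thesis using that assms unfolding orbit_def by blast
qed

lemma proj_invariant: "g \<in> \<Gamma> \<Longrightarrow> y \<in> timecone \<Longrightarrow> proj (g *v y) = proj y"
  by (simp add: proj_def SO_plus_timecone \<Gamma>_SO orbit_invariant)

lemma wall_invariant: "g \<in> \<Gamma> \<Longrightarrow> y \<in> timecone \<Longrightarrow> wall (g *v y) = wall y"
  by (simp add: wall_def proj_invariant)

lemma D_invariant: "g \<in> \<Gamma> \<Longrightarrow> y \<in> timecone \<Longrightarrow> g *v y \<in> D \<longleftrightarrow> y \<in> D"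
  by (simp add: D_def proj_invariant SO_plus_timecone \<Gamma>_SO)

lemma N_invariant: "g \<in> \<Gamma> \<Longrightarrow> y \<in> timecone \<Longrightarrow> g *v y \<in> N \<longleftrightarrow> y \<in> N"
  by (simp add: N_def proj_invariant SO_plus_timecone \<Gamma>_SO)

lemma N_subset_D: "N \<subseteq> D"
  using branched by (auto simp: N_def D_def branched_hypersurface_def)

lemma D_timecone: "D \<subseteq> timecone"
  by (auto simp: D_def)

lemma proj_hyperboloid: "x \<in> hyperboloid \<Longrightarrow> proj x = orbit \<Gamma> x"
  by (simp add: proj_def radial_hyperboloid)

lemma topspace_quotient: "topspace (quotient_manifold \<Gamma>) = orbit \<Gamma> ` hyperboloid"
proof -
  have "lift \<Gamma> (orbit \<Gamma> ` hyperboloid) = hyperboloid" by (auto simp: lift_def)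
  then have "openin (quotient_manifold \<Gamma>) (orbit \<Gamma> ` hyperboloid)"
    by (simp add: openin_quotient_manifold)
  then show ?thesis
    by (metis openin_quotient_manifold openin_subset openin_topspace subset_antisym)
qed

lemma continuous_map_proj: "continuous_map (top_of_set timecone) (quotient_manifold \<Gamma>) proj"
  unfolding continuous_map_def
proof (intro conjI allI impI)
  show "proj \<in> topspace (top_of_set timecone) \<rightarrow> topspace (quotient_manifold \<Gamma>)"
    by (auto simp: topspace_quotient proj_def radial_in_hyperboloid)
  fix U assume U: "openin (quotient_manifold \<Gamma>) U"
  have "{x \<in> timecone. proj x \<in> U} = {x \<in> timecone. radial x \<in> lift \<Gamma> U}"
    by (auto simp: proj_def lift_def radial_in_hyperboloid)
  moreover have "openin (top_of_set timecone) (timecone \<inter> radial -` lift \<Gamma> U)"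
    by (rule continuous_openin_preimage[OF continuous_on_radial, of hyperboloid])
      (use U openin_quotient_manifold radial_in_hyperboloid in auto)
  ultimately show "openin (top_of_set timecone) {x \<in> topspace (top_of_set timecone). proj x \<in> U}"
    by (simp add: vimage_def Collect_conj_eq)
qed

lemma open_off_closed:
  assumes "closedin (quotient_manifold \<Gamma>) S"
  shows "open (timecone - {y \<in> timecone. proj y \<in> S})"
proof -
  have "closedin (top_of_set timecone) {y \<in> timecone. proj y \<in> S}"
    using closedin_continuous_map_preimage[OF continuous_map_proj assms] by simp
  then have "openin (top_of_set timecone) (timecone - {y \<in> timecone. proj y \<in> S})"
    by (simp add: openin_diff)
  then show ?thesis using openin_open_trans open_timecone by blast
qed

lemma open_off_D: "open (timecone - D)" and open_off_N: "open (timecone - N)"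
  using open_off_closed branched by (auto simp: D_def N_def branched_hypersurface_def)

lemma eventually_timecone: "y \<in> timecone \<Longrightarrow> \<forall>\<^sub>F z in nhds y. z \<in> timecone"
  using open_timecone by (intro eventually_nhds_in_open)

lemma eventually_off_N: "y \<in> timecone - N \<Longrightarrow> \<forall>\<^sub>F z in nhds y. z \<in> timecone - N"
  using open_off_N by (intro eventually_nhds_in_open)

text \<open>A connected set upstairs that avoids the bindings projects into a single wall.\<close>

lemma wall_const_on_connected:
  assumes "connected S" "S \<subseteq> D - N" "x \<in> S" "y \<in> S"
  shows "wall x = wall y"
proof -
  let ?X = "subtopology (quotient_manifold \<Gamma>) (\<Delta> - B)"
  have S: "S \<subseteq> timecone" using assms(2) D_timecone by blast
  have "connectedin (top_of_set timecone) S"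
    using assms(1) S by (simp add: connectedin_subtopology)
  then have "connectedin (quotient_manifold \<Gamma>) (proj ` S)"
    by (rule connectedin_continuous_map_image[OF continuous_map_proj])
  moreover have "proj ` S \<subseteq> \<Delta> - B" using assms(2) by (auto simp: D_def N_def)
  ultimately have "connectedin ?X (proj ` S)" by (simp add: connectedin_subtopology)
  then have "connected_component_of ?X (proj x) (proj y)"
    unfolding connected_component_of_def using assms(3,4) by blast
  then have "connected_component_of ?X (proj x) = connected_component_of ?X (proj y)"
    by (simp add: connected_component_of_equiv)
  then show ?thesis by (simp add: wall_def)
qed

text \<open>An invariant, locally constant property of points of the lifted branching locus descends to a subset of
\<open>B\<close> that is closed, together with its complement in \<open>B\<close>; so it is constant on components.\<close>

lemma locally_const_on_binding:
  assumes inv: "\<And>x y. x \<in> N \<Longrightarrow> y \<in> N \<Longrightarrow> proj x = proj y \<Longrightarrow> Q x \<longleftrightarrow> Q y"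
    and loc: "\<And>x. x \<in> N \<Longrightarrow> \<forall>\<^sub>F y in nhds x. y \<in> N \<longrightarrow> (Q y \<longleftrightarrow> Q x)"
    and xy: "x \<in> N" "y \<in> N"
      "connected_component_of (subtopology (quotient_manifold \<Gamma>) B) (proj x) (proj y)"
  shows "Q x \<longleftrightarrow> Q y"
proof -
  let ?X = "quotient_manifold \<Gamma>" and ?Y = "subtopology (quotient_manifold \<Gamma>) B"
  have clB: "closedin ?X B" using branched by (simp add: branched_hypersurface_def)
  have clo: "closedin ?X {p. \<exists>x\<in>N. proj x = p \<and> Q' x}"
    if inv': "\<And>x y. x \<in> N \<Longrightarrow> y \<in> N \<Longrightarrow> proj x = proj y \<Longrightarrow> Q' x \<longleftrightarrow> Q' y"
      and loc': "\<And>x. x \<in> N \<Longrightarrow> \<forall>\<^sub>F y in nhds x. y \<in> N \<longrightarrow> (Q' y \<longleftrightarrow> Q' x)" for Q'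
  proof -
    let ?G = "{p. \<exists>x\<in>N. proj x = p \<and> Q' x}"
    have "?G \<subseteq> topspace ?X"
      by (auto simp: topspace_quotient N_def proj_def radial_in_hyperboloid)
    moreover have "openin ?X (topspace ?X - ?G)"
      unfolding openin_quotient_manifold
    proof
      show "topspace ?X - ?G \<subseteq> orbit \<Gamma> ` hyperboloid" by (simp add: topspace_quotient)
      have eq: "lift \<Gamma> (topspace ?X - ?G) = hyperboloid \<inter> {z \<in> timecone. z \<in> N \<longrightarrow> \<not> Q' z}"
      proof (intro Set.set_eqI iffI)
        fix z assume "z \<in> lift \<Gamma> (topspace ?X - ?G)"
        then show "z \<in> hyperboloid \<inter> {z \<in> timecone. z \<in> N \<longrightarrow> \<not> Q' z}"
          using hyperboloid_subset_timecone by (auto simp: lift_def proj_hyperboloid)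
      next
        fix z assume z: "z \<in> hyperboloid \<inter> {z \<in> timecone. z \<in> N \<longrightarrow> \<not> Q' z}"
        then have "orbit \<Gamma> z \<in> topspace ?X" by (simp add: topspace_quotient)
        moreover have "orbit \<Gamma> z \<notin> ?G"
        proof
          assume "orbit \<Gamma> z \<in> ?G"
          then obtain x where x: "x \<in> N" "proj x = proj z" "Q' x" using z by (auto simp: proj_hyperboloid)
          then have "z \<in> N" using z by (auto simp: N_def)
          then show False using z x inv'[of x z] by simp
        qed
        ultimately show "z \<in> lift \<Gamma> (topspace ?X - ?G)" using z by (simp add: lift_def)
      qed
      have "open {z \<in> timecone. z \<in> N \<longrightarrow> \<not> Q' z}"
      proof (subst open_subopen, intro ballI)
        fix z assume z: "z \<in> {z \<in> timecone. z \<in> N \<longrightarrow> \<not> Q' z}"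
        have "\<forall>\<^sub>F y in nhds z. y \<in> {z \<in> timecone. z \<in> N \<longrightarrow> \<not> Q' z}"
        proof (cases "z \<in> N")
          case True
          then have zz: "z \<in> timecone" "\<not> Q' z" using z by auto
          show ?thesis using loc'[OF True] eventually_timecone[OF zz(1)]
            by eventually_elim (use zz(2) in blast)
        next
          case False
          then have "z \<in> timecone - N" using z by blast
          from eventually_off_N[OF this] show ?thesis by eventually_elim blast
        qed
        then show "\<exists>T. open T \<and> z \<in> T \<and> T \<subseteq> {z \<in> timecone. z \<in> N \<longrightarrow> \<not> Q' z}"
          unfolding eventually_nhds by blast
      qed
      then show "openin (top_of_set hyperboloid) (lift \<Gamma> (topspace ?X - ?G))"
        unfolding eq by (rule openin_open_Int)
    qed
    ultimately show ?thesis by (simp add: closedin_def)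
  qed
  let ?G = "{p. \<exists>x\<in>N. proj x = p \<and> Q x}" and ?G' = "{p. \<exists>x\<in>N. proj x = p \<and> \<not> Q x}"
  have cl: "closedin ?X ?G" "closedin ?X ?G'"
    by (rule clo, use inv in blast, use loc in simp)+
  have sub: "?G \<subseteq> B" "?G' \<subseteq> B" by (auto simp: N_def)
  have topY: "topspace ?Y = B" using closedin_subset[OF clB] by (auto simp: topspace_subtopology)
  have "?G' = B - ?G"
  proof
    show "?G' \<subseteq> B - ?G" using sub(2) inv by blast
    show "B - ?G \<subseteq> ?G'"
    proof
      fix p assume p: "p \<in> B - ?G"
      then have "p \<in> orbit \<Gamma> ` hyperboloid" using closedin_subset[OF clB] topspace_quotient by blast
      then obtain z where z: "z \<in> hyperboloid" "p = proj z" using proj_hyperboloid by auto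
      then have "z \<in> N" using p hyperboloid_subset_timecone by (auto simp: N_def)
      then show "p \<in> ?G'" using p z by blast
    qed
  qed
  moreover have "closedin ?Y ?G" "closedin ?Y ?G'"
    using cl sub by (auto intro!: closedin_subset_topspace)
  ultimately have clopen: "closedin ?Y ?G" "openin ?Y ?G"
    unfolding openin_closedin_eq topY using sub(1) by simp_all
  obtain K where K: "connectedin ?Y K" "proj x \<in> K" "proj y \<in> K"
    using xy(3) unfolding connected_component_of_def by blast
  have "K \<subseteq> ?G \<or> disjnt K ?G" using connectedin_clopen_cases[OF K(1) clopen] .
  then have "proj x \<in> ?G \<longleftrightarrow> proj y \<in> ?G" using K(2,3) by (auto simp: disjnt_iff)
  moreover have "proj z \<in> ?G \<longleftrightarrow> Q z" if "z \<in> N" for z using inv that by blast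
  ultimately show ?thesis using xy by simp
qed

section \<open>Charts at walls and bindings\<close>

text \<open>Off the closed set \<open>N\<close>, the lifts of \<open>\<Delta>\<close> and of \<open>\<Delta> - B\<close> agree near \<open>y\<close>, and the latter is a hyperplane
there.\<close>

lemma wall_point_chart:
  assumes y: "y \<in> D - N"
  obtains e r where "r > 0" "lorentz e e = 1" "ball y r \<subseteq> timecone - N"
    "\<And>z. z \<in> ball y r \<Longrightarrow> z \<in> D \<longleftrightarrow> lorentz e z = 0"
proof -
  have yt: "y \<in> timecone" using y D_timecone by blast
  have lifted: "radial z \<in> lift \<Gamma> (\<Delta> - B) \<longleftrightarrow> z \<in> D" if "z \<in> timecone - N" for z
    using that by (auto simp: lift_def radial_in_hyperboloid D_def N_def proj_def)
  have "totally_geodesic 1 (lift \<Gamma> (\<Delta> - B))" using branched by (simp add: branched_hypersurface_def)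
  moreover have "radial y \<in> lift \<Gamma> (\<Delta> - B)" using lifted y yt by blast
  ultimately obtain U P where U: "openin (top_of_set hyperboloid) U" "radial y \<in> U" "hyp_subspace 1 P"
      "lift \<Gamma> (\<Delta> - B) \<inter> U = P \<inter> U"
    unfolding totally_geodesic_def by blast
  obtain V where V: "subspace V" "dim V + 1 = CARD('n) + 1" "P = hyperboloid \<inter> V"
    using U(3) unfolding hyp_subspace_def by blast
  have "radial y \<in> P" using U(2,4) \<open>radial y \<in> lift \<Gamma> (\<Delta> - B)\<close> by blast
  then have "radial y \<in> V" "radial y \<in> timecone" using V(3) hyperboloid_subset_timecone by auto
  then obtain e where e: "lorentz e e = 1" "V = {z. lorentz e z = 0}"
    using hyperplane_unit_normal[OF V(1,2)] by blast
  have "openin (top_of_set timecone) (timecone \<inter> radial -` U)"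
    by (rule continuous_openin_preimage[OF continuous_on_radial _ U(1)]) (auto simp: radial_in_hyperboloid)
  then have "open (timecone \<inter> radial -` U)" using openin_open_trans open_timecone by blast
  then have "open ((timecone - N) \<inter> (timecone \<inter> radial -` U))" using open_off_N by (rule open_Int[rotated])
  moreover have "y \<in> (timecone - N) \<inter> (timecone \<inter> radial -` U)" using y yt U(2) by blast
  ultimately obtain r where r: "r > 0" "ball y r \<subseteq> (timecone - N) \<inter> (timecone \<inter> radial -` U)"
    by (rule openE)
  show ?thesis
  proof (rule that[OF r(1) e(1)])
    show "ball y r \<subseteq> timecone - N" using r(2) by blast
    fix z assume "z \<in> ball y r"
    then have z: "z \<in> timecone - N" "radial z \<in> U" "z \<in> timecone" using r(2) by auto
    have "z \<in> D \<longleftrightarrow> radial z \<in> P" using lifted[OF z(1)] z(2) U(4) by blast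
    also have "\<dots> \<longleftrightarrow> lorentz e z = 0"
      using V(3) e(2) z(3) by (simp add: radial_in_hyperboloid lorentz_radial_sign)
    finally show "z \<in> D \<longleftrightarrow> lorentz e z = 0" .
  qed
qed

text \<open>The open book at a binding, in linear coordinates: the pages are the preimages of finitely many rays in
the normal plane.\<close>

lemma binding_point_chart:
  assumes x: "x \<in> N"
  obtains a b R r where "r > 0" "lorentz_orthonormal a b" "finite R" "\<And>u. u \<in> R \<Longrightarrow> norm u = 1"
    "ball x r \<subseteq> timecone"
    "\<And>z. z \<in> ball x r \<Longrightarrow> z \<in> N \<longleftrightarrow> normal_coord a b z = 0"
    "\<And>z. z \<in> ball x r \<Longrightarrow> z \<in> D \<longleftrightarrow> (\<exists>u\<in>R. \<exists>s\<ge>0. normal_coord a b z = s *\<^sub>R u)"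
proof -
  have xt: "x \<in> timecone" using x by (simp add: N_def)
  have lifted: "radial z \<in> lift \<Gamma> B \<longleftrightarrow> z \<in> N" "radial z \<in> lift \<Gamma> \<Delta> \<longleftrightarrow> z \<in> D" if "z \<in> timecone" for z
    using that by (auto simp: lift_def radial_in_hyperboloid D_def N_def proj_def)
  have "radial x \<in> lift \<Gamma> B" using lifted xt x by blast
  then obtain U P \<F> where U: "openin (top_of_set hyperboloid) U" "radial x \<in> U" "hyp_subspace 2 P"
      "finite \<F>" "\<forall>F\<in>\<F>. half_hyperplane P F" "lift \<Gamma> B \<inter> U = P \<inter> U" "lift \<Gamma> \<Delta> \<inter> U = \<Union>\<F> \<inter> U"
    using branched unfolding branched_hypersurface_def by blast
  obtain V where V: "subspace V" "dim V + 2 = CARD('n) + 1" "P = hyperboloid \<inter> V" "P \<noteq> {}"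
    using U(3) unfolding hyp_subspace_def by blast
  have "radial x \<in> P" using U(2,6) \<open>radial x \<in> lift \<Gamma> B\<close> by blast
  then have "radial x \<in> V" "radial x \<in> timecone" using V(3) hyperboloid_subset_timecone by auto
  then obtain a b where ab: "lorentz_orthonormal a b" "V = {z. lorentz a z = 0 \<and> lorentz b z = 0}"
    using codim2_orthonormal_normals[OF V(1,2)] by blast
  have P: "P = {x \<in> hyperboloid. normal_coord a b x = 0}"
    using V(3) ab(2) by (auto simp: normal_coord_eq_0_iff)
  have "\<exists>u. norm u = 1 \<and> F = {x \<in> hyperboloid. \<exists>s\<ge>0. normal_coord a b x = s *\<^sub>R u}" if "F \<in> \<F>" for F
  proof -
    have "half_hyperplane P F" using U(5) that by blast
    then obtain u where "norm u = 1" "F = {x \<in> hyperboloid. \<exists>s\<ge>0. normal_coord a b x = s *\<^sub>R u}"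
      by (rule half_hyperplane_ray[OF ab(1) P V(4)])
    then show ?thesis by blast
  qed
  note ray = this
  define \<upsilon> where "\<upsilon> F = (SOME u. norm u = 1 \<and> F = {x \<in> hyperboloid. \<exists>s\<ge>0. normal_coord a b x = s *\<^sub>R u})" for F
  have \<upsilon>: "norm (\<upsilon> F) = 1" "F = {x \<in> hyperboloid. \<exists>s\<ge>0. normal_coord a b x = s *\<^sub>R \<upsilon> F}" if "F \<in> \<F>" for F
    using someI_ex[OF ray[OF that]] unfolding \<upsilon>_def by (rule conjunct1, rule conjunct2)
  have "openin (top_of_set timecone) (timecone \<inter> radial -` U)"
    by (rule continuous_openin_preimage[OF continuous_on_radial _ U(1)]) (auto simp: radial_in_hyperboloid)
  then have "open (timecone \<inter> radial -` U)" using openin_open_trans open_timecone by blast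
  moreover have "x \<in> timecone \<inter> radial -` U" using xt U(2) by blast
  ultimately obtain r where r: "r > 0" "ball x r \<subseteq> timecone \<inter> radial -` U" by (rule openE)
  have scaled: "\<exists>c>0. normal_coord a b z = c *\<^sub>R normal_coord a b (radial z)" if "z \<in> timecone" for z
    using timecone_eq_scaled_radial[OF that] by (metis normal_coord_simps(2))
  show ?thesis
  proof (rule that[of r a b "\<upsilon> ` \<F>"])
    show "r > 0" "lorentz_orthonormal a b" "finite (\<upsilon> ` \<F>)" "ball x r \<subseteq> timecone"
      using r ab U(4) by auto
    show "norm u = 1" if "u \<in> \<upsilon> ` \<F>" for u using that \<upsilon>(1) by blast
    fix z assume "z \<in> ball x r"
    then have z: "radial z \<in> U" "z \<in> timecone" using r(2) by auto
    have h: "radial z \<in> hyperboloid" using z(2) by (rule radial_in_hyperboloid)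
    obtain c where c: "c > 0" "normal_coord a b z = c *\<^sub>R normal_coord a b (radial z)" using scaled[OF z(2)] by blast
    have "z \<in> N \<longleftrightarrow> radial z \<in> P" using lifted[OF z(2)] z(1) U(6) by blast
    also have "\<dots> \<longleftrightarrow> normal_coord a b z = 0" using P h c by simp
    finally show "z \<in> N \<longleftrightarrow> normal_coord a b z = 0" .
    have "z \<in> D \<longleftrightarrow> (\<exists>F\<in>\<F>. radial z \<in> F)" using lifted[OF z(2)] z(1) U(7) by blast
    also have "\<dots> \<longleftrightarrow> (\<exists>F\<in>\<F>. \<exists>s\<ge>0. normal_coord a b (radial z) = s *\<^sub>R \<upsilon> F)" using \<upsilon>(2) h by blast
    also have "\<dots> \<longleftrightarrow> (\<exists>u\<in>\<upsilon> ` \<F>. \<exists>s\<ge>0. normal_coord a b z = s *\<^sub>R u)"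
    proof -
      have "(\<exists>s\<ge>0. normal_coord a b (radial z) = s *\<^sub>R u) \<longleftrightarrow> (\<exists>s\<ge>0. normal_coord a b z = s *\<^sub>R u)" for u
      proof
        assume "\<exists>s\<ge>0. normal_coord a b (radial z) = s *\<^sub>R u"
        then obtain s where "s \<ge> 0" "normal_coord a b (radial z) = s *\<^sub>R u" by blast
        then show "\<exists>s\<ge>0. normal_coord a b z = s *\<^sub>R u" using c by (intro exI[of _ "c * s"]) auto
      next
        assume "\<exists>s\<ge>0. normal_coord a b z = s *\<^sub>R u"
        then obtain s where s: "s \<ge> 0" "normal_coord a b z = s *\<^sub>R u" by blast
        have "normal_coord a b (radial z) = (1 / c) *\<^sub>R normal_coord a b z" using c by simp
        then show "\<exists>s\<ge>0. normal_coord a b (radial z) = s *\<^sub>R u" using s c(1) by (intro exI[of _ "s / c"]) auto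
      qed
      then show ?thesis by simp
    qed
    finally show "z \<in> D \<longleftrightarrow> (\<exists>u\<in>\<upsilon> ` \<F>. \<exists>s\<ge>0. normal_coord a b z = s *\<^sub>R u)" .
  qed
qed

lemma negligible_N: "negligible_locus timecone N"
  unfolding negligible_locus_def
proof
  fix x :: "'n mink" assume x: "x \<in> timecone"
  show "\<exists>r0>0. \<forall>r. 0 < r \<and> r < r0 \<longrightarrow> open (ball x r - N) \<and> connected (ball x r - N) \<and> ball x r - N \<noteq> {}"
  proof (cases "x \<in> N")
    case True
    obtain a b R r0 where r0: "r0 > 0" "lorentz_orthonormal a b"
      "\<And>z. z \<in> ball x r0 \<Longrightarrow> z \<in> N \<longleftrightarrow> normal_coord a b z = 0"
      using binding_point_chart[OF True] by metis
    have x0: "normal_coord a b x = 0" using r0 True by simp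
    show ?thesis
    proof (intro exI[of _ r0] conjI allI impI r0(1))
      fix r assume r: "0 < r \<and> r < r0"
      then have eq: "ball x r - N = ball x r \<inter> {z. normal_coord a b z \<noteq> 0}" using r0(3) by auto
      show "connected (ball x r - N)" "ball x r - N \<noteq> {}"
        unfolding eq using connected_ball_off_axis[OF r0(2) x0] r by auto
      show "open (ball x r - N)" unfolding eq
        by (intro open_Int open_ball open_Collect_neq continuous_intros)
    qed
  next
    case False
    then obtain r0 where r0: "r0 > 0" "ball x r0 \<subseteq> timecone - N"
      using open_off_N x openE by (metis DiffI)
    show ?thesis
    proof (intro exI[of _ r0] conjI allI impI r0(1))
      fix r assume r: "0 < r \<and> r < r0"
      then have "ball x r \<subseteq> ball x r0" by auto
      then have eq: "ball x r - N = ball x r" using r0(2) by blast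
      show "open (ball x r - N)" "connected (ball x r - N)" "ball x r - N \<noteq> {}" unfolding eq using r by auto
    qed
  qed
qed

section \<open>Bending data\<close>

text \<open>The unit normal of the wall through a point of \<open>D - N\<close>, up to an unspecified sign.\<close>

definition normal :: "'n mink \<Rightarrow> 'n mink" where
  "normal y = (SOME e. lorentz e e = 1 \<and> (\<forall>\<^sub>F z in nhds y. z \<in> D \<longleftrightarrow> lorentz e z = 0))"

text \<open>The germs to which \<open>solves_near\<close> is applied. The absolute value makes the sign of the normal irrelevant.\<close>

definition bend :: "('n mink set set \<Rightarrow> real) \<Rightarrow> 'n mink \<Rightarrow> 'n mink \<Rightarrow> real" where
  "bend t y z = (if y \<in> D then t (wall y) * \<bar>lorentz (normal y) z\<bar> else 0)"

lemma normal:
  assumes "y \<in> D - N"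
  shows "lorentz (normal y) (normal y) = 1" "\<forall>\<^sub>F z in nhds y. z \<in> D \<longleftrightarrow> lorentz (normal y) z = 0"
proof -
  obtain e r where e: "r > 0" "lorentz e e = 1" "\<And>z. z \<in> ball y r \<Longrightarrow> z \<in> D \<longleftrightarrow> lorentz e z = 0"
    using wall_point_chart[OF assms] by metis
  have "\<forall>\<^sub>F z in nhds y. z \<in> ball y r" using e(1) by (intro eventually_nhds_in_open) auto
  then have "\<forall>\<^sub>F z in nhds y. z \<in> D \<longleftrightarrow> lorentz e z = 0" by eventually_elim (rule e(3))
  then have "\<exists>e. lorentz e e = 1 \<and> (\<forall>\<^sub>F z in nhds y. z \<in> D \<longleftrightarrow> lorentz e z = 0)" using e(2) by blast
  from someI_ex[OF this] show "lorentz (normal y) (normal y) = 1"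
    "\<forall>\<^sub>F z in nhds y. z \<in> D \<longleftrightarrow> lorentz (normal y) z = 0" unfolding normal_def by blast+
qed

lemma abs_lorentz_normal:
  assumes y: "y \<in> D - N" and e: "lorentz e e = 1" "lorentz e y = 0"
    and ev: "\<forall>\<^sub>F z in nhds y. lorentz e z = 0 \<longrightarrow> z \<in> D"
  shows "\<bar>lorentz (normal y) v\<bar> = \<bar>lorentz e v\<bar>"
proof (rule unit_normal_unique[OF e(1) normal(1)[OF y] e(2)])
  show "\<forall>\<^sub>F z in nhds y. lorentz e z = 0 \<longrightarrow> lorentz (normal y) z = 0"
    using ev normal(2)[OF y] by eventually_elim blast
qed

text \<open>Any unit normal computes the bending, and to recognize one it is enough that its hyperplane is contained
in \<open>D\<close> near \<open>y\<close>.\<close>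

lemma bend_eq:
  assumes "y \<in> D - N" "lorentz e e = 1" "lorentz e y = 0" "\<forall>\<^sub>F z in nhds y. lorentz e z = 0 \<longrightarrow> z \<in> D"
  shows "bend t y z = t (wall y) * \<bar>lorentz e z\<bar>"
  using abs_lorentz_normal[OF assms] assms(1) by (simp add: bend_def)

text \<open>An isometry in \<open>\<Gamma>\<close> takes a unit normal of a wall to one of its image, up to sign, and preserves the
projected wall.\<close>

lemma bend_invariant:
  assumes g: "g \<in> \<Gamma>" and y: "y \<in> timecone - N"
  shows "bend t (g *v y) (g *v z) = bend t y z"
proof (cases "y \<in> D")
  case False
  then show ?thesis using D_invariant[OF g] y by (simp add: bend_def)
next
  case True
  let ?e = "normal (g *v y)"
  have gy: "g *v y \<in> D - N" using D_invariant[OF g] N_invariant[OF g] y True by blast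
  obtain e where e: "g *v e = ?e" using SO_plus_surj[OF \<Gamma>_SO[OF g]] .
  have le: "lorentz ?e (g *v w) = lorentz e w" for w
    using SO_plus_lorentz[OF \<Gamma>_SO[OF g], of e w] by (simp add: e)
  have e1: "lorentz e e = 1" using normal(1)[OF gy] le[of e] by (simp add: e)
  have tend: "filterlim (\<lambda>z. g *v z) (nhds (g *v y)) (nhds y)"
    using matrix_vector_mult_linear_continuous_at[of y g]
    by (simp add: isCont_def tendsto_at_iff_tendsto_nhds)
  have ev: "\<forall>\<^sub>F z in nhds y. g *v z \<in> D \<longleftrightarrow> lorentz ?e (g *v z) = 0"
    using eventually_compose_filterlim[OF normal(2)[OF gy] tend] .
  have "lorentz e y = 0" using eventually_nhds_x_imp_x[OF ev] gy by (simp add: le)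
  moreover have "\<forall>\<^sub>F z in nhds y. lorentz e z = 0 \<longrightarrow> z \<in> D"
    using ev eventually_timecone[of y] y D_invariant[OF g] by (auto simp: le elim: eventually_elim2)
  ultimately have "\<bar>lorentz (normal y) z\<bar> = \<bar>lorentz e z\<bar>"
    using abs_lorentz_normal[of y e z] e1 True y by blast
  then show ?thesis
    using True gy wall_invariant[OF g, of y] y by (simp add: bend_def le)
qed

text \<open>A chart as in \<open>binding_point_chart\<close> in which \<open>\<omega> u\<close> records the wall that contains the page over the ray
through \<open>u\<close>.\<close>

definition book :: "'n mink \<Rightarrow> real \<Rightarrow> 'n mink \<Rightarrow> 'n mink \<Rightarrow> complex set \<Rightarrow> (complex \<Rightarrow> 'n mink set set) \<Rightarrow> bool" where
  "book x r a b R \<omega> \<longleftrightarrow> r > 0 \<and> lorentz_orthonormal a b \<and> finite R \<and> (\<forall>u\<in>R. norm u = 1) \<and> ball x r \<subseteq> timecone \<and>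
     (\<forall>z\<in>ball x r. z \<in> N \<longleftrightarrow> normal_coord a b z = 0) \<and>
     (\<forall>z\<in>ball x r. z \<in> D \<longleftrightarrow> (\<exists>u\<in>R. \<exists>s\<ge>0. normal_coord a b z = s *\<^sub>R u)) \<and>
     (\<forall>u\<in>R. \<forall>z\<in>ball x r. \<forall>s>0. normal_coord a b z = s *\<^sub>R u \<longrightarrow> wall z = \<omega> u)"

lemma bookD:
  assumes "book x r a b R \<omega>"
  shows "r > 0" "lorentz_orthonormal a b" "finite R" "\<And>u. u \<in> R \<Longrightarrow> norm u = 1" "ball x r \<subseteq> timecone"
    "\<And>z. z \<in> ball x r \<Longrightarrow> z \<in> N \<longleftrightarrow> normal_coord a b z = 0"
    "\<And>z. z \<in> ball x r \<Longrightarrow> z \<in> D \<longleftrightarrow> (\<exists>u\<in>R. \<exists>s\<ge>0. normal_coord a b z = s *\<^sub>R u)"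
    "\<And>u z s. \<lbrakk>u \<in> R; z \<in> ball x r; s > 0; normal_coord a b z = s *\<^sub>R u\<rbrakk> \<Longrightarrow> wall z = \<omega> u"
  using assms unfolding book_def by blast+

text \<open>Each page of a chart is convex, so it lies in one wall.\<close>

lemma book_exists:
  assumes x: "x \<in> N"
  obtains r a b R \<omega> where "book x r a b R \<omega>"
proof -
  obtain a b R r where c: "r > 0" "lorentz_orthonormal a b" "finite R" "\<And>u. u \<in> R \<Longrightarrow> norm u = 1"
    "ball x r \<subseteq> timecone" "\<And>z. z \<in> ball x r \<Longrightarrow> z \<in> N \<longleftrightarrow> normal_coord a b z = 0"
    "\<And>z. z \<in> ball x r \<Longrightarrow> z \<in> D \<longleftrightarrow> (\<exists>u\<in>R. \<exists>s\<ge>0. normal_coord a b z = s *\<^sub>R u)"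
    by (rule binding_point_chart[OF x], rule that) assumption+
  define page where "page u = {z \<in> ball x r. \<exists>s>0. normal_coord a b z = s *\<^sub>R u}" for u
  define \<omega> where "\<omega> u = wall (SOME z. z \<in> page u)" for u
  have "wall z = \<omega> u" if u: "u \<in> R" and z: "z \<in> page u" for u z
  proof -
    have "convex (page u)"
    proof (rule convexI)
      fix p q and k l :: real
      assume pq: "p \<in> page u" "q \<in> page u" and kl: "k \<ge> 0" "l \<ge> 0" "k + l = 1"
      obtain s s' where s: "s > 0" "s' > 0" "normal_coord a b p = s *\<^sub>R u" "normal_coord a b q = s' *\<^sub>R u"
        using pq unfolding page_def by blast
      have "k *\<^sub>R p + l *\<^sub>R q \<in> ball x r" using pq kl convexD[OF convex_ball] unfolding page_def by blast
      moreover have "normal_coord a b (k *\<^sub>R p + l *\<^sub>R q) = (k * s + l * s') *\<^sub>R u"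
        by (simp add: s scaleR_add_left)
      moreover have "k * s + l * s' > 0"
      proof (cases "k = 0")
        case False
        then show ?thesis using kl s by (intro add_pos_nonneg) auto
      qed (use kl s in simp)
      ultimately show "k *\<^sub>R p + l *\<^sub>R q \<in> page u" unfolding page_def by blast
    qed
    then have "connected (page u)" by (rule convex_connected)
    moreover have "page u \<subseteq> D - N"
    proof
      fix p assume "p \<in> page u"
      then obtain s where p: "p \<in> ball x r" "s > 0" "normal_coord a b p = s *\<^sub>R u" unfolding page_def by blast
      have "u \<noteq> 0" using c(4)[OF u] by auto
      then have "normal_coord a b p \<noteq> 0" using p by simp
      moreover have "\<exists>u\<in>R. \<exists>s\<ge>0. normal_coord a b p = s *\<^sub>R u" using p u less_imp_le by blast
      ultimately show "p \<in> D - N" using c(6,7)[OF p(1)] by blast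
    qed
    moreover have "(SOME z. z \<in> page u) \<in> page u" using z by (rule someI)
    ultimately show ?thesis unfolding \<omega>_def using wall_const_on_connected z by blast
  qed
  then have "book x r a b R \<omega>" unfolding book_def page_def using c by blast
  then show ?thesis by (rule that)
qed

lemma book_recenter:
  assumes k: "book x r a b R \<omega>" and y: "y \<in> ball x r"
  shows "book y (r - dist x y) a b R \<omega>"
proof -
  have sub: "ball y (r - dist x y) \<subseteq> ball x r"
  proof
    fix z assume "z \<in> ball y (r - dist x y)"
    then show "z \<in> ball x r" using dist_triangle[of x z y] by simp
  qed
  then show ?thesis using k y unfolding book_def by (simp add: subset_iff)
qed

lemma book_transport:
  assumes k: "book x r a b R \<omega>" and g: "g \<in> \<Gamma>" and c: "c > 0"
  obtains r' where "book (c *\<^sub>R (g *v x)) r' (g *v a) (g *v b) R \<omega>"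
proof -
  obtain h where h: "h \<in> \<Gamma>" "h ** g = mat 1" "g ** h = mat 1" using \<Gamma>_inverse[OF g] .
  have hg: "h *v (g *v z) = z" and gh: "g *v (h *v z) = z" for z
    by (simp_all add: matrix_vector_mul_assoc h)
  let ?y = "c *\<^sub>R (g *v x)" and ?\<phi> = "\<lambda>z. (1 / c) *\<^sub>R (h *v z)"
  have \<phi>y: "?\<phi> ?y = x" using c by (simp add: matrix_vector_mult_scaleR hg)
  have cont: "continuous_on UNIV ?\<phi>"
    by (intro continuous_intros linear_continuous_on matrix_vector_mul_bounded_linear)
  have "open (?\<phi> -` ball x r)" using cont by (simp add: continuous_on_open_vimage[OF open_UNIV])
  moreover have "?y \<in> ?\<phi> -` ball x r" using bookD(1)[OF k] unfolding vimage_def mem_Collect_eq \<phi>y by simp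
  ultimately obtain r' where r': "r' > 0" "ball ?y r' \<subseteq> ?\<phi> -` ball x r" by (rule openE)
  have restore: "c *\<^sub>R (g *v ?\<phi> z) = z" for z using c by (simp add: matrix_vector_mult_scaleR gh)
  have tr: "c *\<^sub>R (g *v w) \<in> timecone" "c *\<^sub>R (g *v w) \<in> N \<longleftrightarrow> w \<in> N" "c *\<^sub>R (g *v w) \<in> D \<longleftrightarrow> w \<in> D"
    "wall (c *\<^sub>R (g *v w)) = wall w" if w: "w \<in> timecone" for w
  proof -
    have gw: "g *v w \<in> timecone" using SO_plus_timecone[OF \<Gamma>_SO[OF g] w] by blast
    show cw: "c *\<^sub>R (g *v w) \<in> timecone" using timecone_scaleR[OF gw c] .
    have "proj (c *\<^sub>R (g *v w)) = proj w"
      using proj_invariant[OF g w] by (simp add: proj_def radial_scaleR[OF c])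
    then show "c *\<^sub>R (g *v w) \<in> N \<longleftrightarrow> w \<in> N" "c *\<^sub>R (g *v w) \<in> D \<longleftrightarrow> w \<in> D"
      "wall (c *\<^sub>R (g *v w)) = wall w" using cw w by (auto simp: N_def D_def wall_def)
  qed
  have \<zeta>: "normal_coord (g *v a) (g *v b) (c *\<^sub>R (g *v w)) = c *\<^sub>R normal_coord a b w" for w
    by (simp add: normal_coord_def SO_plus_lorentz[OF \<Gamma>_SO[OF g]] complex_eq_iff)
  have ball: "\<exists>w\<in>ball x r. z = c *\<^sub>R (g *v w)" if "z \<in> ball ?y r'" for z
    by (rule bexI[of _ "?\<phi> z"]) (use restore r'(2) that in auto)
  note kD = bookD[OF k]
  have ray: "(\<exists>s\<ge>0. c *\<^sub>R p = s *\<^sub>R u) \<longleftrightarrow> (\<exists>s\<ge>0. p = s *\<^sub>R u)" for p u :: complex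
  proof
    assume "\<exists>s\<ge>0. c *\<^sub>R p = s *\<^sub>R u"
    then obtain s where s: "s \<ge> 0" "c *\<^sub>R p = s *\<^sub>R u" by blast
    have "(1 / c) *\<^sub>R (c *\<^sub>R p) = (1 / c) *\<^sub>R (s *\<^sub>R u)" using s(2) by (rule arg_cong)
    then have "p = (s / c) *\<^sub>R u" using c by simp
    then show "\<exists>s\<ge>0. p = s *\<^sub>R u" using s c by (intro exI[of _ "s / c"]) auto
  next
    assume "\<exists>s\<ge>0. p = s *\<^sub>R u"
    then obtain s where "s \<ge> 0" "p = s *\<^sub>R u" by blast
    then show "\<exists>s\<ge>0. c *\<^sub>R p = s *\<^sub>R u" using c by (intro exI[of _ "c * s"]) auto
  qed
  have "book ?y r' (g *v a) (g *v b) R \<omega>"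
    unfolding book_def
  proof (intro conjI ballI allI impI r'(1) kD(3))
    show "lorentz_orthonormal (g *v a) (g *v b)"
      using kD(2) by (simp add: lorentz_orthonormal_def SO_plus_lorentz[OF \<Gamma>_SO[OF g]])
    show "norm u = 1" if "u \<in> R" for u using kD(4) that .
    show "ball ?y r' \<subseteq> timecone"
    proof
      fix z assume "z \<in> ball ?y r'"
      then obtain w where "w \<in> ball x r" "z = c *\<^sub>R (g *v w)" using ball by blast
      then show "z \<in> timecone" using tr(1)[of w] kD(5) by blast
    qed
  next
    fix z assume "z \<in> ball ?y r'"
    then obtain w where w: "w \<in> ball x r" "z = c *\<^sub>R (g *v w)" using ball by blast
    have wt: "w \<in> timecone" using w kD(5) by blast
    show "z \<in> N \<longleftrightarrow> normal_coord (g *v a) (g *v b) z = 0"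
      unfolding w(2) \<zeta> tr(2)[OF wt] kD(6)[OF w(1)] using c by simp
    show "z \<in> D \<longleftrightarrow> (\<exists>u\<in>R. \<exists>s\<ge>0. normal_coord (g *v a) (g *v b) z = s *\<^sub>R u)"
      unfolding w(2) \<zeta> tr(3)[OF wt] kD(7)[OF w(1)] ray ..
  next
    fix u z and s :: real
    assume u: "u \<in> R" and "z \<in> ball ?y r'" and s: "s > 0" "normal_coord (g *v a) (g *v b) z = s *\<^sub>R u"
    then obtain w where w: "w \<in> ball x r" "z = c *\<^sub>R (g *v w)" using ball by blast
    have wt: "w \<in> timecone" using w kD(5) by blast
    have "c *\<^sub>R normal_coord a b w = s *\<^sub>R u" using s(2) unfolding w(2) \<zeta> .
    then have "(1 / c) *\<^sub>R (c *\<^sub>R normal_coord a b w) = (1 / c) *\<^sub>R (s *\<^sub>R u)" by (rule arg_cong)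
    then have "normal_coord a b w = (s / c) *\<^sub>R u" using c by simp
    then have "wall w = \<omega> u" using kD(8)[OF u w(1), of "s / c"] s(1) c by simp
    then show "wall z = \<omega> u" using tr(4)[OF wt] w(2) by simp
  qed
  then show ?thesis by (rule that)
qed

text \<open>The unit vectors that point from \<open>x\<close> into the pages, orthogonally to the binding. The definition only
refers to the germ of \<open>D\<close> at \<open>x\<close> and not to a choice of normal coordinates, so that balance at \<open>x\<close> can be
compared between different charts.\<close>

definition directions :: "'n mink \<Rightarrow> 'n mink set" where
  "directions x = {U. lorentz U U = 1 \<and> (\<forall>\<^sub>F y in nhds x. y \<in> N \<longrightarrow> lorentz U y = 0) \<and>
     (\<forall>\<^sub>F s in at_right 0. x + s *\<^sub>R U \<in> D)}"

definition wall_towards :: "'n mink \<Rightarrow> 'n mink \<Rightarrow> 'n mink set set" where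
  "wall_towards x U = (SOME W. \<forall>\<^sub>F s in at_right 0. wall (x + s *\<^sub>R U) = W)"

text \<open>The compatibility condition that the weights satisfy at a binding.\<close>

definition balanced :: "('n mink set set \<Rightarrow> real) \<Rightarrow> 'n mink \<Rightarrow> bool" where
  "balanced t x \<longleftrightarrow> (\<Sum>U\<in>directions x. t (wall_towards x U) *\<^sub>R U) = 0"

text \<open>A unit vector that is orthogonal to the binding and points into \<open>D\<close> has a normal coordinate of norm 1 on
one of the rays, hence is the lift of an element of \<open>R\<close>.\<close>

lemma book_directions:
  assumes k: "book x r a b R \<omega>" and x: "x \<in> N"
  shows "directions x = normal_vector a b ` R"
    and "\<And>u. u \<in> R \<Longrightarrow> wall_towards x (normal_vector a b u) = \<omega> u"
proof -
  note kD = bookD[OF k]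
  let ?\<zeta> = "normal_coord a b"
  have x0: "?\<zeta> x = 0" using kD(1,6) x by simp
  have inball: "\<forall>\<^sub>F y in nhds x. y \<in> ball x r" using kD(1) by (intro eventually_nhds_in_open) auto
  have right: "\<forall>\<^sub>F s in at_right 0. s > 0 \<and> x + s *\<^sub>R U \<in> ball x r" for U
  proof -
    have "((\<lambda>s. x + s *\<^sub>R U) \<longlongrightarrow> x + 0 *\<^sub>R U) (at_right 0)" by (intro tendsto_intros)
    then have "((\<lambda>s. x + s *\<^sub>R U) \<longlongrightarrow> x) (at_right 0)" by simp
    from eventually_compose_filterlim[OF inball this] eventually_at_right_less[of 0]
    show ?thesis by eventually_elim blast
  qed
  have norm1: "norm (?\<zeta> U) = 1" if "U = normal_vector a b (?\<zeta> U)" "lorentz U U = 1" for U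
  proof -
    have "lorentz U U = Re (cnj (?\<zeta> U) * ?\<zeta> U)" by (subst (1) that(1), rule lorentz_normal_vector)
    then have "(norm (?\<zeta> U))\<^sup>2 = 1" using that(2) unfolding cmod_power2 by (simp add: power2_eq_square)
    then show ?thesis using norm_ge_zero[of "?\<zeta> U"] by (auto simp: power2_eq_1_iff)
  qed
  show dir: "directions x = normal_vector a b ` R"
  proof
    show "directions x \<subseteq> normal_vector a b ` R"
    proof
      fix U assume "U \<in> directions x"
      then have U: "lorentz U U = 1" "\<forall>\<^sub>F y in nhds x. y \<in> N \<longrightarrow> lorentz U y = 0"
        "\<forall>\<^sub>F s in at_right 0. x + s *\<^sub>R U \<in> D" by (auto simp: directions_def)
      have "\<forall>\<^sub>F y in nhds x. ?\<zeta> y = 0 \<longrightarrow> lorentz U y = 0"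
        using inball U(2) by eventually_elim (use kD(6) in blast)
      then have Un: "U = normal_vector a b (?\<zeta> U)" by (rule lorentz_vanishing_imp_normal[OF kD(2) x0])
      have "\<exists>s. s > 0 \<and> x + s *\<^sub>R U \<in> ball x r \<and> x + s *\<^sub>R U \<in> D"
        using eventually_happens'[OF trivial_limit_at_right_real eventually_conj[OF right[of U] U(3)]] by blast
      then obtain s where s: "s > 0" "x + s *\<^sub>R U \<in> ball x r" "x + s *\<^sub>R U \<in> D" by blast
      obtain u s' where u: "u \<in> R" "s' \<ge> 0" "?\<zeta> (x + s *\<^sub>R U) = s' *\<^sub>R u" using kD(7)[OF s(2)] s(3) by blast
      have e: "s *\<^sub>R ?\<zeta> U = s' *\<^sub>R u" using u(3) x0 by simp
      then have "norm (s *\<^sub>R ?\<zeta> U) = norm (s' *\<^sub>R u)" by simp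
      then have "s = s'" using norm1[OF Un U(1)] kD(4)[OF u(1)] s(1) u(2) by simp
      then have "?\<zeta> U = u" using e s(1) by simp
      then show "U \<in> normal_vector a b ` R" using Un u(1) by blast
    qed
    show "normal_vector a b ` R \<subseteq> directions x"
    proof
      fix U assume "U \<in> normal_vector a b ` R"
      then obtain u where u: "u \<in> R" "U = normal_vector a b u" by blast
      have \<zeta>U: "?\<zeta> U = u" using kD(2) u by simp
      have "lorentz U U = Re (cnj u * ?\<zeta> U)" using lorentz_normal_vector[of a b u U] by (simp only: u(2))
      also have "\<dots> = Re (cnj u * u)" by (simp only: \<zeta>U)
      also have "\<dots> = (norm u)\<^sup>2" unfolding cmod_power2 by (simp add: power2_eq_square)
      finally have "lorentz U U = 1" using kD(4)[OF u(1)] by simp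
      moreover have "\<forall>\<^sub>F y in nhds x. y \<in> N \<longrightarrow> lorentz U y = 0"
        using inball
      proof eventually_elim
        case (elim y)
        then show ?case using kD(6)[OF elim] lorentz_normal_vector[of a b u y] u(2) by (simp add: normal_coord_eq_0_iff)
      qed
      moreover have "\<forall>\<^sub>F s in at_right 0. x + s *\<^sub>R U \<in> D"
        using right[of U]
      proof eventually_elim
        case (elim s)
        have "?\<zeta> (x + s *\<^sub>R U) = s *\<^sub>R u" using x0 \<zeta>U by simp
        then show ?case using kD(7)[of "x + s *\<^sub>R U"] elim u(1) less_imp_le by blast
      qed
      ultimately show "U \<in> directions x" by (simp add: directions_def)
    qed
  qed
  show "wall_towards x (normal_vector a b u) = \<omega> u" if u: "u \<in> R" for u
  proof -
    let ?U = "normal_vector a b u"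
    have ev: "\<forall>\<^sub>F s in at_right 0. wall (x + s *\<^sub>R ?U) = \<omega> u"
      using right[of ?U]
    proof eventually_elim
      case (elim s)
      have "?\<zeta> (x + s *\<^sub>R ?U) = s *\<^sub>R u" using x0 kD(2) by simp
      then show ?case using kD(8)[OF u] elim by blast
    qed
    have "\<forall>\<^sub>F s in at_right 0. wall (x + s *\<^sub>R ?U) = wall_towards x ?U"
      unfolding wall_towards_def by (rule someI[of "\<lambda>W. \<forall>\<^sub>F s in at_right 0. wall (x + s *\<^sub>R ?U) = W"]) (rule ev)
    from eventually_conj[OF this ev] show ?thesis
      using eventually_happens'[OF trivial_limit_at_right_real] by force
  qed
qed

lemma normal_vector_linear:
  "normal_vector a b (\<Sum>i\<in>I. c i *\<^sub>R f i) = (\<Sum>i\<in>I. c i *\<^sub>R normal_vector a b (f i))"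
  by (induction I rule: infinite_finite_induct) (auto simp: normal_vector_def algebra_simps)

lemma balanced_iff_book:
  assumes k: "book x r a b R \<omega>" and x: "x \<in> N"
  shows "balanced t x \<longleftrightarrow> (\<Sum>u\<in>R. t (\<omega> u) *\<^sub>R u) = 0"
proof -
  note ab = bookD(2)[OF k]
  have inj: "inj_on (normal_vector a b) R"
    by (rule inj_on_inverseI[of _ "normal_coord a b"]) (simp add: ab)
  have "(\<Sum>U\<in>directions x. t (wall_towards x U) *\<^sub>R U) = (\<Sum>u\<in>R. t (\<omega> u) *\<^sub>R normal_vector a b u)"
    unfolding book_directions(1)[OF k x] sum.reindex[OF inj] o_def
    by (rule sum.cong) (auto simp: book_directions(2)[OF k x])
  also have "\<dots> = normal_vector a b (\<Sum>u\<in>R. t (\<omega> u) *\<^sub>R u)" by (simp add: normal_vector_linear)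
  finally have sum: "(\<Sum>U\<in>directions x. t (wall_towards x U) *\<^sub>R U) = normal_vector a b (\<Sum>u\<in>R. t (\<omega> u) *\<^sub>R u)" .
  have "v = 0" if "normal_vector a b v = 0" for v
    using normal_coord_vector[OF ab, of v] that by (simp add: normal_coord_def complex_eq_iff)
  moreover have "normal_vector a b 0 = 0" by (simp add: normal_vector_def)
  ultimately show ?thesis unfolding balanced_def sum by metis
qed

text \<open>Balance is read off from any book. Recentering a book shows that balance is locally constant, and
transporting it by \<open>\<Gamma>\<close> and by scaling shows that balance only depends on the projection.\<close>

lemma balanced_on_binding:
  assumes xy: "x \<in> N" "y \<in> N"
      "connected_component_of (subtopology (quotient_manifold \<Gamma>) B) (proj x) (proj y)"
  shows "balanced t x \<longleftrightarrow> balanced t y"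
proof (rule locally_const_on_binding[OF _ _ xy])
  fix x y assume x: "x \<in> N" and y: "y \<in> N" and p: "proj x = proj y"
  obtain r a b R \<omega> where k: "book x r a b R \<omega>" using book_exists[OF x] .
  obtain g where g: "g \<in> \<Gamma>" "radial y = g *v radial x"
    using orbit_eqD[of "radial y" "radial x"] p unfolding proj_def by metis
  obtain c where c: "c > 0" "y = c *\<^sub>R radial y" using y timecone_eq_scaled_radial by (auto simp: N_def)
  obtain d where d: "d > 0" "x = d *\<^sub>R radial x" using x timecone_eq_scaled_radial by (auto simp: N_def)
  have "(c / d) *\<^sub>R (g *v x) = (c / d) *\<^sub>R (g *v (d *\<^sub>R radial x))" using d(2) by simp
  also have "\<dots> = y" using c(2) d(1) g(2) by (simp add: matrix_vector_mult_scaleR)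
  finally have yx: "(c / d) *\<^sub>R (g *v x) = y" .
  have "c / d > 0" using c d by simp
  then obtain r' where "book y r' (g *v a) (g *v b) R \<omega>"
    using book_transport[OF k g(1)] yx by metis
  then show "balanced t x \<longleftrightarrow> balanced t y"
    using balanced_iff_book[OF k x] balanced_iff_book[OF _ y] by blast
next
  fix x assume x: "x \<in> N"
  obtain r a b R \<omega> where k: "book x r a b R \<omega>" using book_exists[OF x] .
  have "\<forall>\<^sub>F y in nhds x. y \<in> ball x r" using bookD(1)[OF k] by (intro eventually_nhds_in_open) auto
  then show "\<forall>\<^sub>F y in nhds x. y \<in> N \<longrightarrow> (balanced t y \<longleftrightarrow> balanced t x)"
  proof eventually_elim
    case (elim y)
    then show ?case
      using balanced_iff_book[OF k x] balanced_iff_book[OF book_recenter[OF k elim]] by blast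
  qed
qed

section \<open>Existence of bent functions\<close>

lemma solves_near_off_D:
  assumes x: "x \<in> timecone - D"
  shows "\<exists>r>0. \<exists>\<psi>. solves_near (bend t) N (ball x r) \<psi>"
proof -
  obtain r where r: "r > 0" "ball x r \<subseteq> timecone - D" using open_off_D x by (rule openE)
  have "solves_near (bend t) N (ball x r) (\<lambda>z. 0)"
    unfolding solves_near_def
  proof
    fix y assume "y \<in> ball x r - N"
    then have "y \<notin> D" using r(2) by blast
    then show "\<exists>L. \<forall>\<^sub>F z in nhds y. 0 = L \<bullet> z + bend t y z" by (intro exI[of _ 0]) (simp add: bend_def)
  qed
  then show ?thesis using r(1) by blast
qed

text \<open>Near a wall point the solution is the prescribed germ itself; off the wall it is linear since the sign
of \<open>lorentz e\<close> is locally constant.\<close>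

lemma solves_near_wall:
  assumes x: "x \<in> D - N"
  shows "\<exists>r>0. \<exists>\<psi>. solves_near (bend t) N (ball x r) \<psi>"
proof -
  obtain e r where e: "r > 0" "lorentz e e = 1" "ball x r \<subseteq> timecone - N"
    "\<And>z. z \<in> ball x r \<Longrightarrow> z \<in> D \<longleftrightarrow> lorentz e z = 0"
    using wall_point_chart[OF x] by metis
  let ?S = "{z \<in> ball x r. lorentz e z = 0}"
  have "convex ?S"
  proof -
    have "convex {z. lorentz e z = 0}" by (auto simp: convex_def)
    moreover have "?S = ball x r \<inter> {z. lorentz e z = 0}" by blast
    ultimately show ?thesis using convex_Int[OF convex_ball] by metis
  qed
  then have S: "connected ?S" "?S \<subseteq> D - N" using e(3,4) by (auto intro: convex_connected)
  have xS: "x \<in> ?S" using e(1,4) x by simp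
  have "solves_near (bend t) N (ball x r) (\<lambda>z. t (wall x) * \<bar>lorentz e z\<bar>)"
    unfolding solves_near_def
  proof
    fix y assume "y \<in> ball x r - N"
    then have y: "y \<in> ball x r" "y \<notin> N" by auto
    have near: "\<forall>\<^sub>F z in nhds y. z \<in> ball x r" using y(1) by (intro eventually_nhds_in_open) auto
    show "\<exists>L. \<forall>\<^sub>F z in nhds y. t (wall x) * \<bar>lorentz e z\<bar> = L \<bullet> z + bend t y z"
    proof (cases "y \<in> D")
      case True
      then have ey: "lorentz e y = 0" using e(4)[OF y(1)] by simp
      have "\<forall>\<^sub>F z in nhds y. lorentz e z = 0 \<longrightarrow> z \<in> D" using near by eventually_elim (use e(4) in blast)
      then have "bend t y z = t (wall y) * \<bar>lorentz e z\<bar>" for z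
        using bend_eq[of y e] True y(2) e(2) ey by blast
      moreover have "wall y = wall x" using wall_const_on_connected[OF S _ xS] y(1) ey by blast
      ultimately show ?thesis by (intro exI[of _ 0]) simp
    next
      case False
      then have ey: "lorentz e y \<noteq> 0" using e(4)[OF y(1)] by simp
      let ?\<sigma> = "sgn (lorentz e y)"
      have "open {z. ?\<sigma> * lorentz e z > 0}" by (intro open_Collect_less continuous_intros)
      then have "\<forall>\<^sub>F z in nhds y. z \<in> {z. ?\<sigma> * lorentz e z > 0}"
        using ey by (intro eventually_nhds_in_open) (auto simp: sgn_real_def)
      then have "\<forall>\<^sub>F z in nhds y. t (wall x) * \<bar>lorentz e z\<bar> = ((t (wall x) * ?\<sigma>) *\<^sub>R lorentz_flip e) \<bullet> z + bend t y z"
      proof eventually_elim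
        case (elim z)
        then have "\<bar>lorentz e z\<bar> = ?\<sigma> * lorentz e z" using ey by (auto simp: sgn_real_def abs_if split: if_splits)
        then show ?case using False by (simp add: bend_def lorentz_eq_inner[symmetric])
      qed
      then show ?thesis by (rule exI)
    qed
  qed
  then show ?thesis using e(1) by blast
qed

text \<open>The planar function of \<open>balanced_rays_break\<close>, composed with the normal coordinate. The line through a ray
\<open>u\<close> is the zero set of \<open>Im(\<zeta>/u)\<close>, and this is \<open>lorentz\<close> with the unit vector over \<open>\<i> u\<close>.\<close>

lemma solves_near_binding:
  assumes x: "x \<in> N" and bal: "balanced t x"
  shows "\<exists>r>0. \<exists>\<psi>. solves_near (bend t) N (ball x r) \<psi>"
proof -
  obtain r a b R \<omega> where k: "book x r a b R \<omega>" using book_exists[OF x] .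
  note kD = bookD[OF k]
  let ?\<zeta> = "normal_coord a b"
  have bal': "(\<Sum>u\<in>R. t (\<omega> u) *\<^sub>R u) = 0" using bal balanced_iff_book[OF k x] by simp
  define \<psi> where "\<psi> z = (\<Sum>u\<in>R. t (\<omega> u) * (- (Arg (- (?\<zeta> z / u)) * Im (?\<zeta> z / u)) / pi))" for z
  have Im: "Im (?\<zeta> z / u) = lorentz (normal_vector a b (\<i> * u)) z" if "u \<in> R" for u z
    using kD(4)[OF that] complex_div_cnj[of "?\<zeta> z" u] by (simp add: lorentz_normal_vector)
  have "solves_near (bend t) N (ball x r) \<psi>"
    unfolding solves_near_def
  proof
    fix y assume "y \<in> ball x r - N"
    then have y: "y \<in> ball x r" "y \<notin> N" by auto
    have y0: "?\<zeta> y \<noteq> 0" using kD(6)[OF y(1)] y(2) by simp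
    have near: "\<forall>\<^sub>F z in nhds y. z \<in> ball x r" using y(1) by (intro eventually_nhds_in_open) auto
    have "continuous_on UNIV ?\<zeta>" by (intro continuous_intros)
    then have tend: "filterlim ?\<zeta> (nhds (?\<zeta> y)) (nhds y)"
      by (simp add: continuous_on_eq_continuous_at isCont_def tendsto_at_iff_tendsto_nhds)
    obtain \<kappa> where "\<forall>\<^sub>F \<zeta> in nhds (?\<zeta> y). (\<Sum>u\<in>R. t (\<omega> u) * (- (Arg (- (\<zeta> / u)) * Im (\<zeta> / u)) / pi)) =
     (\<Sum>u\<in>R. \<kappa> u * Im (\<zeta> / u)) + (\<Sum>u\<in>R. if \<exists>s>0. ?\<zeta> y = s *\<^sub>R u then t (\<omega> u) * \<bar>Im (\<zeta> / u)\<bar> else 0)"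
      using balanced_rays_break[OF kD(3,4) bal' y0] ..
    from eventually_compose_filterlim[OF this tend]
    have ev: "\<forall>\<^sub>F z in nhds y. \<psi> z = (\<Sum>u\<in>R. \<kappa> u * Im (?\<zeta> z / u)) +
        (\<Sum>u\<in>R. if \<exists>s>0. ?\<zeta> y = s *\<^sub>R u then t (\<omega> u) * \<bar>Im (?\<zeta> z / u)\<bar> else 0)"
      unfolding \<psi>_def .
    define L where "L = lorentz_flip (\<Sum>u\<in>R. \<kappa> u *\<^sub>R normal_vector a b (\<i> * u))"
    have L: "(\<Sum>u\<in>R. \<kappa> u * Im (?\<zeta> z / u)) = L \<bullet> z" for z
      unfolding L_def lorentz_eq_inner[symmetric] lorentz_sum_left
      by (rule sum.cong) (simp_all add: Im)
    have jump: "(\<Sum>u\<in>R. if \<exists>s>0. ?\<zeta> y = s *\<^sub>R u then t (\<omega> u) * \<bar>Im (?\<zeta> z / u)\<bar> else 0) = bend t y z" for z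
    proof (cases "y \<in> D")
      case False
      have none: "\<not> (\<exists>s>0. ?\<zeta> y = s *\<^sub>R u)" if "u \<in> R" for u
        using kD(7)[OF y(1)] False that less_imp_le by blast
      show ?thesis unfolding bend_def if_not_P[OF False]
        by (rule sum.neutral) (use none in auto)
    next
      case True
      obtain u0 s0 where u0: "u0 \<in> R" "s0 \<ge> 0" "?\<zeta> y = s0 *\<^sub>R u0" using kD(7)[OF y(1)] True by blast
      have s0: "s0 > 0" using u0(2,3) y0 by (cases "s0 = 0") auto
      have n0: "norm u0 = 1" "u0 \<noteq> 0" using kD(4)[OF u0(1)] by auto
      have uniq: "(\<exists>s>0. ?\<zeta> y = s *\<^sub>R u) \<longleftrightarrow> u = u0" if "u \<in> R" for u
      proof
        assume "\<exists>s>0. ?\<zeta> y = s *\<^sub>R u"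
        then obtain s where s: "s > 0" "s0 *\<^sub>R u0 = s *\<^sub>R u" using u0(3) by auto
        then have "norm (s0 *\<^sub>R u0) = norm (s *\<^sub>R u)" by simp
        then have "s0 = s" using n0 kD(4)[OF that] s(1) s0 by simp
        then show "u = u0" using s by simp
      qed (use u0(3) s0 in auto)
      have "(\<Sum>u\<in>R. if \<exists>s>0. ?\<zeta> y = s *\<^sub>R u then t (\<omega> u) * \<bar>Im (?\<zeta> z / u)\<bar> else 0)
          = (\<Sum>u\<in>R. if u = u0 then t (\<omega> u) * \<bar>Im (?\<zeta> z / u)\<bar> else 0)"
        by (rule sum.cong) (simp_all add: uniq)
      also have "\<dots> = t (\<omega> u0) * \<bar>Im (?\<zeta> z / u0)\<bar>" using u0(1) kD(3) by simp
      also have "\<dots> = t (wall y) * \<bar>lorentz (normal_vector a b (\<i> * u0)) z\<bar>"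
        using kD(8)[OF u0(1) y(1) s0 u0(3)] Im[OF u0(1)] by simp
      also have "\<dots> = bend t y z"
      proof (rule bend_eq[symmetric])
        let ?n = "normal_vector a b (\<i> * u0)"
        show "y \<in> D - N" using True y(2) by blast
        show "lorentz ?n ?n = 1"
          using Im[OF u0(1), of ?n] kD(2) n0 by simp
        show "lorentz ?n y = 0" using Im[OF u0(1), of y] n0(2) by (simp add: u0(3) scaleR_conv_of_real)
        have "filterlim (\<lambda>z. Re (?\<zeta> z / u0)) (nhds (Re (?\<zeta> y / u0))) (nhds y)"
          using n0(2) by (intro tendsto_intros tend) auto
        moreover have "Re (?\<zeta> y / u0) > 0" using n0(2) s0 by (simp add: u0(3) scaleR_conv_of_real)
        ultimately have "\<forall>\<^sub>F z in nhds y. Re (?\<zeta> z / u0) > 0" by (rule order_tendstoD(1))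
        then show "\<forall>\<^sub>F z in nhds y. lorentz ?n z = 0 \<longrightarrow> z \<in> D"
          using near
        proof eventually_elim
          case (elim z)
          show ?case
          proof
            assume "lorentz ?n z = 0"
            then have "Im (?\<zeta> z / u0) = 0" using Im[OF u0(1)] by simp
            then have "?\<zeta> z / u0 = of_real (Re (?\<zeta> z / u0))" by (simp add: complex_eq_iff)
            then have "?\<zeta> z = Re (?\<zeta> z / u0) *\<^sub>R u0" using n0(2) by (metis nonzero_divide_eq_eq scaleR_conv_of_real)
            then show "z \<in> D" using kD(7)[OF elim(2)] u0(1) elim(1) less_imp_le by blast
          qed
        qed
      qed
      finally show ?thesis .
    qed
    show "\<exists>L. \<forall>\<^sub>F z in nhds y. \<psi> z = L \<bullet> z + bend t y z"
      using ev unfolding L jump by (rule exI)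
  qed
  then show ?thesis using kD(1) by blast
qed

lemma bent_solution_exists:
  assumes "\<And>x. x \<in> N \<Longrightarrow> balanced t x"
  shows "\<exists>\<Psi>. solves_near (bend t) N timecone \<Psi>"
proof (rule solves_near_glue[OF negligible_N convex_timecone open_timecone])
  fix x :: "'n mink" assume "x \<in> timecone"
  then consider "x \<in> N" | "x \<in> D - N" | "x \<in> timecone - D" by blast
  then show "\<exists>r>0. \<exists>\<psi>. solves_near (bend t) N (ball x r) \<psi>"
    by cases (use solves_near_off_D solves_near_wall solves_near_binding assms in auto)
qed

end

section \<open>The bending cocycle\<close>

lemma solves_near_sum:
  assumes I: "finite I" and sol: "\<And>i. i \<in> I \<Longrightarrow> solves_near (m i) N W (\<Psi> i)"
  shows "solves_near (\<lambda>y z. \<Sum>i\<in>I. k i * m i y z) N W (\<lambda>z. \<Sum>i\<in>I. k i * \<Psi> i z)"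
  unfolding solves_near_def
proof
  fix y assume y: "y \<in> W - N"
  have "\<forall>i\<in>I. \<exists>L. \<forall>\<^sub>F z in nhds y. \<Psi> i z = L \<bullet> z + m i y z"
    using solves_nearD[OF sol y] by simp
  from bchoice[OF this] obtain L where L: "\<forall>i\<in>I. \<forall>\<^sub>F z in nhds y. \<Psi> i z = L i \<bullet> z + m i y z" ..
  then have "\<forall>\<^sub>F z in nhds y. \<forall>i\<in>I. \<Psi> i z = L i \<bullet> z + m i y z"
    using I by (simp add: eventually_ball_finite)
  then have "\<forall>\<^sub>F z in nhds y. (\<Sum>i\<in>I. k i * \<Psi> i z) = (\<Sum>i\<in>I. k i *\<^sub>R L i) \<bullet> z + (\<Sum>i\<in>I. k i * m i y z)"
  proof eventually_elim
    case (elim z)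
    have "(\<Sum>i\<in>I. k i * \<Psi> i z) = (\<Sum>i\<in>I. k i * (L i \<bullet> z) + k i * m i y z)"
      by (rule sum.cong) (use elim in \<open>simp_all add: algebra_simps\<close>)
    then show ?case by (simp add: sum.distrib inner_sum_left)
  qed
  then show "\<exists>L. \<forall>\<^sub>F z in nhds y. (\<Sum>i\<in>I. k i * \<Psi> i z) = L \<bullet> z + (\<Sum>i\<in>I. k i * m i y z)"
    by (rule exI)
qed

context branched_lattice
begin

lemma timecone_off_N: "open (timecone - N)" "timecone - N \<noteq> {}"
proof -
  show "open (timecone - N)" by (rule open_off_N)
  define o' :: "'n mink" where "o' = (\<chi> k. if k = None then 1 else 0)"
  have "space_part o' = 0" by (simp add: o'_def space_part_def vec_eq_iff)
  then have o: "o' \<in> timecone" by (simp add: timecone_iff o'_def)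
  show "timecone - N \<noteq> {}" using negligible_locusE[OF negligible_N o open_timecone o] by (metis Diff_mono Int_Diff bot.extremum_unique inf.absorb2 order_refl subset_empty)
qed

text \<open>Used to compare values of cocycles, which are characterized by the linear functions they induce.\<close>

lemma vector_eq_if_shifted_forms_eq:
  assumes g: "g \<in> \<Gamma>" and S: "open S" "S \<noteq> {}"
    and eq: "\<And>z. z \<in> S \<Longrightarrow> lorentz f (g *v z) = lorentz f' (g *v z)"
  shows "f = f'"
proof -
  obtain e where e: "g *v e = f" using SO_plus_surj[OF \<Gamma>_SO[OF g]] .
  obtain e' where e': "g *v e' = f'" using SO_plus_surj[OF \<Gamma>_SO[OF g]] .
  have "lorentz e z = lorentz e' z" if "z \<in> S" for z
    using eq[OF that] SO_plus_lorentz[OF \<Gamma>_SO[OF g]] by (metis e e')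
  then have "lorentz_flip e = lorentz_flip e'"
    by (intro inner_eq_on_open_imp_eq[OF S]) (simp add: lorentz_eq_inner[symmetric])
  then show ?thesis using e e' by (metis lorentz_flip_flip)
qed

text \<open>By invariance of the prescribed germs, the translate of a solution by \<open>g\<close> is a solution for the same
weights.\<close>

lemma translate_differs_by_linear:
  assumes sol: "solves_near (bend t) N timecone \<Psi>" and g: "g \<in> \<Gamma>"
  shows "\<exists>f. \<forall>z\<in>timecone - N. \<Psi> z - \<Psi> (g *v z) = lorentz f (g *v z)"
proof -
  have "solves_near (bend t) N timecone (\<lambda>z. \<Psi> (g *v z))"
    unfolding solves_near_def
  proof
    fix y assume y: "y \<in> timecone - N"
    then have gy: "g *v y \<in> timecone - N"
      using N_invariant[OF g] SO_plus_timecone(1)[OF \<Gamma>_SO[OF g]] by blast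
    obtain L where L: "\<forall>\<^sub>F z in nhds (g *v y). \<Psi> z = L \<bullet> z + bend t (g *v y) z"
      using solves_nearD[OF sol gy] ..
    have tend: "filterlim (\<lambda>z. g *v z) (nhds (g *v y)) (nhds y)"
      using matrix_vector_mult_linear_continuous_at[of y g]
      by (simp add: isCont_def tendsto_at_iff_tendsto_nhds)
    obtain e where e: "g *v e = lorentz_flip L" using SO_plus_surj[OF \<Gamma>_SO[OF g]] .
    have "L \<bullet> (g *v z) = lorentz_flip e \<bullet> z" for z
      using SO_plus_lorentz[OF \<Gamma>_SO[OF g], of e z] unfolding e lorentz_eq_inner by simp
    then have "\<forall>\<^sub>F z in nhds y. \<Psi> (g *v z) = lorentz_flip e \<bullet> z + bend t y z"
      using eventually_compose_filterlim[OF L tend] bend_invariant[OF g y] by simp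
    then show "\<exists>L. \<forall>\<^sub>F z in nhds y. \<Psi> (g *v z) = L \<bullet> z + bend t y z" by (rule exI)
  qed
  from solves_near_diff_linear[OF negligible_N convex_connected[OF convex_timecone] open_timecone order_refl sol this]
  obtain L where L: "\<forall>z\<in>timecone - N. \<Psi> z - \<Psi> (g *v z) = L \<bullet> z" ..
  have "L \<bullet> z = lorentz (g *v lorentz_flip L) (g *v z)" for z
    by (simp add: SO_plus_lorentz[OF \<Gamma>_SO[OF g]] inner_eq_lorentz)
  then show ?thesis using L by (intro exI[of _ "g *v lorentz_flip L"]) simp
qed

definition bending_cocycle :: "('n mink \<Rightarrow> real) \<Rightarrow> 'n mink_mat \<Rightarrow> 'n mink" where
  "bending_cocycle \<Psi> g = (if g \<in> \<Gamma> then SOME f. \<forall>z\<in>timecone - N. \<Psi> z - \<Psi> (g *v z) = lorentz f (g *v z) else 0)"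

lemma bending_cocycle:
  assumes "solves_near (bend t) N timecone \<Psi>" "g \<in> \<Gamma>" "z \<in> timecone - N"
  shows "\<Psi> z - \<Psi> (g *v z) = lorentz (bending_cocycle \<Psi> g) (g *v z)"
  using someI_ex[OF translate_differs_by_linear[OF assms(1,2)]] assms(2,3)
  unfolding bending_cocycle_def by simp

text \<open>The cocycle identity is \<open>\<Psi> z - \<Psi> (g h z) = (\<Psi> z - \<Psi> (h z)) + (\<Psi> (h z) - \<Psi> (g h z))\<close>, read through
the form.\<close>

lemma bending_cocycle_in_cocycles1:
  assumes sol: "solves_near (bend t) N timecone \<Psi>"
  shows "bending_cocycle \<Psi> \<in> cocycles1 \<Gamma>"
  unfolding cocycles1_def
proof (intro CollectI conjI ballI allI impI)
  fix g assume "g \<notin> \<Gamma>"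
  then show "bending_cocycle \<Psi> g = 0" by (simp add: bending_cocycle_def)
next
  fix g h assume g: "g \<in> \<Gamma>" and h: "h \<in> \<Gamma>"
  show "bending_cocycle \<Psi> (g ** h) = bending_cocycle \<Psi> g + g *v bending_cocycle \<Psi> h"
  proof (rule vector_eq_if_shifted_forms_eq[OF \<Gamma>_mult[OF g h] timecone_off_N])
    fix z assume z: "z \<in> timecone - N"
    then have hz: "h *v z \<in> timecone - N"
      using N_invariant[OF h] SO_plus_timecone(1)[OF \<Gamma>_SO[OF h]] by blast
    have "lorentz (g *v bending_cocycle \<Psi> h) (g *v (h *v z)) = lorentz (bending_cocycle \<Psi> h) (h *v z)"
      by (rule SO_plus_lorentz[OF \<Gamma>_SO[OF g]])
    then show "lorentz (bending_cocycle \<Psi> (g ** h)) ((g ** h) *v z) =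
        lorentz (bending_cocycle \<Psi> g + g *v bending_cocycle \<Psi> h) ((g ** h) *v z)"
      using bending_cocycle[OF sol \<Gamma>_mult[OF g h] z] bending_cocycle[OF sol h z] bending_cocycle[OF sol g hz]
      by (simp add: matrix_vector_mul_assoc[symmetric])
  qed
qed

section \<open>Cohomologically trivial bending is zero\<close>

text \<open>Let \<open>S\<close> be the component of the complement of \<open>D\<close> in the cone that contains \<open>y\<close>, and \<open>\<delta>\<close> the
complementary region of \<open>radial y\<close>, which lies in \<open>S\<close>. An element of \<open>\<Gamma>\<close> that stabilizes \<open>\<delta>\<close> maps \<open>S\<close> into
itself, so it fixes the vector that represents the linear function \<open>\<Phi>\<close> on \<open>S\<close>. By density the vector is
fixed by the whole group.\<close>

lemma invariant_solution_vanishes_off_D: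
  assumes n: "CARD('n) \<ge> 2"
    and dense: "\<And>\<delta>. \<delta> \<in> components (hyperboloid - lift \<Gamma> \<Delta>) \<Longrightarrow>
           zariski_dense_in (set_stabilizer \<Gamma> \<delta>) (carrier SO_plus)"
    and sol: "solves_near (bend t) N timecone \<Phi>"
    and inv: "\<And>g z. g \<in> \<Gamma> \<Longrightarrow> z \<in> timecone - N \<Longrightarrow> \<Phi> (g *v z) = \<Phi> z"
    and y: "y \<in> timecone - D"
  shows "\<Phi> y = 0"
proof -
  let ?O = "timecone - D"
  define S where "S = connected_component_set ?O y"
  have S: "open S" "connected S" "S \<subseteq> ?O" "y \<in> S"
    unfolding S_def using open_off_D y
    by (auto simp: open_connected_component connected_component_subset)
  \<comment> \<open>On \<open>S\<close> nothing is prescribed, so that the empty locus suffices.\<close>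
  have none: "negligible_locus UNIV ({} :: 'n mink set)"
    unfolding negligible_locus_def by (auto intro!: exI[of _ "1::real"])
  have "\<exists>L. \<forall>z\<in>S - {}. \<Phi> z = L \<bullet> z"
  proof (rule locally_linear_imp_linear_off_locus[OF none S(2,1) subset_UNIV])
    fix z assume "z \<in> S"
    then have z: "z \<in> timecone - N" "z \<notin> D" using S(3) N_subset_D by auto
    show "\<exists>L. \<forall>\<^sub>F w in nhds z. w \<notin> {} \<longrightarrow> \<Phi> w = L \<bullet> w"
      using solves_nearD[OF sol z(1)] z(2) by (simp add: bend_def)
  qed
  then obtain L where L: "\<And>z. z \<in> S \<Longrightarrow> \<Phi> z = lorentz (lorentz_flip L) z"
    by (auto simp: inner_eq_lorentz)
  let ?w = "lorentz_flip L"
  have yt: "y \<in> timecone" using y by blast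
  have lifted: "z \<in> hyperboloid - lift \<Gamma> \<Delta> \<longleftrightarrow> z \<in> hyperboloid \<and> z \<in> ?O" for z
    using hyperboloid_subset_timecone by (auto simp: lift_def D_def proj_hyperboloid)
  have ry: "radial y \<in> hyperboloid - lift \<Gamma> \<Delta>"
    unfolding lifted using yt y radial_in_hyperboloid[OF yt] hyperboloid_subset_timecone
    by (auto simp: D_def proj_def radial_hyperboloid)
  define \<delta> where "\<delta> = connected_component_set (hyperboloid - lift \<Gamma> \<Delta>) (radial y)"
  have \<delta>: "\<delta> \<in> components (hyperboloid - lift \<Gamma> \<Delta>)" "radial y \<in> \<delta>" "connected \<delta>" "\<delta> \<subseteq> ?O"
    unfolding \<delta>_def using ry lifted connected_component_subset
    by (auto simp: components_def)
  have "radial y \<in> S"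
  proof -
    let ?K = "(\<lambda>c. c *\<^sub>R y) ` {0<..}"
    have "connected ?K" by (intro connected_continuous_image continuous_intros) simp
    moreover have "?K \<subseteq> ?O"
      using y timecone_scaleR by (auto simp: D_def proj_def radial_scaleR)
    moreover have "y \<in> ?K" by (rule image_eqI[of _ _ 1]) auto
    moreover have "radial y \<in> ?K" using yt by (auto simp: radial_def timecone_def)
    ultimately show ?thesis unfolding S_def by (simp add: connected_component_def) blast
  qed
  then have \<delta>S: "\<delta> \<subseteq> S"
    using \<delta> connected_component_maximal[of "radial y" \<delta> ?O] connected_component_eq[of "radial y" ?O y]
    unfolding S_def by blast
  have fixw: "g *v ?w = ?w" if g: "g \<in> set_stabilizer \<Gamma> \<delta>" for g
  proof -
    have g\<Gamma>: "g \<in> \<Gamma>" and g\<delta>: "(\<lambda>x. g *v x) ` \<delta> = \<delta>" using g by (auto simp: set_stabilizer_def)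
    have gS: "(\<lambda>x. g *v x) ` S \<subseteq> S"
    proof -
      have c: "connected ((\<lambda>x. g *v x) ` S)"
        using S(2) by (intro connected_continuous_image linear_continuous_on matrix_vector_mul_bounded_linear)
      have sub: "(\<lambda>x. g *v x) ` S \<subseteq> ?O"
        using S(3) D_invariant[OF g\<Gamma>] SO_plus_timecone(1)[OF \<Gamma>_SO[OF g\<Gamma>]] by blast
      have m: "g *v radial y \<in> S" using g\<delta> \<delta>(2) \<delta>S by blast
      have "g *v radial y \<in> (\<lambda>x. g *v x) ` S" using \<open>radial y \<in> S\<close> by blast
      then show ?thesis
        using connected_component_maximal[OF _ c sub] connected_component_eq[of "g *v radial y" ?O y] m
        unfolding S_def by blast
    qed
    show ?thesis
    proof (rule vector_eq_if_shifted_forms_eq[OF g\<Gamma> S(1)])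
      show "S \<noteq> {}" using S(4) by blast
      fix z assume z: "z \<in> S"
      then have "lorentz ?w (g *v z) = \<Phi> (g *v z)" using L gS by auto
      also have "\<dots> = \<Phi> z" using inv[OF g\<Gamma>, of z] z S(3) N_subset_D by auto
      also have "\<dots> = lorentz (g *v ?w) (g *v z)" using L[OF z] SO_plus_lorentz[OF \<Gamma>_SO[OF g\<Gamma>]] by simp
      finally show "lorentz (g *v ?w) (g *v z) = lorentz ?w (g *v z)" by simp
    qed
  qed
  have "A *v ?w = ?w" if "A \<in> carrier SO_plus" for A
  proof -
    have "carrier SO_plus \<subseteq> {A. A *v ?w = ?w}"
      using dense[OF \<delta>(1)] zariski_closed_fixing[of ?w] fixw unfolding zariski_dense_in_def by blast
    then show ?thesis using that by blast
  qed
  then have "?w = 0" by (rule SO_plus_fixed_vector[OF n])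
  then show ?thesis using L[OF S(4)] by simp
qed

text \<open>Near \<open>y\<close> a linear function plus \<open>t \<bar>lorentz e z\<bar>\<close> vanishes off the wall. Evaluated at \<open>y \<plusminus> s e\<close> and at
\<open>y \<plusminus> (s/2) e\<close>, this leaves \<open>t s = 0\<close>.\<close>

lemma weight_zero_if_vanishing_off_D:
  assumes sol: "solves_near (bend t) N timecone \<Phi>" and van: "\<And>z. z \<in> timecone - D \<Longrightarrow> \<Phi> z = 0"
    and y: "y \<in> D - N"
  shows "t (wall y) = 0"
proof -
  let ?e = "normal y" and ?t = "t (wall y)"
  have yt: "y \<in> timecone - N" using y D_timecone by blast
  obtain L where L: "\<forall>\<^sub>F z in nhds y. \<Phi> z = L \<bullet> z + bend t y z" using solves_nearD[OF sol yt] ..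
  have "\<forall>\<^sub>F z in nhds y. lorentz ?e z \<noteq> 0 \<longrightarrow> L \<bullet> z + ?t * \<bar>lorentz ?e z\<bar> = 0"
    using L normal(2)[OF y] eventually_off_N[OF yt]
  proof eventually_elim
    case (elim z)
    show ?case
    proof
      assume "lorentz ?e z \<noteq> 0"
      then have "\<Phi> z = 0" using elim van by blast
      then show "L \<bullet> z + ?t * \<bar>lorentz ?e z\<bar> = 0" using elim y by (simp add: bend_def)
    qed
  qed
  then obtain U where U: "open U" "y \<in> U"
    "\<And>z. z \<in> U \<Longrightarrow> lorentz ?e z \<noteq> 0 \<Longrightarrow> L \<bullet> z + ?t * \<bar>lorentz ?e z\<bar> = 0"
    unfolding eventually_nhds by blast
  obtain r where r: "r > 0" "ball y r \<subseteq> U" using U(1,2) by (rule openE)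
  have ey: "lorentz ?e y = 0" using eventually_nhds_x_imp_x[OF normal(2)[OF y]] y by blast
  have e1: "lorentz ?e ?e = 1" using normal(1)[OF y] .
  have ne: "norm ?e > 0" using e1 by auto
  have pt: "L \<bullet> y + s * (L \<bullet> ?e) + ?t * \<bar>s\<bar> = 0" if s: "s \<noteq> 0" "\<bar>s\<bar> * norm ?e < r" for s
  proof -
    have "y + s *\<^sub>R ?e \<in> U" using s(2) r(2) by (auto simp: dist_norm subset_iff)
    from U(3)[OF this] show ?thesis using s(1) by (simp add: ey e1 inner_add_right)
  qed
  define s where "s = r / (2 * norm ?e)"
  have s: "s > 0" "s * norm ?e < r" "s / 2 * norm ?e < r" using r(1) ne by (auto simp: s_def)
  define P where "P = s * (L \<bullet> ?e)"
  define T where "T = ?t * s"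
  have "L \<bullet> y + P + T = 0" "L \<bullet> y - P + T = 0" "L \<bullet> y + P / 2 + T / 2 = 0" "L \<bullet> y - P / 2 + T / 2 = 0"
    using pt[of s] pt[of "- s"] pt[of "s / 2"] pt[of "- (s / 2)"] s by (auto simp: P_def T_def)
  then have "T = 0" by linarith
  then show ?thesis using s(1) by (simp add: T_def)
qed

end

section \<open>Counting weights\<close>

text \<open>Every linear condition lowers the dimension of a space of weights on \<open>W\<close> by at most one. The induction
carries an independent family \<open>s\<close> in the common kernel, indexed by a subset \<open>I\<close> of \<open>W\<close>; a new functional
that is nonzero on some \<open>s p\<close> costs the index \<open>p\<close>, which serves as a pivot for the others.\<close>

lemma common_kernel_of_functionals:
  fixes W :: "'w set" and K :: "(('w \<Rightarrow> real) \<Rightarrow> real) set"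
  assumes "finite W" "finite K"
    and lin: "\<And>l p q k. l \<in> K \<Longrightarrow> l (\<lambda>w. p w + k * q w) = l p + k * l q"
  shows "\<exists>I s. I \<subseteq> W \<and> card W \<le> card I + card K \<and> (\<forall>i\<in>I. \<forall>l\<in>K. l (s i) = 0) \<and>
     (\<forall>c. (\<forall>w\<in>W. (\<Sum>i\<in>I. c i * s i w) = 0) \<longrightarrow> (\<forall>i\<in>I. c i = (0::real)))"
  using assms(2) lin
proof (induction K rule: finite_induct)
  case empty
  show ?case
  proof (intro exI[of _ W] exI[of _ "\<lambda>i w. if i = w then 1 else 0"] conjI allI impI ballI)
    fix c :: "'w \<Rightarrow> real" and i
    assume "\<forall>w\<in>W. (\<Sum>i\<in>W. c i * (if i = w then 1 else 0)) = 0" and i: "i \<in> W"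
    then have "(\<Sum>j\<in>W. c j * (if j = i then 1 else 0)) = 0" by blast
    also have "(\<Sum>j\<in>W. c j * (if j = i then 1 else 0)) = (\<Sum>j\<in>W. if j = i then c j else 0)"
      by (rule sum.cong) auto
    finally show "c i = 0" using i \<open>finite W\<close> by simp
  qed auto
next
  case (insert l K)
  have K_lin: "l' (\<lambda>w. p w + k * q w) = l' p + k * l' q" if "l' \<in> K" for l' p q k
    by (rule insert.prems) (use that in blast)
  obtain I s where I: "I \<subseteq> W" "card W \<le> card I + card K"
    and raw: "\<forall>i\<in>I. \<forall>l\<in>K. l (s i) = 0"
      "\<forall>c. (\<forall>w\<in>W. (\<Sum>i\<in>I. c i * s i w) = 0) \<longrightarrow> (\<forall>i\<in>I. c i = (0::real))"
    using insert.IH[OF K_lin] by blast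
  then have van: "i \<in> I \<Longrightarrow> l \<in> K \<Longrightarrow> l (s i) = 0" for i l by blast
  have ind: "(\<forall>w\<in>W. (\<Sum>i\<in>I. c i * s i w) = 0) \<Longrightarrow> (\<forall>i\<in>I. c i = 0)" for c
    using raw(2) by blast
  have fI: "finite I" using I(1) \<open>finite W\<close> finite_subset by blast
  have K: "card (insert l K) = Suc (card K)" using insert.hyps by simp
  show ?case
  proof (cases "\<forall>i\<in>I. l (s i) = 0")
    case True
    show ?thesis
      by (intro exI[of _ I] exI[of _ s] conjI allI impI) (use I True ind van K in auto)
  next
    case False
    then obtain p where p: "p \<in> I" "l (s p) \<noteq> 0" by blast
    define s' where "s' i = (\<lambda>w. s i w + (- l (s i) / l (s p)) * s p w)" for i
    show ?thesis
    proof (intro exI[of _ "I - {p}"] exI[of _ s'] conjI allI impI ballI)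
      show "I - {p} \<subseteq> W" using I(1) by blast
      show "card W \<le> card (I - {p}) + card (insert l K)"
        using I(2) K p(1) fI by (simp add: card_Suc_Diff1 card_Diff_singleton)
    next
      fix i k assume i: "i \<in> I - {p}" and k: "k \<in> insert l K"
      have "k (s' i) = k (s i) + (- l (s i) / l (s p)) * k (s p)"
        unfolding s'_def by (rule insert.prems[OF k])
      then show "k (s' i) = 0" using k van[of _ k] i p by auto
    next
      fix c i assume van: "\<forall>w\<in>W. (\<Sum>i\<in>I - {p}. c i * s' i w) = 0" and i: "i \<in> I - {p}"
      \<comment> \<open>Expanding the family \<open>s'\<close> in terms of \<open>s\<close> collects the coefficient of the pivot.\<close>
      define c' where "c' j = (if j = p then \<Sum>i\<in>I - {p}. c i * (- l (s i) / l (s p)) else c j)" for j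
      have "\<forall>w\<in>W. (\<Sum>j\<in>I. c' j * s j w) = 0"
      proof
        fix w assume "w \<in> W"
        have "(\<Sum>j\<in>I. c' j * s j w) = c' p * s p w + (\<Sum>j\<in>I - {p}. c' j * s j w)"
          using fI p(1) by (rule sum.remove)
        also have "(\<Sum>j\<in>I - {p}. c' j * s j w) = (\<Sum>j\<in>I - {p}. c j * s j w)"
          by (rule sum.cong) (auto simp: c'_def)
        also have "c' p * s p w + \<dots> = (\<Sum>i\<in>I - {p}. c i * (- l (s i) / l (s p)) * s p w + c i * s i w)"
          by (simp only: c'_def simp_thms if_True sum_distrib_right sum.distrib)
        also have "\<dots> = (\<Sum>i\<in>I - {p}. c i * s' i w)"
          by (rule sum.cong) (simp_all add: s'_def algebra_simps)
        also have "\<dots> = 0" using van \<open>w \<in> W\<close> by blast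
        finally show "(\<Sum>j\<in>I. c' j * s j w) = 0" .
      qed
      then have "\<forall>j\<in>I. c' j = 0" by (rule ind)
      then show "c i = 0" using i by (auto simp: c'_def)
    qed
  qed
qed

context branched_lattice
begin

lemma topspace_sub:
  "topspace (subtopology (quotient_manifold \<Gamma>) B) = B"
  "topspace (subtopology (quotient_manifold \<Gamma>) (\<Delta> - B)) = \<Delta> - B"
  and \<Delta>_proj: "p \<in> \<Delta> \<Longrightarrow> \<exists>z\<in>D. proj z = p"
proof -
  have "\<Delta> \<subseteq> topspace (quotient_manifold \<Gamma>)" "B \<subseteq> \<Delta>"
    using branched closedin_subset unfolding branched_hypersurface_def by blast+
  then show "topspace (subtopology (quotient_manifold \<Gamma>) B) = B"
    "topspace (subtopology (quotient_manifold \<Gamma>) (\<Delta> - B)) = \<Delta> - B"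
    by (auto simp: topspace_subtopology)
  show "\<exists>z\<in>D. proj z = p" if p: "p \<in> \<Delta>"
  proof -
    obtain z where z: "z \<in> hyperboloid" "p = proj z"
      using p \<open>\<Delta> \<subseteq> _\<close> topspace_quotient proj_hyperboloid by auto
    then have "z \<in> D" using p hyperboloid_subset_timecone by (auto simp: D_def)
    then show ?thesis using z by blast
  qed
qed

lemma wall_point_exists:
  assumes "w \<in> connected_components_of (subtopology (quotient_manifold \<Gamma>) (\<Delta> - B))"
  obtains y where "y \<in> D - N" "wall y = w"
proof -
  obtain p where p: "p \<in> \<Delta> - B" "w = connected_component_of_set (subtopology (quotient_manifold \<Gamma>) (\<Delta> - B)) p"
    using assms unfolding connected_components_of_def topspace_sub by blast
  obtain z where z: "z \<in> D" "proj z = p" using \<Delta>_proj p(1) by blast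
  then have "z \<in> D - N" using p(1) by (auto simp: N_def)
  then show ?thesis using that p(2) z(2) by (auto simp: wall_def)
qed

text \<open>One point for each binding is enough.\<close>

lemma balanced_if_balanced_at_representatives:
  assumes rep: "\<And>b. b \<in> connected_components_of (subtopology (quotient_manifold \<Gamma>) B) \<Longrightarrow>
      X b \<in> N \<and> proj (X b) \<in> b \<and> balanced t (X b)"
    and x: "x \<in> N"
  shows "balanced t x"
proof -
  let ?Y = "subtopology (quotient_manifold \<Gamma>) B"
  let ?b = "connected_component_of_set ?Y (proj x)"
  have "proj x \<in> topspace ?Y" unfolding topspace_sub using x by (simp add: N_def)
  then have "?b \<in> connected_components_of ?Y" by (simp add: connected_components_of_def)
  from rep[OF this] show ?thesis using balanced_on_binding[OF x] by blast
qed

text \<open>Real and imaginary part of the balance condition at one point of each binding are the functionals to which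
\<open>common_kernel_of_functionals\<close> is applied. The bending cocycles of the resulting weights are independent
modulo coboundaries: a combination of them is the bending cocycle of the combined weight.\<close>

lemma dim_H1_lower_bound:
  assumes n: "CARD('n) \<ge> 2"
    and dense: "\<And>\<delta>. \<delta> \<in> components (hyperboloid - lift \<Gamma> \<Delta>) \<Longrightarrow>
           zariski_dense_in (set_stabilizer \<Gamma> \<delta>) (carrier SO_plus)"
  shows "enat (num_walls \<Gamma> \<Delta> B - 2 * num_bindings \<Gamma> B) \<le> dim_H1 \<Gamma>"
proof -
  let ?W = "connected_components_of (subtopology (quotient_manifold \<Gamma>) (\<Delta> - B))"
  let ?B = "connected_components_of (subtopology (quotient_manifold \<Gamma>) B)"
  have fin: "finite ?W" "finite ?B" using branched by (auto simp: branched_hypersurface_def)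
  have "\<exists>x. x \<in> N \<and> proj x \<in> b" if b: "b \<in> ?B" for b
  proof -
    obtain p where p: "p \<in> B" "b = connected_component_of_set (subtopology (quotient_manifold \<Gamma>) B) p"
      using b unfolding connected_components_of_def topspace_sub by blast
    have "B \<subseteq> \<Delta>" using branched by (simp add: branched_hypersurface_def)
    then obtain z where z: "z \<in> D" "proj z = p" using \<Delta>_proj p(1) by blast
    then have "z \<in> N" using p(1) by (auto simp: N_def D_def)
    moreover have "p \<in> b"
      unfolding p(2) mem_Collect_eq connected_component_of_refl topspace_sub by (rule p(1))
    ultimately show ?thesis using z by blast
  qed
  then obtain X where X: "\<And>b. b \<in> ?B \<Longrightarrow> X b \<in> N \<and> proj (X b) \<in> b" by metis
  have "\<exists>R \<omega>. \<exists>r a b'. book (X b) r a b' R \<omega>" if "b \<in> ?B" for b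
    using book_exists X[OF that] by metis
  then obtain R \<omega> where R\<omega>: "\<And>b. b \<in> ?B \<Longrightarrow> \<exists>r a b'. book (X b) r a b' (R b) (\<omega> b)" by metis
  define l1 where "l1 b t = Re (\<Sum>u\<in>R b. t (\<omega> b u) *\<^sub>R u)" for b and t :: "'n mink set set \<Rightarrow> real"
  define l2 where "l2 b t = Im (\<Sum>u\<in>R b. t (\<omega> b u) *\<^sub>R u)" for b and t :: "'n mink set set \<Rightarrow> real"
  let ?K = "l1 ` ?B \<union> l2 ` ?B"
  have finK: "finite ?K" using fin by simp
  have cardK: "card ?K \<le> card ?B + card ?B"
    using card_Un_le[of "l1 ` ?B" "l2 ` ?B"] card_image_le[OF fin(2), of l1] card_image_le[OF fin(2), of l2] by linarith
  have lin: "l (\<lambda>w. p w + k * q w) = l p + k * l q" if "l \<in> ?K" for l p q k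
    using that by (auto simp: l1_def l2_def Re_sum Im_sum sum.distrib sum_distrib_left algebra_simps)
  obtain I s where I: "I \<subseteq> ?W" "card ?W \<le> card I + card ?K" and raw: "\<forall>i\<in>I. \<forall>l\<in>?K. l (s i) = 0"
      "\<forall>c. (\<forall>w\<in>?W. (\<Sum>i\<in>I. c i * s i w) = 0) \<longrightarrow> (\<forall>i\<in>I. c i = (0::real))"
    using common_kernel_of_functionals[OF fin(1) finK lin] by blast
  from I(2) cardK have cardI: "num_walls \<Gamma> \<Delta> B - 2 * num_bindings \<Gamma> B \<le> card I"
    unfolding num_walls_def num_bindings_def by linarith
  have fI: "finite I" using I(1) fin(1) finite_subset by blast
  have "\<exists>\<Psi>. solves_near (bend (s i)) N timecone \<Psi>" if i: "i \<in> I" for i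
  proof (rule bent_solution_exists, rule balanced_if_balanced_at_representatives)
    fix b assume b: "b \<in> ?B"
    obtain r a b' where k: "book (X b) r a b' (R b) (\<omega> b)" using R\<omega>[OF b] by blast
    have "l1 b (s i) = 0" "l2 b (s i) = 0" using raw(1) i b by blast+
    then have "balanced (s i) (X b)"
      using balanced_iff_book[OF k] X[OF b] by (simp add: l1_def l2_def complex_eq_iff)
    then show "X b \<in> N \<and> proj (X b) \<in> b \<and> balanced (s i) (X b)" using X[OF b] by blast
  qed
  then obtain \<Psi> where \<Psi>: "\<And>i. i \<in> I \<Longrightarrow> solves_near (bend (s i)) N timecone (\<Psi> i)" by metis
  let ?f = "\<lambda>i. bending_cocycle (\<Psi> i)"
  have key: "\<forall>i\<in>I. k i = 0" if cob: "(\<lambda>g. \<Sum>i\<in>I. k i *\<^sub>R ?f i g) \<in> coboundaries1 \<Gamma>" for k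
  proof -
    obtain v where v: "(\<Sum>i\<in>I. k i *\<^sub>R ?f i g) = g *v v - v" if "g \<in> \<Gamma>" for g
    proof -
      obtain v where "(\<lambda>g. \<Sum>i\<in>I. k i *\<^sub>R ?f i g) = (\<lambda>g. if g \<in> \<Gamma> then g *v v - v else 0)"
        using cob unfolding coboundaries1_def by blast
      then show ?thesis by (intro that[of v]) (metis (mono_tags, lifting))
    qed
    define t where "t w = (\<Sum>i\<in>I. k i * s i w)" for w
    \<comment> \<open>The coboundary of \<open>v\<close> is absorbed by a linear function.\<close>
    define \<Phi> where "\<Phi> z = (\<Sum>i\<in>I. k i * \<Psi> i z) - lorentz v z" for z
    have bend_t: "bend t = (\<lambda>y z. \<Sum>i\<in>I. k i * bend (s i) y z)"
      by (auto simp: fun_eq_iff bend_def t_def sum_distrib_right mult.assoc)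
    have "solves_near (bend t) N timecone (\<lambda>z. \<Sum>i\<in>I. k i * \<Psi> i z)"
      unfolding bend_t using fI \<Psi> by (rule solves_near_sum)
    then have sol: "solves_near (bend t) N timecone \<Phi>"
      unfolding solves_near_def
    proof (intro ballI)
      fix y assume *: "\<forall>y\<in>timecone - N. \<exists>L. \<forall>\<^sub>F z in nhds y. (\<Sum>i\<in>I. k i * \<Psi> i z) = L \<bullet> z + bend t y z"
        and y: "y \<in> timecone - N"
      obtain L where "\<forall>\<^sub>F z in nhds y. (\<Sum>i\<in>I. k i * \<Psi> i z) = L \<bullet> z + bend t y z" using bspec[OF * y] ..
      then have "\<forall>\<^sub>F z in nhds y. \<Phi> z = (L - lorentz_flip v) \<bullet> z + bend t y z"
        by eventually_elim (simp add: \<Phi>_def inner_diff_left lorentz_eq_inner)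
      then show "\<exists>L. \<forall>\<^sub>F z in nhds y. \<Phi> z = L \<bullet> z + bend t y z" by (rule exI)
    qed
    have inv: "\<Phi> (g *v z) = \<Phi> z" if g: "g \<in> \<Gamma>" and z: "z \<in> timecone - N" for g z
    proof -
      have "(\<Sum>i\<in>I. k i * \<Psi> i z) - (\<Sum>i\<in>I. k i * \<Psi> i (g *v z)) = (\<Sum>i\<in>I. k i * lorentz (?f i g) (g *v z))"
        unfolding sum_subtractf[symmetric] right_diff_distrib[symmetric]
        by (rule sum.cong) (simp_all add: bending_cocycle[OF \<Psi> g z])
      also have "\<dots> = lorentz (\<Sum>i\<in>I. k i *\<^sub>R ?f i g) (g *v z)" by (simp add: lorentz_sum_left)
      also have "\<dots> = lorentz v z - lorentz v (g *v z)"
        unfolding v[OF g] by (simp add: SO_plus_lorentz[OF \<Gamma>_SO[OF g]])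
      finally show ?thesis by (simp add: \<Phi>_def)
    qed
    have "t w = 0" if w: "w \<in> ?W" for w
    proof -
      obtain y where y: "y \<in> D - N" "wall y = w" using wall_point_exists[OF w] .
      have "t (wall y) = 0"
        by (rule weight_zero_if_vanishing_off_D[OF sol _ y(1)])
          (rule invariant_solution_vanishes_off_D[OF n dense sol inv])
      then show ?thesis using y(2) by simp
    qed
    then have "\<forall>w\<in>?W. (\<Sum>i\<in>I. k i * s i w) = 0" by (simp add: t_def)
    then show ?thesis using raw(2) by blast
  qed
  have inj: "inj_on ?f I"
  proof (rule inj_onI, rule ccontr)
    fix i j assume ij: "i \<in> I" "j \<in> I" "?f i = ?f j" "i \<noteq> j"
    define k where "k l = (if l = i then 1 else 0) - (if l = j then 1 else (0::real))" for l
    have "(\<Sum>l\<in>I. k l *\<^sub>R ?f l g) = 0" for g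
    proof -
      have "(\<Sum>l\<in>I. k l *\<^sub>R ?f l g) = (\<Sum>l\<in>I. (if l = i then ?f l g else 0) - (if l = j then ?f l g else 0))"
        by (rule sum.cong) (auto simp: k_def)
      then show ?thesis using ij fI by (simp add: sum_subtractf)
    qed
    then have "(\<lambda>g. \<Sum>l\<in>I. k l *\<^sub>R ?f l g) \<in> coboundaries1 \<Gamma>"
      unfolding coboundaries1_def by (intro image_eqI[of _ _ 0]) auto
    then have "k i = 0" using key ij by blast
    then show False using ij by (simp add: k_def)
  qed
  have "enat (card (?f ` I)) \<le> dim_H1 \<Gamma>"
    unfolding dim_H1_def quotient_dim_def
  proof (intro Sup_upper CollectI exI[of _ "?f ` I"] conjI refl allI impI)
    show "finite (?f ` I)" using fI by simp
    show "?f ` I \<subseteq> cocycles1 \<Gamma>" using bending_cocycle_in_cocycles1[OF \<Psi>] by blast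
    fix c assume "(\<lambda>g. \<Sum>s\<in>?f ` I. c s *\<^sub>R s g) \<in> coboundaries1 \<Gamma>"
    then have "(\<lambda>g. \<Sum>i\<in>I. c (?f i) *\<^sub>R ?f i g) \<in> coboundaries1 \<Gamma>"
      by (simp add: sum.reindex[OF inj])
    from key[OF this] show "\<forall>s\<in>?f ` I. c s = 0" by blast
  qed
  moreover have "card (?f ` I) = card I" using inj by (rule card_image)
  ultimately show ?thesis using cardI by (metis enat_ord_simps(1) order_trans)
qed

end

theorem theorem1p1:
  fixes \<Gamma> :: "'n::finite mink_mat set" and \<Delta> B :: "'n mink set set"
  assumes "CARD('n) \<ge> 3"
    and "torsion_free_lattice \<Gamma>"
    and "branched_hypersurface \<Gamma> \<Delta> B"
    and "\<And>\<delta>. \<delta> \<in> components (hyperboloid - lift \<Gamma> \<Delta>) \<Longrightarrow>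
           zariski_dense_in (set_stabilizer \<Gamma> \<delta>) (carrier SO_plus)"
  shows "ereal_of_enat (dim_H1 \<Gamma>) \<ge> ereal (real (num_walls \<Gamma> \<Delta> B) - 2 * real (num_bindings \<Gamma> B))"
proof -
  interpret branched_lattice \<Gamma> \<Delta> B
    using assms(2,3) by (intro branched_lattice.intro) (auto simp: torsion_free_lattice_def)
  have "enat (num_walls \<Gamma> \<Delta> B - 2 * num_bindings \<Gamma> B) \<le> dim_H1 \<Gamma>"
    using assms(1) by (intro dim_H1_lower_bound assms(4)) auto
  then have "ereal_of_enat (enat (num_walls \<Gamma> \<Delta> B - 2 * num_bindings \<Gamma> B)) \<le> ereal_of_enat (dim_H1 \<Gamma>)"
    by (simp only: ereal_of_enat_le_iff)
  moreover have "ereal (real (num_walls \<Gamma> \<Delta> B) - 2 * real (num_bindings \<Gamma> B)) \<le>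
      ereal_of_enat (enat (num_walls \<Gamma> \<Delta> B - 2 * num_bindings \<Gamma> B))"
    by simp
  ultimately show ?thesis by (rule order_trans[rotated])
qed

end
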